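(* Let $(M,g)$ be a compact Riemannian manifold and let $\mathcal F$ be an odd-codimensional (non-singular) Riemannian foliation with bounded holonomy on $(M,g)$. Then $M$ has a plane with nonpositive sectional curvature, i.e. there exist a point $p\in M$ and a $2$-plane in $T_pM$ whose sectional curvature (with respect to $g$) is nonpositive.
   Context: A foliation $\mathcal F$ on $(M,g)$ is Riemannian if its leaves are locally equidistant (equivalently, $\mathcal F$ is locally given by the fibers of a Riemannian submersion). All foliations are non-singular: all leaves have the same dimension. $\mathcal V$ denotes the bundle of vertical vectors (tangent to leaves), $\mathcal H=\mathcal V^\perp$ the bundle of horizontal vectors; superscripts $^v,{}^h$ denote orthogonal projections onto $\mathcal V,\mathcal H$; $\nabla$ is the Levi-Civita connection of $M$. For horizontal $X,Y$ and vertical $\xi$: $A_XY=\nabla^v_XY=\tfrac12[X,Y]^v$ (O'Neill tensor, with $X,Y$ extended to horizontal fields), $A_X^*:\mathcal V\to\mathcal H$ is its adjoint, $\langle A^*_X\xi,Y\rangle=\langle \xi,A_XY\rangle$, and $S_X\xi=-\nabla^v_\xi X$ (the shape operator of the leaves, self-adjoint on $\mathcal V$). A curve is horizontal if its velocity is everywhere in $\mathcal H$. A holonomy field along a (smooth) horizontal curve $c:[0,1]\to M$ is a vertical vector field $\xi$ along $c$ satisfying $\nabla_{\dot c}\xi=-A^*_{\dot c}\xi-S_{\dot c}\xi$. $\mathcal F$ has bounded holonomy if there is a constant $L$ such that $\|\xi(1)\|\le L\|\xi(0)\|$ for every holonomy field $\xi$ along every horizontal curve $c:[0,1]\to M$.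
   Formalization: The leaves are assumed to have positive dimension (and M to be nonempty); for the foliation by points the claim fails, e.g. on the round 3-sphere, where the codimension is 3, bounded holonomy is vacuous and all sectional curvatures are positive. *)

theory Defs
  imports "HOL-Analysis.Analysis"
begin

section \<open>Smooth maps between Euclidean spaces\<close>

text \<open>Only meant for open \<open>S\<close> in a Euclidean space.\<close>

primrec Ck_on :: "nat \<Rightarrow> 'a::real_normed_vector set \<Rightarrow> ('a \<Rightarrow> 'b::real_normed_vector) \<Rightarrow> bool" where
  "Ck_on 0 S f \<longleftrightarrow> continuous_on S f"
| "Ck_on (Suc n) S f \<longleftrightarrow>
     (\<forall>x\<in>S. f differentiable (at x)) \<and> (\<forall>v. Ck_on n S (\<lambda>x. frechet_derivative f (at x) v))"

definition smooth_on :: "'a::real_normed_vector set \<Rightarrow> ('a \<Rightarrow> 'b::real_normed_vector) \<Rightarrow> bool" where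
  "smooth_on S f \<longleftrightarrow> (\<forall>n. Ck_on n S f)"


section \<open>Smooth manifolds\<close>

text \<open>The manifold is the whole type \<open>'m\<close>. A chart is a domain together with a coordinate map;
  the values of the coordinate map off the domain are irrelevant.\<close>

type_synonym ('m, 'e) chart = "'m set \<times> ('m \<Rightarrow> 'e)"

abbreviation cdom :: "('m, 'e) chart \<Rightarrow> 'm set" where "cdom \<equiv> fst"
abbreviation cmap :: "('m, 'e) chart \<Rightarrow> 'm \<Rightarrow> 'e" where "cmap \<equiv> snd"

definition cimg :: "('m, 'e) chart \<Rightarrow> 'e set" where
  "cimg c = cmap c ` cdom c"

definition cinv :: "('m, 'e) chart \<Rightarrow> 'e \<Rightarrow> 'm" where
  "cinv c = inv_into (cdom c) (cmap c)"

definition is_chart :: "('m::topological_space, 'e::euclidean_space) chart \<Rightarrow> bool" where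
  "is_chart c \<longleftrightarrow> open (cdom c) \<and> open (cimg c) \<and> homeomorphism (cdom c) (cimg c) (cmap c) (cinv c)"

text \<open>The two charts may have different model spaces: the foliated charts below take values in a
  product of Euclidean spaces.\<close>

definition smoothly_compatible ::
    "('m, 'e::euclidean_space) chart \<Rightarrow> ('m, 'f::euclidean_space) chart \<Rightarrow> bool" where
  "smoothly_compatible c d \<longleftrightarrow>
     smooth_on (cmap c ` (cdom c \<inter> cdom d)) (cmap d \<circ> cinv c) \<and>
     smooth_on (cmap d ` (cdom c \<inter> cdom d)) (cmap c \<circ> cinv d)"

definition smooth_atlas :: "('m::topological_space, 'e::euclidean_space) chart set \<Rightarrow> bool" where
  "smooth_atlas A \<longleftrightarrow>
     (\<forall>c\<in>A. is_chart c) \<and> (\<Union>c\<in>A. cdom c) = UNIV \<and> (\<forall>c\<in>A. \<forall>d\<in>A. smoothly_compatible c d)"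

definition smooth_map_on ::
    "('m, 'e::euclidean_space) chart set \<Rightarrow> 'm set \<Rightarrow> ('m \<Rightarrow> 'f::euclidean_space) \<Rightarrow> bool" where
  "smooth_map_on A U f \<longleftrightarrow> (\<forall>c\<in>A. smooth_on (cmap c ` (cdom c \<inter> U)) (f \<circ> cinv c))"


section \<open>Tangent vectors\<close>

text \<open>For each point \<open>p\<close> one chart of the atlas around \<open>p\<close> is singled out, and a tangent vector at \<open>p\<close>
  is its component vector in that chart. So the tangent space at every point is the type \<open>'e\<close>,
  but components in any other chart are obtained by \<open>tdiff\<close>, and a
  coordinate vector of an arbitrary chart is turned into a tangent vector by \<open>tvec\<close>.\<close>

definition chart_at :: "('m, 'e) chart set \<Rightarrow> 'm \<Rightarrow> ('m, 'e) chart" where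
  "chart_at A p = (SOME c. c \<in> A \<and> p \<in> cdom c)"

text \<open>The differential at \<open>p\<close> of a map defined near \<open>p\<close>. With \<open>f = cmap d\<close> it gives the components
  of a tangent vector in the chart \<open>d\<close>.\<close>

definition tdiff ::
    "('m, 'e::euclidean_space) chart set \<Rightarrow> ('m \<Rightarrow> 'f::euclidean_space) \<Rightarrow> 'm \<Rightarrow> 'e \<Rightarrow> 'f" where
  "tdiff A f p =
     frechet_derivative (f \<circ> cinv (chart_at A p)) (at (cmap (chart_at A p) p))"

text \<open>The tangent vector at \<open>cinv c x\<close> with components \<open>u\<close> in the chart \<open>c\<close>.\<close>

definition tvec :: "('m, 'e::euclidean_space) chart set \<Rightarrow> ('m, 'e) chart \<Rightarrow> 'e \<Rightarrow> 'e \<Rightarrow> 'e" where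
  "tvec A c x = frechet_derivative (cmap (chart_at A (cinv c x)) \<circ> cinv c) (at x)"

text \<open>The component function in the chart \<open>c\<close> of a vector field \<open>X\<close>, where \<open>X p\<close> is a tangent
  vector at \<open>p\<close>.\<close>

definition field_in_chart ::
    "('m, 'e::euclidean_space) chart set \<Rightarrow> ('m, 'e) chart \<Rightarrow> ('m \<Rightarrow> 'e) \<Rightarrow> 'e \<Rightarrow> 'e" where
  "field_in_chart A c X x = tdiff A (cmap c) (cinv c x) (X (cinv c x))"

definition smooth_field_on ::
    "('m, 'e::euclidean_space) chart set \<Rightarrow> 'm set \<Rightarrow> ('m \<Rightarrow> 'e) \<Rightarrow> bool" where
  "smooth_field_on A U X \<longleftrightarrow> (\<forall>c\<in>A. smooth_on (cmap c ` (cdom c \<inter> U)) (field_in_chart A c X))"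


section \<open>Riemannian metrics, Levi-Civita connection, sectional curvature\<close>

definition inner_product :: "('e::euclidean_space \<Rightarrow> 'e \<Rightarrow> real) \<Rightarrow> bool" where
  "inner_product B \<longleftrightarrow> bilinear B \<and> (\<forall>u v. B u v = B v u) \<and> (\<forall>u. u \<noteq> 0 \<longrightarrow> B u u > 0)"

text \<open>Riemannian metrics on an open subset of a Euclidean space.\<close>

definition metric_on :: "'e::euclidean_space set \<Rightarrow> ('e \<Rightarrow> 'e \<Rightarrow> 'e \<Rightarrow> real) \<Rightarrow> bool" where
  "metric_on S G \<longleftrightarrow> (\<forall>x\<in>S. inner_product (G x)) \<and> (\<forall>u v. smooth_on S (\<lambda>x. G x u v))"

definition metric_in_chart ::
    "('m, 'e::euclidean_space) chart set \<Rightarrow> ('m \<Rightarrow> 'e \<Rightarrow> 'e \<Rightarrow> real) \<Rightarrow> ('m, 'e) chart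
      \<Rightarrow> 'e \<Rightarrow> 'e \<Rightarrow> 'e \<Rightarrow> real" where
  "metric_in_chart A g c x u v = g (cinv c x) (tvec A c x u) (tvec A c x v)"

definition riemannian_metric ::
    "('m, 'e::euclidean_space) chart set \<Rightarrow> ('m \<Rightarrow> 'e \<Rightarrow> 'e \<Rightarrow> real) \<Rightarrow> bool" where
  "riemannian_metric A g \<longleftrightarrow>
     (\<forall>p. inner_product (g p)) \<and> (\<forall>c\<in>A. metric_on (cimg c) (metric_in_chart A g c))"

text \<open>The Christoffel symbols of a metric \<open>G\<close> on an open set as a vector-valued bilinear map: the
  Koszul formula for coordinate fields, which commute.\<close>

definition christoffel :: "('e::euclidean_space \<Rightarrow> 'e \<Rightarrow> 'e \<Rightarrow> real) \<Rightarrow> 'e \<Rightarrow> 'e \<Rightarrow> 'e \<Rightarrow> 'e" where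
  "christoffel G x u v = (THE w. \<forall>z. 2 * G x w z =
       frechet_derivative (\<lambda>y. G y v z) (at x) u
     + frechet_derivative (\<lambda>y. G y u z) (at x) v
     - frechet_derivative (\<lambda>y. G y u v) (at x) z)"

text \<open>Curvature tensor with the sign convention
  \<open>R(X,Y)Z = \<nabla>\<^sub>X\<nabla>\<^sub>YZ - \<nabla>\<^sub>Y\<nabla>\<^sub>XZ - \<nabla>\<^bsub>[X,Y]\<^esub>Z\<close>.\<close>

definition curvature :: "('e::euclidean_space \<Rightarrow> 'e \<Rightarrow> 'e \<Rightarrow> real) \<Rightarrow> 'e \<Rightarrow> 'e \<Rightarrow> 'e \<Rightarrow> 'e \<Rightarrow> 'e" where
  "curvature G x u v w =
       frechet_derivative (\<lambda>y. christoffel G y v w) (at x) u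
     - frechet_derivative (\<lambda>y. christoffel G y u w) (at x) v
     + christoffel G x u (christoffel G x v w)
     - christoffel G x v (christoffel G x u w)"

text \<open>Sectional curvature of the plane spanned by linearly independent tangent vectors \<open>u\<close>, \<open>v\<close>
  at \<open>p\<close>.\<close>

definition sectional_curvature ::
    "('m, 'e::euclidean_space) chart set \<Rightarrow> ('m \<Rightarrow> 'e \<Rightarrow> 'e \<Rightarrow> real) \<Rightarrow> 'm \<Rightarrow> 'e \<Rightarrow> 'e \<Rightarrow> real" where
  "sectional_curvature A g p u v =
     (let c = chart_at A p; R = curvature (metric_in_chart A g c) (cmap c p)
      in g p (R u v v) u / (g p u u * g p v v - (g p u v)\<^sup>2))"

text \<open>Levi-Civita covariant derivative at \<open>p\<close> of a vector field in the direction \<open>u\<close>.\<close>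

definition nabla ::
    "('m, 'e::euclidean_space) chart set \<Rightarrow> ('m \<Rightarrow> 'e \<Rightarrow> 'e \<Rightarrow> real) \<Rightarrow> 'm \<Rightarrow> 'e \<Rightarrow> ('m \<Rightarrow> 'e) \<Rightarrow> 'e" where
  "nabla A g p u X =
     (let c = chart_at A p; x = cmap c p
      in frechet_derivative (field_in_chart A c X) (at x) u
         + christoffel (metric_in_chart A g c) x u (X p))"


section \<open>Curves\<close>

text \<open>A smooth curve on \<open>[0,1]\<close> is one with a smooth extension to an open neighbourhood of \<open>[0,1]\<close>;
  the extension is part of the function, but is not subject to further conditions.\<close>

definition smooth_curve ::
    "('m::topological_space, 'e::euclidean_space) chart set \<Rightarrow> (real \<Rightarrow> 'm) \<Rightarrow> bool" where
  "smooth_curve A \<gamma> \<longleftrightarrow> (\<exists>T. open T \<and> {0..1} \<subseteq> T \<and> continuous_on T \<gamma> \<and>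
     (\<forall>c\<in>A. smooth_on (T \<inter> \<gamma> -` cdom c) (cmap c \<circ> \<gamma>)))"

definition velocity ::
    "('m, 'e::euclidean_space) chart set \<Rightarrow> (real \<Rightarrow> 'm) \<Rightarrow> real \<Rightarrow> 'e" where
  "velocity A \<gamma> t = vector_derivative (cmap (chart_at A (\<gamma> t)) \<circ> \<gamma>) (at t)"

text \<open>\<open>\<xi>\<close> is a vector field along \<open>\<gamma>\<close> on \<open>[0,1]\<close>, and \<open>w\<close> its covariant derivative at time \<open>t\<close>
  (one-sided at the end points).\<close>

definition has_covariant_derivative ::
    "('m, 'e::euclidean_space) chart set \<Rightarrow> ('m \<Rightarrow> 'e \<Rightarrow> 'e \<Rightarrow> real)
      \<Rightarrow> (real \<Rightarrow> 'm) \<Rightarrow> (real \<Rightarrow> 'e) \<Rightarrow> 'e \<Rightarrow> real \<Rightarrow> bool" where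
  "has_covariant_derivative A g \<gamma> \<xi> w t \<longleftrightarrow>
     (let c = chart_at A (\<gamma> t)
      in ((\<lambda>s. tdiff A (cmap c) (\<gamma> s) (\<xi> s)) has_vector_derivative
            (w - christoffel (metric_in_chart A g c) (cmap c (\<gamma> t)) (velocity A \<gamma> t) (\<xi> t)))
         (at t within {0..1}))"


section \<open>Riemannian foliations\<close>

text \<open>A foliation is given by a foliated atlas, with leaf dimension \<open>DIM('v)\<close> and codimension
  \<open>DIM('h)\<close>. The plaques of a foliated chart \<open>\<phi>\<close> are the fibres of \<open>snd \<circ> cmap \<phi>\<close>; the leaves are
  obtained by gluing plaques, which is consistent because changes of foliated charts locally have
  the form \<open>(a, b) \<mapsto> (\<beta> (a, b), \<gamma> b)\<close>. The dimensions are positive, since a Euclidean space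
  type always is nonzero; in particular foliations by points are excluded.\<close>

definition foliation ::
    "('m::topological_space, 'e::euclidean_space) chart set
      \<Rightarrow> ('m, 'v::euclidean_space \<times> 'h::euclidean_space) chart set \<Rightarrow> bool" where
  "foliation A F \<longleftrightarrow>
     (\<forall>\<phi>\<in>F. is_chart \<phi> \<and> (\<forall>c\<in>A. smoothly_compatible c \<phi>) \<and>
        (\<exists>P Q. connected P \<and> connected Q \<and> cimg \<phi> = P \<times> Q)) \<and>
     (\<Union>\<phi>\<in>F. cdom \<phi>) = UNIV \<and>
     (\<forall>\<phi>\<in>F. \<forall>\<psi>\<in>F. \<forall>p \<in> cdom \<phi> \<inter> cdom \<psi>. \<exists>W \<gamma>. open W \<and> p \<in> W \<and> W \<subseteq> cdom \<phi> \<inter> cdom \<psi> \<and>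
        (\<forall>q\<in>W. snd (cmap \<psi> q) = \<gamma> (snd (cmap \<phi> q))))"

text \<open>Tangent space at \<open>p\<close> of the plaque, hence of the leaf, through \<open>p\<close>.\<close>

definition vertical ::
    "('m, 'e::euclidean_space) chart set
      \<Rightarrow> ('m, 'v::euclidean_space \<times> 'h::euclidean_space) chart set \<Rightarrow> 'm \<Rightarrow> 'e set" where
  "vertical A F p = {u. \<exists>\<phi>\<in>F. p \<in> cdom \<phi> \<and> tdiff A (snd \<circ> cmap \<phi>) p u = 0}"

definition horizontal ::
    "('m, 'e::euclidean_space) chart set \<Rightarrow> ('m \<Rightarrow> 'e \<Rightarrow> 'e \<Rightarrow> real)
      \<Rightarrow> ('m, 'v::euclidean_space \<times> 'h::euclidean_space) chart set \<Rightarrow> 'm \<Rightarrow> 'e set" where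
  "horizontal A g F p = {u. \<forall>v \<in> vertical A F p. g p u v = 0}"

definition vproj ::
    "('m, 'e::euclidean_space) chart set \<Rightarrow> ('m \<Rightarrow> 'e \<Rightarrow> 'e \<Rightarrow> real)
      \<Rightarrow> ('m, 'v::euclidean_space \<times> 'h::euclidean_space) chart set \<Rightarrow> 'm \<Rightarrow> 'e \<Rightarrow> 'e" where
  "vproj A g F p u = (THE v. v \<in> vertical A F p \<and> u - v \<in> horizontal A g F p)"

text \<open>\<open>f\<close> is a Riemannian submersion from the open set \<open>U\<close> onto \<open>(f ` U, k)\<close>.\<close>

definition riemannian_submersion ::
    "('m, 'e::euclidean_space) chart set \<Rightarrow> ('m \<Rightarrow> 'e \<Rightarrow> 'e \<Rightarrow> real)
      \<Rightarrow> 'm set \<Rightarrow> ('m \<Rightarrow> 'h::euclidean_space) \<Rightarrow> ('h \<Rightarrow> 'h \<Rightarrow> 'h \<Rightarrow> real) \<Rightarrow> bool" where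
  "riemannian_submersion A g U f k \<longleftrightarrow>
     smooth_map_on A U f \<and> open (f ` U) \<and> metric_on (f ` U) k \<and>
     (\<forall>p\<in>U. surj (tdiff A f p) \<and>
        (\<forall>u w. (\<forall>z. tdiff A f p z = 0 \<longrightarrow> g p u z = 0 \<and> g p w z = 0) \<longrightarrow>
           k (f p) (tdiff A f p u) (tdiff A f p w) = g p u w))"

definition riemannian_foliation ::
    "('m::topological_space, 'e::euclidean_space) chart set \<Rightarrow> ('m \<Rightarrow> 'e \<Rightarrow> 'e \<Rightarrow> real)
      \<Rightarrow> ('m, 'v::euclidean_space \<times> 'h::euclidean_space) chart set \<Rightarrow> bool" where
  "riemannian_foliation A g F \<longleftrightarrow> foliation A F \<and>
     (\<forall>p. \<exists>\<phi>\<in>F. \<exists>U k. open U \<and> p \<in> U \<and> U \<subseteq> cdom \<phi> \<and>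
        riemannian_submersion A g U (snd \<circ> cmap \<phi>) k)"


section \<open>O'Neill tensor, shape operator, holonomy\<close>

text \<open>The vertical part of \<open>\<nabla>\<^sub>u X\<close> for horizontal \<open>X\<close>, where \<open>X\<close> is extended to a smooth horizontal
  field near \<open>p\<close>. It is tensorial in \<open>X\<close>, so all extensions give the same value.\<close>

definition vnabla ::
    "('m::topological_space, 'e::euclidean_space) chart set \<Rightarrow> ('m \<Rightarrow> 'e \<Rightarrow> 'e \<Rightarrow> real)
      \<Rightarrow> ('m, 'v::euclidean_space \<times> 'h::euclidean_space) chart set \<Rightarrow> 'm \<Rightarrow> 'e \<Rightarrow> 'e \<Rightarrow> 'e" where
  "vnabla A g F p u X = (THE a. \<exists>X' W. open W \<and> p \<in> W \<and> smooth_field_on A W X' \<and>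
     (\<forall>q\<in>W. X' q \<in> horizontal A g F q) \<and> X' p = X \<and> a = vproj A g F p (nabla A g p u X'))"

text \<open>O'Neill tensor of horizontal vectors \<open>X\<close>, \<open>Y\<close>.\<close>

definition oneill ::
    "('m::topological_space, 'e::euclidean_space) chart set \<Rightarrow> ('m \<Rightarrow> 'e \<Rightarrow> 'e \<Rightarrow> real)
      \<Rightarrow> ('m, 'v::euclidean_space \<times> 'h::euclidean_space) chart set \<Rightarrow> 'm \<Rightarrow> 'e \<Rightarrow> 'e \<Rightarrow> 'e" where
  "oneill A g F p X Y = vnabla A g F p X Y"

definition oneill_adjoint ::
    "('m::topological_space, 'e::euclidean_space) chart set \<Rightarrow> ('m \<Rightarrow> 'e \<Rightarrow> 'e \<Rightarrow> real)
      \<Rightarrow> ('m, 'v::euclidean_space \<times> 'h::euclidean_space) chart set \<Rightarrow> 'm \<Rightarrow> 'e \<Rightarrow> 'e \<Rightarrow> 'e" where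
  "oneill_adjoint A g F p X \<xi> = (THE w. w \<in> horizontal A g F p \<and>
     (\<forall>Y \<in> horizontal A g F p. g p w Y = g p \<xi> (oneill A g F p X Y)))"

text \<open>Shape operator of the leaves in the horizontal direction \<open>X\<close>, applied to a vertical \<open>\<xi>\<close>.\<close>

definition shape ::
    "('m::topological_space, 'e::euclidean_space) chart set \<Rightarrow> ('m \<Rightarrow> 'e \<Rightarrow> 'e \<Rightarrow> real)
      \<Rightarrow> ('m, 'v::euclidean_space \<times> 'h::euclidean_space) chart set \<Rightarrow> 'm \<Rightarrow> 'e \<Rightarrow> 'e \<Rightarrow> 'e" where
  "shape A g F p X \<xi> = - vnabla A g F p \<xi> X"

definition horizontal_curve ::
    "('m::topological_space, 'e::euclidean_space) chart set \<Rightarrow> ('m \<Rightarrow> 'e \<Rightarrow> 'e \<Rightarrow> real)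
      \<Rightarrow> ('m, 'v::euclidean_space \<times> 'h::euclidean_space) chart set \<Rightarrow> (real \<Rightarrow> 'm) \<Rightarrow> bool" where
  "horizontal_curve A g F \<gamma> \<longleftrightarrow>
     smooth_curve A \<gamma> \<and> (\<forall>t\<in>{0..1}. velocity A \<gamma> t \<in> horizontal A g F (\<gamma> t))"

definition holonomy_field ::
    "('m::topological_space, 'e::euclidean_space) chart set \<Rightarrow> ('m \<Rightarrow> 'e \<Rightarrow> 'e \<Rightarrow> real)
      \<Rightarrow> ('m, 'v::euclidean_space \<times> 'h::euclidean_space) chart set
      \<Rightarrow> (real \<Rightarrow> 'm) \<Rightarrow> (real \<Rightarrow> 'e) \<Rightarrow> bool" where
  "holonomy_field A g F \<gamma> \<xi> \<longleftrightarrow> (\<forall>t\<in>{0..1}. \<xi> t \<in> vertical A F (\<gamma> t) \<and>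
     has_covariant_derivative A g \<gamma> \<xi>
       (- oneill_adjoint A g F (\<gamma> t) (velocity A \<gamma> t) (\<xi> t)
        - shape A g F (\<gamma> t) (velocity A \<gamma> t) (\<xi> t)) t)"

definition bounded_holonomy ::
    "('m::topological_space, 'e::euclidean_space) chart set \<Rightarrow> ('m \<Rightarrow> 'e \<Rightarrow> 'e \<Rightarrow> real)
      \<Rightarrow> ('m, 'v::euclidean_space \<times> 'h::euclidean_space) chart set \<Rightarrow> bool" where
  "bounded_holonomy A g F \<longleftrightarrow> (\<exists>L. \<forall>\<gamma> \<xi>. horizontal_curve A g F \<gamma> \<longrightarrow> holonomy_field A g F \<gamma> \<xi> \<longrightarrow>
     sqrt (g (\<gamma> 1) (\<xi> 1) (\<xi> 1)) \<le> L * sqrt (g (\<gamma> 0) (\<xi> 0) (\<xi> 0)))"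

end

theory Submission
  imports Defs
begin

text \<open>Along a horizontal curve with velocity field \<open>X\<close> (the horizontal lift of a constant vector of
  the local base) a dual holonomy field \<open>\<nu>\<close> satisfies \<open>\<nabla>\<^sub>X\<nu> = - A\<^sup>*\<^sub>X\<nu> + S\<^sub>X\<nu>\<close>, so its inner product with
  every holonomy field is constant; if holonomy is bounded by \<open>L\<close>, its length grows at most by the
  factor \<open>L\<close>. Hence the supremum of the lengths of all dual holonomy fields with a given
  initial value is finite, and by compactness there is a vertical vector \<open>\<nu>\<close> at some point that is a
  limit of values of such fields and whose length is that supremum. There the length cannot increase in
  any horizontal direction. The first variation gives \<open>\<langle>S\<^sub>Y\<nu>, \<nu>\<rangle> = 0\<close> for all horizontal \<open>Y\<close>, and then
  half of the second variation of \<open>\<parallel>\<nu>\<parallel>\<^sup>2\<close> in direction \<open>X\<close> is \<open>K(X, \<nu>) + 3 \<parallel>S\<^sub>X\<nu>\<parallel>\<^sup>2 - \<parallel>A\<^sup>*\<^sub>X\<nu>\<parallel>\<^sup>2\<close>, where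
  \<open>K\<close> is the unnormalised sectional curvature. As \<open>X \<mapsto> A\<^sup>*\<^sub>X\<nu>\<close> is skew and the codimension is odd, some
  \<open>X \<noteq> 0\<close> has \<open>A\<^sup>*\<^sub>X\<nu> = 0\<close>, so \<open>K(X, \<nu>) \<le> 0\<close>.\<close>

section \<open>Calculus of maps of class \<open>C\<^sup>k\<close>\<close>

text \<open>Dual lengths are controlled through reversed curves: \<open>dual_related\<close> asks
  that every vertical vector at the end be carried back with the pairing preserved, and mentions no
  dual field. Dual fields occur only locally, along integral curves of a basic field X, where the
  holonomy equation reads \<xi>' = dX(\<xi>) in coordinates. Pieces are joined by
  \<open>transport_trans\<close>; since curves must stay smooth, each piece is first brought to rest
  near its ends by a smooth step function.

  The obstacle is that the supremum need not be attained: the limit vector may fail to be the value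
  of a dual field. So the flow starts at the late vectors of a maximising sequence and runs for one
  time \<delta> common to all of them. The squared length and its first two derivatives are
  continuous functions of position and vector, and this carries the estimates to the limit.

  Christoffel symbols and horizontal lifts are solutions of positive definite linear systems; their
  smoothness comes from differentiating the system.\<close>

abbreviation fd :: "('a::real_normed_vector \<Rightarrow> 'b::real_normed_vector) \<Rightarrow> 'a \<Rightarrow> 'a \<Rightarrow> 'b" where
  "fd f x \<equiv> frechet_derivative f (at x)"

lemma fd_works: "f differentiable (at x) \<Longrightarrow> (f has_derivative fd f x) (at x)"
  by (simp add: frechet_derivative_works[symmetric])

lemma fd_eq: "(f has_derivative f') (at x) \<Longrightarrow> fd f x = f'"
  using frechet_derivative_at by metis

lemma fd_linear: "f differentiable (at x) \<Longrightarrow> linear (fd f x)"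
  by (rule linear_frechet_derivative)

lemma has_derivative_cong_open:
  assumes "open S" "x \<in> S" "\<And>y. y \<in> S \<Longrightarrow> f y = g y"
  shows "(f has_derivative f') (at x) \<longleftrightarrow> (g has_derivative f') (at x)"
  using assms by (metis has_derivative_transform_within_open)

lemma fd_cong:
  assumes "open S" "x \<in> S" "\<And>y. y \<in> S \<Longrightarrow> f y = g y"
  shows "fd f x = fd g x"
  unfolding frechet_derivative_def using has_derivative_cong_open[OF assms] by simp

lemma differentiable_cong_open:
  assumes "open S" "x \<in> S" "\<And>y. y \<in> S \<Longrightarrow> f y = g y"
  shows "f differentiable (at x) \<longleftrightarrow> g differentiable (at x)"
  unfolding differentiable_def using has_derivative_cong_open[OF assms] by simp

lemma Ck_on_cong:
  assumes "open S" "\<And>x. x \<in> S \<Longrightarrow> f x = g x" "Ck_on n S f"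
  shows "Ck_on n S g"
  using assms(2,3)
proof (induction n arbitrary: f g)
  case 0
  then show ?case using continuous_on_cong[of S S f g] by simp
next
  case (Suc n)
  have "g differentiable (at x)" if "x \<in> S" for x
    using Suc.prems that differentiable_cong_open[OF assms(1) that, of f g] by simp
  moreover have "Ck_on n S (\<lambda>x. fd g x v)" for v
  proof (rule Suc.IH)
    show "Ck_on n S (\<lambda>x. fd f x v)" using Suc.prems by simp
    show "fd f x v = fd g x v" if "x \<in> S" for x
      using fd_cong[OF assms(1) that, of f g] Suc.prems by simp
  qed
  ultimately show ?case by simp
qed

lemma Ck_on_subset: "Ck_on n S f \<Longrightarrow> T \<subseteq> S \<Longrightarrow> Ck_on n T f"
  by (induction n arbitrary: f) (auto intro: continuous_on_subset)

lemma Ck_on_SucD: "Ck_on (Suc n) S f \<Longrightarrow> Ck_on n S f"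
proof (induction n arbitrary: f)
  case 0
  then show ?case
    by (auto intro!: continuous_at_imp_continuous_on differentiable_imp_continuous_within)
next
  case (Suc n)
  have "Ck_on n S (\<lambda>x. fd f x v)" for v
    using Suc.prems by (intro Suc.IH) simp
  then show ?case using Suc.prems by simp
qed

lemma Ck_on_SucI:
  assumes "open S" "\<And>x. x \<in> S \<Longrightarrow> (f has_derivative f' x) (at x)" "\<And>v. Ck_on n S (\<lambda>x. f' x v)"
  shows "Ck_on (Suc n) S f"
proof -
  have "Ck_on n S (\<lambda>x. fd f x v)" for v
    by (rule Ck_on_cong[OF assms(1) _ assms(3)[of v]]) (simp add: fd_eq[OF assms(2)])
  then show ?thesis using assms(2) by (auto simp: differentiable_def)
qed

lemma Ck_on_Suc_works:
  "Ck_on (Suc n) S f \<Longrightarrow> x \<in> S \<Longrightarrow> (f has_derivative fd f x) (at x)"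
  by (simp add: fd_works)

lemma Ck_on_const [simp]: "Ck_on n S (\<lambda>x. c)"
  by (induction n arbitrary: c) auto

lemma Ck_on_bounded_linear:
  assumes "open S" "bounded_linear L" "Ck_on n S f"
  shows "Ck_on n S (\<lambda>x. L (f x))"
  using assms(3)
proof (induction n arbitrary: f)
  case 0
  then show ?case using assms(2) by (simp add: bounded_linear.continuous_on)
next
  case (Suc n)
  show ?case
  proof (rule Ck_on_SucI[OF assms(1), where f'="\<lambda>x v. L (fd f x v)"])
    show "((\<lambda>x. L (f x)) has_derivative (\<lambda>v. L (fd f x v))) (at x)" if "x \<in> S" for x
      by (rule bounded_linear.has_derivative[OF assms(2) Ck_on_Suc_works[OF Suc.prems that]])
    show "Ck_on n S (\<lambda>x. L (fd f x v))" for v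
      using Suc by simp
  qed
qed

lemma Ck_on_id: "open S \<Longrightarrow> Ck_on n S (\<lambda>x. x)"
proof (cases n)
  case (Suc m)
  assume "open S"
  then show ?thesis unfolding Suc
    by (rule Ck_on_SucI[where f'="\<lambda>x v. v"]) auto
qed (simp add: continuous_on_id)

lemma Ck_on_add:
  assumes "open S" "Ck_on n S f" "Ck_on n S g"
  shows "Ck_on n S (\<lambda>x. f x + g x)"
  using assms(2,3)
proof (induction n arbitrary: f g)
  case 0
  then show ?case by (auto intro: continuous_intros)
next
  case (Suc n)
  show ?case
  proof (rule Ck_on_SucI[OF assms(1), where f'="\<lambda>x v. fd f x v + fd g x v"])
    show "((\<lambda>x. f x + g x) has_derivative (\<lambda>v. fd f x v + fd g x v)) (at x)" if "x \<in> S" for x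
      using Ck_on_Suc_works[OF Suc.prems(1) that] Ck_on_Suc_works[OF Suc.prems(2) that]
      by (rule has_derivative_add)
    show "Ck_on n S (\<lambda>x. fd f x v + fd g x v)" for v
      using Suc by simp
  qed
qed

lemma Ck_on_bilinear:
  assumes "open S" "bounded_bilinear P" "Ck_on n S f" "Ck_on n S g"
  shows "Ck_on n S (\<lambda>x. P (f x) (g x))"
  using assms(3,4)
proof (induction n arbitrary: f g)
  case 0
  then show ?case using assms(2) by (simp add: bounded_bilinear.continuous_on)
next
  case (Suc n)
  note fg = Ck_on_SucD[OF Suc.prems(1)] Ck_on_SucD[OF Suc.prems(2)]
  show ?case
  proof (rule Ck_on_SucI[OF assms(1), where f'="\<lambda>x v. P (f x) (fd g x v) + P (fd f x v) (g x)"])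
    show "((\<lambda>x. P (f x) (g x)) has_derivative (\<lambda>v. P (f x) (fd g x v) + P (fd f x v) (g x))) (at x)"
      if "x \<in> S" for x
      using Ck_on_Suc_works[OF Suc.prems(1) that] Ck_on_Suc_works[OF Suc.prems(2) that]
      by (rule bounded_bilinear.FDERIV[OF assms(2)])
    show "Ck_on n S (\<lambda>x. P (f x) (fd g x v) + P (fd f x v) (g x))" for v
      using Suc fg by (intro Ck_on_add[OF assms(1)] Suc.IH) auto
  qed
qed

lemma Ck_on_sum:
  assumes "open S" "\<And>i. i \<in> I \<Longrightarrow> Ck_on n S (f i)"
  shows "Ck_on n S (\<lambda>x. \<Sum>i\<in>I. f i x)"
  using assms(2) by (induction I rule: infinite_finite_induct) (auto intro: Ck_on_add[OF assms(1)])

lemma linear_basis_sum: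
  fixes L :: "'a::euclidean_space \<Rightarrow> 'b::real_vector"
  assumes "linear L"
  shows "L u = (\<Sum>b\<in>Basis. (u \<bullet> b) *\<^sub>R L b)"
  using linear_sum[OF assms, of "\<lambda>b. (u \<bullet> b) *\<^sub>R b" Basis] linear_cmul[OF assms]
  by (simp add: euclidean_representation)

text \<open>Expanding the moving argument in a basis leaves a finite sum of products, so regularity
  for fixed arguments is enough.\<close>

lemma Ck_on_linear_family:
  fixes L :: "'c::real_normed_vector \<Rightarrow> 'a::euclidean_space \<Rightarrow> 'b::real_normed_vector"
  assumes "open S" "\<And>x. x \<in> S \<Longrightarrow> linear (L x)" "\<And>b. Ck_on n S (\<lambda>x. L x b)" "Ck_on n S u"
  shows "Ck_on n S (\<lambda>x. L x (u x))"
proof -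
  have "Ck_on n S (\<lambda>x. \<Sum>b\<in>Basis. (u x \<bullet> b) *\<^sub>R L x b)"
    by (intro Ck_on_sum[OF assms(1)] Ck_on_bilinear[OF assms(1) bounded_bilinear_scaleR]
        Ck_on_bounded_linear[OF assms(1) bounded_linear_inner_left] assms)
  then show ?thesis
    by (rule Ck_on_cong[OF assms(1), rotated]) (simp add: linear_basis_sum[OF assms(2), symmetric])
qed

text \<open>The induction runs over all outer maps at once: the chain rule produces the linear
  family \<open>fd f (g x)\<close>, and the induction hypothesis applies to its values on fixed
  vectors, with the same \<open>g\<close>.\<close>

lemma Ck_on_compose:
  fixes f :: "'a::euclidean_space \<Rightarrow> 'b::real_normed_vector" and g :: "'c::real_normed_vector \<Rightarrow> 'a"
  assumes "open S" "open T" "Ck_on n S f" "Ck_on n T g" "\<And>x. x \<in> T \<Longrightarrow> g x \<in> S"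
  shows "Ck_on n T (\<lambda>x. f (g x))"
  using assms(3,4)
proof (induction n arbitrary: f)
  case 0
  then show ?case using assms(5) by (auto intro: continuous_on_compose2)
next
  case (Suc n)
  note g = Ck_on_SucD[OF Suc.prems(2)]
  show ?case
  proof (rule Ck_on_SucI[OF assms(2), where f'="\<lambda>x v. fd f (g x) (fd g x v)"])
    show "((\<lambda>x. f (g x)) has_derivative (\<lambda>v. fd f (g x) (fd g x v))) (at x)" if "x \<in> T" for x
      by (rule has_derivative_compose[OF Ck_on_Suc_works[OF Suc.prems(2) that]
            Ck_on_Suc_works[OF Suc.prems(1) assms(5)[OF that]]])
    show "Ck_on n T (\<lambda>x. fd f (g x) (fd g x v))" for v
    proof (rule Ck_on_linear_family[OF assms(2), where L="\<lambda>x. fd f (g x)"])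
      show "linear (fd f (g x))" if "x \<in> T" for x
        using Suc.prems(1) assms(5)[OF that] by (simp add: fd_linear)
      show "Ck_on n T (\<lambda>x. fd f (g x) b)" for b
        using Suc.IH[of "\<lambda>x. fd f x b"] Suc.prems g by simp
    qed (use Suc.prems in simp)
  qed
qed

lemma Ck_on_local:
  assumes "\<And>x. x \<in> S \<Longrightarrow> \<exists>U. open U \<and> x \<in> U \<and> Ck_on n U f"
  shows "Ck_on n S f"
  using assms
proof (induction n arbitrary: f)
  case 0
  show ?case unfolding Ck_on.simps
  proof (rule continuous_at_imp_continuous_on, rule ballI)
    fix x assume "x \<in> S"
    then obtain U where "open U" "x \<in> U" "Ck_on 0 U f" using 0 by blast
    then show "isCont f x" by (simp add: continuous_on_eq_continuous_at)
  qed
next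
  case (Suc n)
  have "f differentiable (at x)" if "x \<in> S" for x using Suc.prems[OF that] by auto
  moreover have "Ck_on n S (\<lambda>x. fd f x v)" for v
    by (rule Suc.IH) (use Suc.prems in fastforce)
  ultimately show ?case by simp
qed

subsection \<open>Smooth maps\<close>

lemma smooth_onI: "(\<And>n. Ck_on n S f) \<Longrightarrow> smooth_on S f"
  by (simp add: smooth_on_def)

lemma smooth_onD: "smooth_on S f \<Longrightarrow> Ck_on n S f"
  by (simp add: smooth_on_def)

lemma smooth_on_differentiable: "smooth_on S f \<Longrightarrow> x \<in> S \<Longrightarrow> f differentiable (at x)"
  using smooth_onD[of S f 1] by simp

lemma smooth_on_works: "smooth_on S f \<Longrightarrow> x \<in> S \<Longrightarrow> (f has_derivative fd f x) (at x)"
  by (rule fd_works[OF smooth_on_differentiable])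

lemma smooth_on_fd_linear: "smooth_on S f \<Longrightarrow> x \<in> S \<Longrightarrow> linear (fd f x)"
  by (rule fd_linear[OF smooth_on_differentiable])

lemma smooth_on_continuous: "smooth_on S f \<Longrightarrow> continuous_on S f"
  using smooth_onD[of S f 0] by simp

lemma smooth_on_cong:
  "smooth_on S f \<Longrightarrow> open S \<Longrightarrow> (\<And>x. x \<in> S \<Longrightarrow> f x = g x) \<Longrightarrow> smooth_on S g"
  by (rule smooth_onI, rule Ck_on_cong[OF _ _ smooth_onD])

lemma smooth_on_subset: "smooth_on S f \<Longrightarrow> T \<subseteq> S \<Longrightarrow> smooth_on T f"
  by (rule smooth_onI, rule Ck_on_subset[OF smooth_onD])

lemma smooth_on_local:
  assumes "\<And>x. x \<in> S \<Longrightarrow> \<exists>U. open U \<and> x \<in> U \<and> smooth_on U f"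
  shows "smooth_on S f"
  by (rule smooth_onI, rule Ck_on_local) (metis assms smooth_onD)

lemma smooth_on_compose:
  fixes f :: "'a::euclidean_space \<Rightarrow> 'b::real_normed_vector" and g :: "'c::real_normed_vector \<Rightarrow> 'a"
  assumes "open S" "open T" "smooth_on S f" "smooth_on T g" "\<And>x. x \<in> T \<Longrightarrow> g x \<in> S"
  shows "smooth_on T (\<lambda>x. f (g x))"
  by (rule smooth_onI, rule Ck_on_compose[OF assms(1,2) smooth_onD[OF assms(3)] smooth_onD[OF assms(4)] assms(5)])

named_theorems smooth_intros

lemma smooth_on_const [smooth_intros]: "smooth_on S (\<lambda>x. c)"
  by (simp add: smooth_on_def)

lemma smooth_on_id [smooth_intros]: "open S \<Longrightarrow> smooth_on S (\<lambda>x. x)"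
  by (simp add: smooth_on_def Ck_on_id)

lemma smooth_on_bounded_linear:
  "open S \<Longrightarrow> bounded_linear L \<Longrightarrow> smooth_on S f \<Longrightarrow> smooth_on S (\<lambda>x. L (f x))"
  by (simp add: smooth_on_def Ck_on_bounded_linear)

lemma smooth_on_bilinear:
  "open S \<Longrightarrow> bounded_bilinear P \<Longrightarrow> smooth_on S f \<Longrightarrow> smooth_on S g \<Longrightarrow> smooth_on S (\<lambda>x. P (f x) (g x))"
  by (simp add: smooth_on_def Ck_on_bilinear)

lemma smooth_on_add [smooth_intros]:
  "open S \<Longrightarrow> smooth_on S f \<Longrightarrow> smooth_on S g \<Longrightarrow> smooth_on S (\<lambda>x. f x + g x)"
  by (simp add: smooth_on_def Ck_on_add)

lemma smooth_on_uminus [smooth_intros]: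
  "open S \<Longrightarrow> smooth_on S f \<Longrightarrow> smooth_on S (\<lambda>x. - f x)"
  by (rule smooth_on_bounded_linear[OF _ bounded_linear_minus[OF bounded_linear_ident]])

lemma smooth_on_diff [smooth_intros]:
  "open S \<Longrightarrow> smooth_on S f \<Longrightarrow> smooth_on S g \<Longrightarrow> smooth_on S (\<lambda>x. f x - g x)"
  using smooth_on_add[of S f "\<lambda>x. - g x"] smooth_on_uminus[of S g] by simp

lemma smooth_on_scaleR [smooth_intros]:
  "open S \<Longrightarrow> smooth_on S f \<Longrightarrow> smooth_on S g \<Longrightarrow> smooth_on S (\<lambda>x. f x *\<^sub>R g x)"
  by (rule smooth_on_bilinear[OF _ bounded_bilinear_scaleR])

lemma smooth_on_mult [smooth_intros]:
  fixes f g :: "'a::real_normed_vector \<Rightarrow> real"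
  shows "open S \<Longrightarrow> smooth_on S f \<Longrightarrow> smooth_on S g \<Longrightarrow> smooth_on S (\<lambda>x. f x * g x)"
  by (rule smooth_on_bilinear[OF _ bounded_bilinear_mult])

lemma smooth_on_Pair [smooth_intros]:
  fixes f :: "'a::real_normed_vector \<Rightarrow> 'b::real_normed_vector" and g :: "'a \<Rightarrow> 'c::real_normed_vector"
  assumes "open S" "smooth_on S f" "smooth_on S g" 
  shows "smooth_on S (\<lambda>x. (f x, g x))"
proof -
  have "smooth_on S (\<lambda>x. (f x, 0) + (0, g x))"
    by (intro smooth_on_add assms smooth_on_bounded_linear[where L="\<lambda>u. (u, 0)"]
        smooth_on_bounded_linear[where L="\<lambda>u. (0, u)"] bounded_linear_Pair bounded_linear_ident bounded_linear_zero)
  then show ?thesis by simp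
qed

lemma smooth_on_fst [smooth_intros]: "open S \<Longrightarrow> smooth_on S f \<Longrightarrow> smooth_on S (\<lambda>x. fst (f x))"
  by (rule smooth_on_bounded_linear[OF _ bounded_linear_fst])

lemma smooth_on_snd [smooth_intros]: "open S \<Longrightarrow> smooth_on S f \<Longrightarrow> smooth_on S (\<lambda>x. snd (f x))"
  by (rule smooth_on_bounded_linear[OF _ bounded_linear_snd])

lemma smooth_on_fd_const: "smooth_on S f \<Longrightarrow> smooth_on S (\<lambda>x. fd f x v)"
  by (rule smooth_onI) (use smooth_onD[of S f "Suc _"] in simp)

lemma smooth_on_linear_family:
  fixes L :: "'c::real_normed_vector \<Rightarrow> 'a::euclidean_space \<Rightarrow> 'b::real_normed_vector"
  assumes "open S" "\<And>x. x \<in> S \<Longrightarrow> linear (L x)" "\<And>b. smooth_on S (\<lambda>x. L x b)" "smooth_on S u"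
  shows "smooth_on S (\<lambda>x. L x (u x))"
  by (rule smooth_onI, rule Ck_on_linear_family[OF assms(1,2) smooth_onD[OF assms(3)] smooth_onD[OF assms(4)]])

lemma smooth_on_fd:
  fixes f :: "'a::euclidean_space \<Rightarrow> 'b::real_normed_vector"
  assumes "open S" "smooth_on S f" "smooth_on S v"
  shows "smooth_on S (\<lambda>x. fd f x (v x))"
  by (rule smooth_on_linear_family[where L="\<lambda>x. fd f x", OF assms(1) smooth_on_fd_linear[OF assms(2)]
        smooth_on_fd_const[OF assms(2)] assms(3)])

lemma smooth_on_bilinear_family:
  fixes B :: "'c::real_normed_vector \<Rightarrow> 'a::euclidean_space \<Rightarrow> 'a2::euclidean_space \<Rightarrow> 'b::real_normed_vector"
  assumes "open S" "\<And>x. x \<in> S \<Longrightarrow> bilinear (B x)" "\<And>b c. smooth_on S (\<lambda>x. B x b c)"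
    "smooth_on S u" "smooth_on S v"
  shows "smooth_on S (\<lambda>x. B x (u x) (v x))"
proof (rule smooth_on_linear_family[where L="\<lambda>x a. B x a (v x)", OF assms(1) _ _ assms(4)])
  show "linear (\<lambda>a. B x a (v x))" if "x \<in> S" for x
    using assms(2)[OF that] by (simp add: bilinear_def)
  show "smooth_on S (\<lambda>x. B x b (v x))" for b
  proof (rule smooth_on_linear_family[where L="\<lambda>x. B x b", OF assms(1) _ assms(3,5)])
    show "linear (B x b)" if "x \<in> S" for x
      using assms(2)[OF that] by (simp add: bilinear_def)
  qed
qed

subsection \<open>Derivatives of linear and bilinear families\<close>

text \<open>A Leibniz rule in which the vector \<open>u x\<close> is frozen in the first term.
  Second derivatives and derivatives of Christoffel symbols enter later computations in exactly this
  shape.\<close>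

lemma has_derivative_linear_family:
  fixes L :: "'c::real_normed_vector \<Rightarrow> 'a::euclidean_space \<Rightarrow> 'b::real_normed_vector"
  assumes "open S" "x \<in> S" "\<And>x. x \<in> S \<Longrightarrow> linear (L x)" "\<And>b. (\<lambda>y. L y b) differentiable (at x)"
    and u: "(u has_derivative u') (at x)"
  shows "((\<lambda>y. L y (u y)) has_derivative (\<lambda>w. fd (\<lambda>y. L y (u x)) x w + L x (u' w))) (at x)"
proof -
  have d: "((\<lambda>y. L y b) has_derivative fd (\<lambda>y. L y b) x) (at x)" for b
    using assms(4) by (rule fd_works)
  have "((\<lambda>y. \<Sum>b\<in>Basis. (u x \<bullet> b) *\<^sub>R L y b) has_derivative
      (\<lambda>w. \<Sum>b\<in>Basis. (u x \<bullet> b) *\<^sub>R fd (\<lambda>y. L y b) x w)) (at x)"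
    by (intro has_derivative_sum has_derivative_scaleR_right d)
  then have "((\<lambda>y. L y (u x)) has_derivative
      (\<lambda>w. \<Sum>b\<in>Basis. (u x \<bullet> b) *\<^sub>R fd (\<lambda>y. L y b) x w)) (at x)"
    by (subst has_derivative_cong_open[OF assms(1,2)]) (auto simp: linear_basis_sum[OF assms(3), symmetric])
  note e = fd_eq[OF this]
  have "((\<lambda>y. \<Sum>b\<in>Basis. (u y \<bullet> b) *\<^sub>R L y b) has_derivative
      (\<lambda>w. \<Sum>b\<in>Basis. (u x \<bullet> b) *\<^sub>R fd (\<lambda>y. L y b) x w + (u' w \<bullet> b) *\<^sub>R L x b)) (at x)"
    by (intro has_derivative_sum has_derivative_scaleR d has_derivative_inner_left u)
  moreover have "(\<lambda>w. \<Sum>b\<in>Basis. (u x \<bullet> b) *\<^sub>R fd (\<lambda>y. L y b) x w + (u' w \<bullet> b) *\<^sub>R L x b)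
     = (\<lambda>w. fd (\<lambda>y. L y (u x)) x w + L x (u' w))"
    by (auto simp: fun_eq_iff e sum.distrib linear_basis_sum[OF assms(3)[OF assms(2)], of "u' _"])
  ultimately show ?thesis
    by (subst has_derivative_cong_open[OF assms(1,2)]) (auto simp: linear_basis_sum[OF assms(3), symmetric])
qed

lemma linear_fd_family:
  fixes L :: "'c::real_normed_vector \<Rightarrow> 'a::real_vector \<Rightarrow> 'b::real_normed_vector"
  assumes "open S" "x \<in> S" "\<And>x. x \<in> S \<Longrightarrow> linear (L x)" "\<And>b. (\<lambda>y. L y b) differentiable (at x)"
  shows "linear (\<lambda>b. fd (\<lambda>y. L y b) x w)"
proof (rule linearI)
  fix a b
  have "((\<lambda>y. L y a + L y b) has_derivative (\<lambda>w. fd (\<lambda>y. L y a) x w + fd (\<lambda>y. L y b) x w)) (at x)"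
    by (intro has_derivative_add fd_works assms)
  then have "((\<lambda>y. L y (a + b)) has_derivative (\<lambda>w. fd (\<lambda>y. L y a) x w + fd (\<lambda>y. L y b) x w)) (at x)"
    by (subst has_derivative_cong_open[OF assms(1,2)]) (auto simp: linear_add[OF assms(3)])
  then show "fd (\<lambda>y. L y (a + b)) x w = fd (\<lambda>y. L y a) x w + fd (\<lambda>y. L y b) x w"
    by (simp add: fd_eq)
next
  fix r b
  have "((\<lambda>y. r *\<^sub>R L y b) has_derivative (\<lambda>w. r *\<^sub>R fd (\<lambda>y. L y b) x w)) (at x)"
    by (intro has_derivative_scaleR_right fd_works assms)
  then have "((\<lambda>y. L y (r *\<^sub>R b)) has_derivative (\<lambda>w. r *\<^sub>R fd (\<lambda>y. L y b) x w)) (at x)"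
    by (subst has_derivative_cong_open[OF assms(1,2)]) (auto simp: linear_cmul[OF assms(3)])
  then show "fd (\<lambda>y. L y (r *\<^sub>R b)) x w = r *\<^sub>R fd (\<lambda>y. L y b) x w"
    by (simp add: fd_eq)
qed

lemma has_derivative_bilinear_family:
  fixes B :: "'c::real_normed_vector \<Rightarrow> 'a::euclidean_space \<Rightarrow> 'a2::euclidean_space \<Rightarrow> 'b::real_normed_vector"
  assumes "open S" "x \<in> S" "\<And>x. x \<in> S \<Longrightarrow> bilinear (B x)" "\<And>b c. (\<lambda>y. B y b c) differentiable (at x)"
    and u: "(u has_derivative u') (at x)" and v: "(v has_derivative v') (at x)"
  shows "((\<lambda>y. B y (u y) (v y)) has_derivative
     (\<lambda>w. fd (\<lambda>y. B y (u x) (v x)) x w + B x (u' w) (v x) + B x (u x) (v' w))) (at x)"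
proof -
  have 1: "((\<lambda>y. B y a (v y)) has_derivative
     (\<lambda>w. fd (\<lambda>y. B y a (v x)) x w + B x a (v' w))) (at x)" for a
    using assms(3,4)
    by (intro has_derivative_linear_family[where L="\<lambda>y. B y a", OF assms(1,2) _ _ v]) (auto simp: bilinear_def)
  have "((\<lambda>y. B y (u y) (v y)) has_derivative
     (\<lambda>w. fd (\<lambda>y. B y (u x) (v y)) x w + B x (u' w) (v x))) (at x)"
    using assms(3,4) 1
    by (intro has_derivative_linear_family[where L="\<lambda>y a. B y a (v y)", OF assms(1,2) _ _ u])
      (auto simp: bilinear_def intro: differentiableI[OF 1])
  then show ?thesis unfolding fd_eq[OF 1] by (simp add: algebra_simps)
qed


text \<open>Continuity of one factor suffices when the other vanishes at \<open>x\<close>: since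
  \<open>h y\<close> is of order \<open>norm (y - x)\<close>, the product
  \<open>(u y - u x) * h y\<close> is of smaller order. This is how differentiability of the
  solution of a linear system is obtained from its continuity.\<close>

lemma continuous_times_vanishing_has_derivative:
  fixes u h :: "'a::real_normed_vector \<Rightarrow> real"
  assumes "isCont u x" "(h has_derivative h') (at x)" "h x = 0"
  shows "((\<lambda>y. u y * h y) has_derivative (\<lambda>v. u x * h' v)) (at x)"
proof -
  have bl: "bounded_linear h'" using assms(2) by (rule has_derivative_bounded_linear)
  have 1: "((\<lambda>y. u x * h y) has_derivative (\<lambda>v. u x * h' v)) (at x)"
    by (intro has_derivative_mult_right assms)
  obtain K where K: "\<And>v. norm (h' v) \<le> norm v * K" "K > 0"
    using bounded_linear.pos_bounded[OF bl] by blast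
  have q: "((\<lambda>y. norm (h y - h x - h' (y - x)) / norm (y - x)) \<longlongrightarrow> 0) (at x)"
    using assms(2) by (simp add: has_derivative_iff_norm)
  have u0: "((\<lambda>y. u y - u x) \<longlongrightarrow> 0) (at x)"
    using assms(1) LIM_zero by (auto simp: isCont_def)
  have "((\<lambda>y. (u y - u x) * h y) has_derivative (\<lambda>v. 0)) (at x)"
    unfolding has_derivative_iff_norm
  proof (intro conjI)
    have ev: "\<forall>\<^sub>F y in at x. norm (((u y - u x) * h y - (u x - u x) * h x - 0) / norm (y - x))
        \<le> norm (u y - u x) * (norm (h y - h x - h' (y - x)) / norm (y - x) + K)"
    proof (rule eventually_mono[OF eventually_neq_at_within[of x x UNIV]])
      fix y assume "y \<noteq> x"
      then have n: "norm (y - x) > 0" by simp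
      have "norm (h y) \<le> norm (h y - h x - h' (y - x)) + norm (h' (y - x))"
        using norm_triangle_ineq[of "h y - h x - h' (y - x)" "h' (y - x)"] assms(3) by simp
      also have "\<dots> \<le> norm (h y - h x - h' (y - x)) + norm (y - x) * K" using K(1) by simp
      finally have "norm (h y) / norm (y - x) \<le> norm (h y - h x - h' (y - x)) / norm (y - x) + K"
        using n by (simp add: field_simps)
      then have "norm (u y - u x) * (norm (h y) / norm (y - x)) \<le>
         norm (u y - u x) * (norm (h y - h x - h' (y - x)) / norm (y - x) + K)"
        by (rule mult_left_mono) simp
      then show "norm (((u y - u x) * h y - (u x - u x) * h x - 0) / norm (y - x))
        \<le> norm (u y - u x) * (norm (h y - h x - h' (y - x)) / norm (y - x) + K)"
        by (simp add: abs_mult)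
    qed
    have "((\<lambda>y. norm (u y - u x) * (norm (h y - h x - h' (y - x)) / norm (y - x) + K)) \<longlongrightarrow> norm (0::real) * (0 + K)) (at x)"
      by (intro tendsto_mult tendsto_norm u0 tendsto_add q tendsto_const)
    then have "((\<lambda>y. norm (u y - u x) * (norm (h y - h x - h' (y - x)) / norm (y - x) + K)) \<longlongrightarrow> 0) (at x)"
      by simp
    from Lim_null_comparison[OF ev this]
    have "((\<lambda>y. ((u y - u x) * h y - (u x - u x) * h x - 0) / norm (y - x)) \<longlongrightarrow> 0) (at x)" .
    from tendsto_norm[OF this]
    show "((\<lambda>y. norm ((u y - u x) * h y - (u x - u x) * h x - 0) / norm (y - x)) \<longlongrightarrow> 0) (at x)"
      by (simp add: abs_mult abs_div)
  qed simp
  from has_derivative_add[OF 1 this] show ?thesis by (simp add: algebra_simps)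
qed

subsection \<open>Linear systems with a positive definite matrix\<close>

lemma inner_product_linear:
  "inner_product B \<Longrightarrow> linear (B u)" "inner_product B \<Longrightarrow> linear (\<lambda>u. B u v)"
  by (simp_all add: inner_product_def bilinear_def)

lemma inner_product_eqI:
  assumes B: "inner_product B" "\<And>z. B w z = B w' z" shows "w = w'"
proof (rule ccontr)
  assume "w \<noteq> w'"
  then have "B (w - w') (w - w') > 0" using B(1) by (simp add: inner_product_def)
  moreover have "B (w - w') (w - w') = B w (w - w') - B w' (w - w')"
    using linear_diff[OF inner_product_linear(2)[OF B(1)]] by simp
  ultimately show False using B(2) by simp
qed

text \<open>\<open>M w\<close> is the Euclidean representative of the functional \<open>B w\<close>.
  Positivity makes \<open>M\<close> injective, hence onto, because the dimension is finite.\<close>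

lemma inner_product_riesz:
  fixes B :: "'e::euclidean_space \<Rightarrow> 'e \<Rightarrow> real"
  assumes B: "inner_product B" and r: "linear r"
  shows "\<exists>!w. \<forall>z. B w z = r z"
proof -
  define M where "M w = (\<Sum>i\<in>Basis. B w i *\<^sub>R i)" for w
  have Mz: "M w \<bullet> z = B w z" for w z
  proof -
    have "B w z = B w (\<Sum>i\<in>Basis. (z \<bullet> i) *\<^sub>R i)" by (simp add: euclidean_representation)
    also have "\<dots> = (\<Sum>i\<in>Basis. (z \<bullet> i) * B w i)"
      using linear_basis_sum[OF inner_product_linear(1)[OF B], of w z] by (simp add: euclidean_representation)
    also have "\<dots> = M w \<bullet> z"
      unfolding M_def inner_sum_left inner_scaleR_left
      by (intro sum.cong refl) (metis inner_commute mult.commute)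
    finally show ?thesis by simp
  qed
  have "linear M" unfolding M_def
    by (intro linear_compose_sum linear_compose_scale_right ballI)
      (auto simp: inner_product_linear[OF B] linear_iff linear_add[OF inner_product_linear(2)[OF B]]
        linear_cmul[OF inner_product_linear(2)[OF B]] algebra_simps)
  moreover have "inj M"
    by (rule injI, rule inner_product_eqI[OF B]) (metis Mz)
  ultimately have "surj M" by (rule linear_inj_imp_surj)
  then obtain w where "M w = (\<Sum>i\<in>Basis. r i *\<^sub>R i)" by (metis surjD)
  then have "B w z = r z" for z
    unfolding Mz[symmetric] using linear_basis_sum[OF r, of z]
    by (simp add: inner_sum_left, intro sum.cong refl) (metis inner_commute mult.commute)
  then show ?thesis using inner_product_eqI[OF B] by (intro ex1I[of _ w]) auto
qed

lemma inner_product_coercive: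
  fixes B :: "'e::euclidean_space \<Rightarrow> 'e \<Rightarrow> real"
  assumes B: "inner_product B"
  obtains c where "c > 0" "\<And>w. c * (norm w)\<^sup>2 \<le> B w w"
proof -
  have bb: "bounded_bilinear B"
    using B by (simp add: inner_product_def bilinear_conv_bounded_bilinear)
  have "continuous_on (sphere 0 1) (\<lambda>w. B w w)"
    by (intro bounded_bilinear.continuous_on[OF bb] continuous_intros)
  moreover obtain b :: 'e where "b \<in> Basis" using nonempty_Basis by blast
  then have "sphere (0::'e) 1 \<noteq> {}" by (metis mem_sphere_0 norm_Basis empty_iff)
  ultimately have "\<exists>w\<in>sphere 0 1. \<forall>y\<in>sphere 0 1. B w w \<le> B y y"
    by (intro continuous_attains_inf compact_sphere)
  then obtain w0 where w0: "w0 \<in> sphere 0 1" "\<And>w. w \<in> sphere 0 1 \<Longrightarrow> B w0 w0 \<le> B w w"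
    by blast
  have "B w0 w0 * (norm w)\<^sup>2 \<le> B w w" for w
  proof (cases "w = 0")
    case False
    have "B w0 w0 \<le> B (w /\<^sub>R norm w) (w /\<^sub>R norm w)" using False by (intro w0) simp
    also have "\<dots> = B w w / (norm w)\<^sup>2"
      by (simp add: bounded_bilinear.scaleR_left[OF bb] bounded_bilinear.scaleR_right[OF bb] power2_eq_square field_simps)
    finally show ?thesis using False by (simp add: field_simps)
  qed (simp add: bounded_bilinear.zero_left[OF bb])
  moreover have "w0 \<noteq> 0" using w0(1) by auto
  then have "B w0 w0 > 0" using B by (simp add: inner_product_def)
  ultimately show thesis using that by blast
qed

text \<open>The constant is a plain sum of matrix entries, so for a family of forms it tends to 0 as
  soon as the entries do.\<close>

lemma bilinear_norm_le_Basis: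
  fixes B :: "'e::euclidean_space \<Rightarrow> 'e \<Rightarrow> real"
  assumes "bilinear B"
  shows "\<bar>B u v\<bar> \<le> (\<Sum>i\<in>Basis. \<Sum>j\<in>Basis. \<bar>B i j\<bar>) * norm u * norm v"
proof -
  have l: "linear (B u)" "linear (\<lambda>v. B v u)" for u using assms by (auto simp: bilinear_def)
  have 2: "B i v = (\<Sum>j\<in>Basis. (v \<bullet> j) * B i j)" for i
    using linear_basis_sum[OF l(1)[of i], of v] by simp
  have "B u v = (\<Sum>i\<in>Basis. (u \<bullet> i) * B i v)"
    using linear_basis_sum[OF l(2)[of v], of u] by simp
  also have "\<dots> = (\<Sum>i\<in>Basis. \<Sum>j\<in>Basis. (u \<bullet> i) * ((v \<bullet> j) * B i j))"
    by (simp only: 2 sum_distrib_left)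
  also have "\<bar>\<dots>\<bar> \<le> (\<Sum>i\<in>Basis. \<Sum>j\<in>Basis. \<bar>(u \<bullet> i) * ((v \<bullet> j) * B i j)\<bar>)"
    by (rule order_trans[OF sum_abs sum_mono[OF sum_abs]])
  also have "\<dots> \<le> (\<Sum>i\<in>Basis. \<Sum>j\<in>Basis. norm u * (norm v * \<bar>B i j\<bar>))"
    unfolding abs_mult
    by (intro sum_mono mult_mono) (auto simp: Basis_le_norm)
  finally show ?thesis by (simp add: sum_distrib_left sum_distrib_right mult_ac)
qed

lemma linear_norm_le_Basis:
  fixes r :: "'e::euclidean_space \<Rightarrow> real"
  assumes "linear r"
  shows "\<bar>r v\<bar> \<le> (\<Sum>j\<in>Basis. \<bar>r j\<bar>) * norm v"
proof -
  have "r v = (\<Sum>j\<in>Basis. (v \<bullet> j) * r j)" using linear_basis_sum[OF assms, of v] by simp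
  also have "\<bar>\<dots>\<bar> \<le> (\<Sum>j\<in>Basis. \<bar>(v \<bullet> j) * r j\<bar>)" by (rule sum_abs)
  also have "\<dots> \<le> (\<Sum>j\<in>Basis. norm v * \<bar>r j\<bar>)"
    unfolding abs_mult by (intro sum_mono mult_mono) (auto simp: Basis_le_norm)
  finally show ?thesis by (simp add: sum_distrib_left mult_ac)
qed

text \<open>The form at \<open>a\<close> is coercive and the forms nearby differ from it by little.
  Coercivity is used twice: on \<open>w x\<close>, to bound the solutions near \<open>a\<close>, and
  then on \<open>w x - w a\<close>, to make the difference small.\<close>

lemma continuous_on_linear_system:
  fixes B :: "'c::real_normed_vector \<Rightarrow> 'e::euclidean_space \<Rightarrow> 'e \<Rightarrow> real"
  assumes "open S" and B: "\<And>x. x \<in> S \<Longrightarrow> inner_product (B x)"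
    and Bc: "\<And>u v. continuous_on S (\<lambda>x. B x u v)"
    and r: "\<And>x. x \<in> S \<Longrightarrow> linear (r x)" and rc: "\<And>z. continuous_on S (\<lambda>x. r x z)"
    and w: "\<And>x z. x \<in> S \<Longrightarrow> B x (w x) z = r x z"
    and a: "a \<in> S"
  shows "isCont w a"
proof -
  have ev: "\<forall>\<^sub>F x in at a. x \<in> S"
    using assms(1) a by (intro eventually_at_in_open') auto
  define e where "e x = (\<Sum>i\<in>Basis. \<Sum>j\<in>Basis. \<bar>B a i j - B x i j\<bar>)" for x
  define d where "d x = (\<Sum>j\<in>Basis. \<bar>r x j - r a j\<bar>)" for x
  define R where "R x = (\<Sum>j\<in>Basis. \<bar>r x j\<bar>)" for x
  have lim: "((\<lambda>x. B x u v) \<longlongrightarrow> B a u v) (at a)" "((\<lambda>x. r x v) \<longlongrightarrow> r a v) (at a)" for u v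
    using Bc[of u v] rc[of v] assms(1) a by (auto simp: continuous_on_eq_continuous_at isCont_def)
  have "(e \<longlongrightarrow> (\<Sum>i\<in>Basis. \<Sum>j\<in>Basis. \<bar>B a i j - B a i j\<bar>)) (at a)"
    unfolding e_def by (intro tendsto_intros lim)
  then have e0: "(e \<longlongrightarrow> 0) (at a)" by simp
  have "(d \<longlongrightarrow> (\<Sum>j\<in>Basis. \<bar>r a j - r a j\<bar>)) (at a)"
    unfolding d_def by (intro tendsto_intros lim)
  then have d0: "(d \<longlongrightarrow> 0) (at a)" by simp
  have R0: "(R \<longlongrightarrow> R a) (at a)" unfolding R_def by (intro tendsto_intros lim)
  obtain c where c: "c > 0" "\<And>w. c * (norm w)\<^sup>2 \<le> B a w w"
    using inner_product_coercive[OF B[OF a]] by blast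
  have bil: "bilinear (\<lambda>u v. B a u v - B x u v)" if "x \<in> S" for x
    using inner_product_linear[OF B[OF a]] inner_product_linear[OF B[OF that]]
    unfolding bilinear_def by (auto intro: linear_compose_sub)
  have eb: "\<bar>B a u v - B x u v\<bar> \<le> e x * norm u * norm v" if "x \<in> S" for x u v
    using bilinear_norm_le_Basis[OF bil[OF that], of u v] by (simp add: e_def)
  have db: "\<bar>r x v - r a v\<bar> \<le> d x * norm v" if "x \<in> S" for x v
    using linear_norm_le_Basis[OF linear_compose_sub[OF r[OF that] r[OF a]], of v] by (simp add: d_def)
  have ec: "\<forall>\<^sub>F x in at a. e x < c / 2"
    using order_tendstoD(2)[OF e0, of "c/2"] c(1) by simp
  have Rb: "\<forall>\<^sub>F x in at a. R x < R a + 1"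
    using order_tendstoD(2)[OF R0, of "R a + 1"] by simp
  have key: "\<forall>\<^sub>F x in at a. norm (w x - w a) \<le> (e x * (2 * (R a + 1) / c) + d x) / c"
    using ev ec Rb
  proof eventually_elim
    case (elim x)
    have "c * (norm (w x))\<^sup>2 \<le> B a (w x) (w x)" by (rule c)
    also have "\<dots> = (B a (w x) (w x) - B x (w x) (w x)) + r x (w x)" using w elim by simp
    also have "\<dots> \<le> e x * norm (w x) * norm (w x) + R x * norm (w x)"
      using eb[OF elim(1), of "w x" "w x"] linear_norm_le_Basis[OF r[OF elim(1)], of "w x"] by (simp add: R_def)
    also have "\<dots> \<le> c / 2 * norm (w x) * norm (w x) + (R a + 1) * norm (w x)"
      using elim by (intro add_mono mult_right_mono) auto
    finally have "(c / 2 * norm (w x)) * norm (w x) \<le> (R a + 1) * norm (w x)"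
      by (simp add: power2_eq_square algebra_simps)
    \<comment> \<open>Half of the coercivity constant has absorbed the error \<open>e x\<close>;
      dividing by \<open>norm (w x)\<close> leaves a bound that does not depend on
      \<open>x\<close>.\<close>
    then have wb: "norm (w x) \<le> 2 * (R a + 1) / c"
    proof (cases "w x = 0")
      case True
      have "R a \<ge> 0" by (auto simp: R_def intro!: sum_nonneg)
      then show ?thesis using True c by simp
    next
      case False
      assume "(c / 2 * norm (w x)) * norm (w x) \<le> (R a + 1) * norm (w x)"
      then have "c / 2 * norm (w x) \<le> R a + 1" using False by simp
      then show ?thesis using c by (simp add: field_simps)
    qed
    have e0': "e x \<ge> 0" by (auto simp: e_def intro!: sum_nonneg)
    let ?z = "w x - w a"
    have "c * (norm ?z)\<^sup>2 \<le> B a ?z ?z" by (rule c)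
    also have "\<dots> = (B a (w x) ?z - B x (w x) ?z) + (r x ?z - r a ?z)"
      using w[OF elim(1)] w[OF a] linear_diff[OF inner_product_linear(2)[OF B[OF a]], of "w x" "w a"] by simp
    also have "\<dots> \<le> e x * norm (w x) * norm ?z + d x * norm ?z"
      using eb[OF elim(1), of "w x" ?z] db[OF elim(1), of ?z] by simp
    also have "\<dots> \<le> (e x * (2 * (R a + 1) / c) + d x) * norm ?z"
      unfolding distrib_right
      by (intro add_mono mult_right_mono mult_left_mono wb e0' order_refl norm_ge_zero)
    finally have "(c * norm ?z) * norm ?z \<le> (e x * (2 * (R a + 1) / c) + d x) * norm ?z"
      by (simp add: power2_eq_square mult_ac)
    moreover have "d x \<ge> 0" "R a \<ge> 0" by (auto simp: d_def R_def intro!: sum_nonneg)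
    then have "e x * (2 * (R a + 1) / c) + d x \<ge> 0" using e0' c by simp
    ultimately have "c * norm ?z \<le> e x * (2 * (R a + 1) / c) + d x"
      by (cases "?z = 0") auto
    then show ?case using c by (simp add: field_simps)
  qed
  have "((\<lambda>x. (e x * (2 * (R a + 1) / c) + d x) / c) \<longlongrightarrow> (0 * (2 * (R a + 1) / c) + 0) / c) (at a)"
    using c by (intro tendsto_intros e0 d0) auto
  then have "((\<lambda>x. (e x * (2 * (R a + 1) / c) + d x) / c) \<longlongrightarrow> 0) (at a)" by simp
  from Lim_null_comparison[OF key this] show ?thesis
    using LIM_zero_cancel by (auto simp: isCont_def)
qed

lemma differentiable_linear_system:
  fixes B :: "'c::real_normed_vector \<Rightarrow> 'e::euclidean_space \<Rightarrow> 'e \<Rightarrow> real"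
  assumes "open S" and B: "\<And>x. x \<in> S \<Longrightarrow> inner_product (B x)"
    and Bd: "\<And>u v x. x \<in> S \<Longrightarrow> (\<lambda>x. B x u v) differentiable (at x)"
    and r: "\<And>x. x \<in> S \<Longrightarrow> linear (r x)" and rd: "\<And>z x. x \<in> S \<Longrightarrow> (\<lambda>x. r x z) differentiable (at x)"
    and w: "\<And>x z. x \<in> S \<Longrightarrow> B x (w x) z = r x z"
    and a: "a \<in> S"
  shows "w differentiable (at a)"
proof -
  have wc: "isCont w a"
    by (rule continuous_on_linear_system[OF assms(1) B _ r _ w a])
      (auto intro!: continuous_at_imp_continuous_on differentiable_imp_continuous_within Bd rd)
  have "(\<lambda>x. w x \<bullet> i) differentiable (at a)" if "i \<in> Basis" for i
  proof -
    have "linear (\<lambda>z. z \<bullet> i)" by (simp add: bounded_linear.linear bounded_linear_inner_left)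
    \<comment> \<open>Testing the system with the representative of the i-th coordinate functional
      for the form at \<open>a\<close> writes this coordinate of \<open>w x\<close> as a
      differentiable term plus products of coordinates of \<open>w x\<close> with factors that
      vanish at \<open>a\<close>.\<close>
    then obtain \<rho> where \<rho>: "\<And>z. B a \<rho> z = z \<bullet> i"
      using inner_product_riesz[OF B[OF a], of "\<lambda>z. z \<bullet> i"] by auto
    have sym: "B x u v = B x v u" if "x \<in> S" for x u v using B[OF that] by (simp add: inner_product_def)
    have e: "w x \<bullet> i = r x \<rho> + (\<Sum>j\<in>Basis. (w x \<bullet> j) * (B a j \<rho> - B x j \<rho>))" if "x \<in> S" for x
    proof -
      have "w x \<bullet> i = r x \<rho> + (B a (w x) \<rho> - B x (w x) \<rho>)"
        using \<rho>[of "w x"] w[OF that, of \<rho>] sym[OF a] by simp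
      also have "B a (w x) \<rho> - B x (w x) \<rho> = (\<Sum>j\<in>Basis. (w x \<bullet> j) *\<^sub>R (B a j \<rho> - B x j \<rho>))"
        by (rule linear_basis_sum) (intro linear_compose_sub inner_product_linear B that a)
      finally show ?thesis by simp
    qed
    have "(\<lambda>x. r x \<rho> + (\<Sum>j\<in>Basis. (w x \<bullet> j) * (B a j \<rho> - B x j \<rho>))) differentiable (at a)"
    proof (intro differentiable_add differentiable_sum rd a ballI)
      fix j :: 'e assume "j \<in> Basis"
      have 1: "((\<lambda>x. B a j \<rho> - B x j \<rho>) has_derivative (\<lambda>v. 0 - fd (\<lambda>x. B x j \<rho>) a v)) (at a)"
        by (intro has_derivative_diff has_derivative_const fd_works Bd a)
      show "(\<lambda>x. (w x \<bullet> j) * (B a j \<rho> - B x j \<rho>)) differentiable (at a)"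
        by (rule differentiableI[OF continuous_times_vanishing_has_derivative[OF _ 1]])
          (use wc in \<open>auto intro: continuous_intros\<close>)
    qed simp
    then show ?thesis
      using differentiable_cong_open[OF assms(1) a, of "\<lambda>x. w x \<bullet> i"] e by simp
  qed
  then show ?thesis
    using differentiable_componentwise_within[of w a UNIV] by simp
qed

text \<open>Differentiating the system shows that the derivative of the solution solves a system
  with the same forms and a new right-hand side, which involves \<open>w\<close> itself only to
  order n. Hence the induction has to vary both \<open>r\<close> and \<open>w\<close>.\<close>

lemma Ck_on_linear_system:
  fixes B :: "'c::real_normed_vector \<Rightarrow> 'e::euclidean_space \<Rightarrow> 'e \<Rightarrow> real"
  assumes "open S" and B: "\<And>x. x \<in> S \<Longrightarrow> inner_product (B x)"
    and Bk: "\<And>u v. Ck_on n S (\<lambda>x. B x u v)"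
    and r: "\<And>x. x \<in> S \<Longrightarrow> linear (r x)" and rk: "\<And>z. Ck_on n S (\<lambda>x. r x z)"
    and w: "\<And>x z. x \<in> S \<Longrightarrow> B x (w x) z = r x z"
  shows "Ck_on n S w"
  using Bk r rk w
proof (induction n arbitrary: r w)
  case 0
  show ?case unfolding Ck_on.simps
    by (rule continuous_at_imp_continuous_on, rule ballI,
        rule continuous_on_linear_system[OF assms(1) B _ 0(2) _ 0(4)]) (use 0(1,3) in auto)
next
  case (Suc n)
  have Bd: "(\<lambda>x. B x u v) differentiable (at x)" and rd: "(\<lambda>x. r x u) differentiable (at x)" if "x \<in> S" for x u v
    using Suc.prems(1,3) that by auto
  have wd: "w differentiable (at x)" if "x \<in> S" for x
    by (rule differentiable_linear_system[OF assms(1) B Bd Suc.prems(2) rd Suc.prems(4) that])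
  have bil: "bilinear (B x)" if "x \<in> S" for x using B[OF that] by (simp add: inner_product_def)
  have eq: "B x (fd w x u) z = fd (\<lambda>y. r y z) x u - fd (\<lambda>y. B y (w x) z) x u" if x: "x \<in> S" for x u z
  proof -
    have "((\<lambda>y. B y (w y) z) has_derivative
      (\<lambda>u. fd (\<lambda>y. B y (w x) z) x u + B x (fd w x u) z + B x (w x) 0)) (at x)"
      by (rule has_derivative_bilinear_family[OF assms(1) x bil Bd[OF x] fd_works[OF wd[OF x]]]) auto
    then have "((\<lambda>y. r y z) has_derivative
      (\<lambda>u. fd (\<lambda>y. B y (w x) z) x u + B x (fd w x u) z + B x (w x) 0)) (at x)"
      by (subst has_derivative_cong_open[OF assms(1) x, where g="\<lambda>y. B y (w y) z"]) (auto simp: Suc.prems(4))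
    from fd_eq[OF this] show ?thesis
      using linear_0[OF inner_product_linear(1)[OF B[OF x]]] by simp
  qed
  note wn = Suc.IH[OF Ck_on_SucD[OF Suc.prems(1)] Suc.prems(2) Ck_on_SucD[OF Suc.prems(3)] Suc.prems(4)]
  have "Ck_on n S (\<lambda>x. fd w x u)" for u
  proof (rule Suc.IH[OF Ck_on_SucD[OF Suc.prems(1)], where r="\<lambda>x z. fd (\<lambda>y. r y z) x u - fd (\<lambda>y. B y (w x) z) x u"])
    show "linear (\<lambda>z. fd (\<lambda>y. r y z) x u - fd (\<lambda>y. B y (w x) z) x u)" if x: "x \<in> S" for x
      by (intro linear_compose_sub linear_fd_family[OF assms(1) x] rd Bd Suc.prems(2) inner_product_linear B x)
    have "Ck_on n S (\<lambda>x. fd (\<lambda>y. B y (w x) z) x u)" for z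
    proof (rule Ck_on_linear_family[where L="\<lambda>x b. fd (\<lambda>y. B y b z) x u", OF assms(1) _ _ wn])
      show "linear (\<lambda>b. fd (\<lambda>y. B y b z) x u)" if x: "x \<in> S" for x
        by (rule linear_fd_family[OF assms(1) x, where L="\<lambda>y b. B y b z"]) (auto intro: inner_product_linear B Bd x)
    qed (use Suc.prems(1) in simp)
    then have "Ck_on n S (\<lambda>x. (-1) *\<^sub>R fd (\<lambda>y. B y (w x) z) x u)" for z
      by (rule Ck_on_bounded_linear[OF assms(1) bounded_linear_scaleR_right])
    then show "Ck_on n S (\<lambda>x. fd (\<lambda>y. r y z) x u - fd (\<lambda>y. B y (w x) z) x u)" for z
      using Ck_on_add[OF assms(1), of n "\<lambda>x. fd (\<lambda>y. r y z) x u" "\<lambda>x. (-1) *\<^sub>R fd (\<lambda>y. B y (w x) z) x u"]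
        Suc.prems(3) by simp
  qed (rule eq)
  then show ?case using wd by simp
qed

lemma smooth_on_linear_system:
  fixes B :: "'c::real_normed_vector \<Rightarrow> 'e::euclidean_space \<Rightarrow> 'e \<Rightarrow> real"
  assumes "open S" "\<And>x. x \<in> S \<Longrightarrow> inner_product (B x)" "\<And>u v. smooth_on S (\<lambda>x. B x u v)"
    "\<And>x. x \<in> S \<Longrightarrow> linear (r x)" "\<And>z. smooth_on S (\<lambda>x. r x z)"
    "\<And>x z. x \<in> S \<Longrightarrow> B x (w x) z = r x z"
  shows "smooth_on S w"
  by (rule smooth_onI, rule Ck_on_linear_system[OF assms(1,2) smooth_onD[OF assms(3)] assms(4) smooth_onD[OF assms(5)] assms(6)])

subsection \<open>Symmetry of second derivatives\<close>

text \<open>The mean value theorem, applied once in each direction, writes the second difference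
  over a small parallelogram as t * t times either mixed derivative at some point of it. Continuity
  at \<open>x\<close> then identifies the two. Vector values are handled by components in
  \<open>fd_symmetric\<close>.\<close>

lemma real_fd_symmetric:
  fixes f :: "'a::real_normed_vector \<Rightarrow> real"
  assumes "open S" "Ck_on 2 S f" "x \<in> S"
  shows "fd (\<lambda>y. fd f y u) x v = fd (\<lambda>y. fd f y v) x u"
proof -
  have fd1: "(f has_derivative fd f y) (at y)" if "y \<in> S" for y
    using assms(2) that by (intro fd_works) (simp add: numeral_2_eq_2)
  have fd2: "((\<lambda>y. fd f y u) has_derivative fd (\<lambda>y. fd f y u) y) (at y)" if "y \<in> S" for y u
    using assms(2) that by (intro fd_works) (simp add: numeral_2_eq_2)
  have lin1: "linear (fd f y)" if "y \<in> S" for y using fd1[OF that] has_derivative_linear by blast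
  have lin2: "linear (fd (\<lambda>y. fd f y u) y)" if "y \<in> S" for y u using fd2[OF that] has_derivative_linear by blast
  obtain e where e: "e > 0" "ball x e \<subseteq> S" using assms(1,3) by (meson openE)
  define d where "d = e / (norm u + norm v + 1)"
  have d: "d > 0" using e(1) by (simp add: d_def add_nonneg_pos)
  have inS: "x + s *\<^sub>R u + t *\<^sub>R v \<in> S" if "0 \<le> s" "s < d" "0 \<le> t" "t < d" for s t
  proof -
    have "norm (s *\<^sub>R u + t *\<^sub>R v) \<le> s * norm u + t * norm v"
      using norm_triangle_ineq[of "s *\<^sub>R u" "t *\<^sub>R v"] that by simp
    also have "\<dots> \<le> d * norm u + d * norm v" using that by (intro add_mono mult_right_mono) auto
    also have "\<dots> < d * (norm u + norm v + 1)" using d by (simp add: algebra_simps)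
    also have "\<dots> = e" unfolding d_def by (simp add: add_nonneg_pos less_imp_neq[THEN not_sym])
    finally have "x + s *\<^sub>R u + t *\<^sub>R v \<in> ball x e" 
      using norm_minus_cancel[of "s *\<^sub>R u + t *\<^sub>R v"] by (simp add: dist_norm algebra_simps)
    then show ?thesis using e(2) by blast
  qed
  define A where "A a b y = fd (\<lambda>y. fd f y a) y b" for a b y
  define \<Delta> where "\<Delta> t = f (x + t *\<^sub>R u + t *\<^sub>R v) - f (x + t *\<^sub>R u) - f (x + t *\<^sub>R v) + f x" for t
  have mvt: "\<exists>\<sigma> \<tau>. 0 < \<sigma> \<and> \<sigma> < t \<and> 0 < \<tau> \<and> \<tau> < t \<and>
      f (x + t *\<^sub>R a + t *\<^sub>R b) - f (x + t *\<^sub>R a) - f (x + t *\<^sub>R b) + f x = t * t * A a b (x + \<sigma> *\<^sub>R a + \<tau> *\<^sub>R b)"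
    if t: "0 < t" "t < d" and ab: "(a = u \<and> b = v) \<or> (a = v \<and> b = u)" for t a b
  proof -
    have in': "x + s *\<^sub>R a + s' *\<^sub>R b \<in> S" if "0 \<le> s" "s < d" "0 \<le> s'" "s' < d" for s s'
      using ab inS[OF that] inS[OF that(3,4,1,2)] by (auto simp: add_ac)
    have D1: "((\<lambda>s. f (x + s *\<^sub>R a + c *\<^sub>R b)) has_real_derivative fd f (x + s *\<^sub>R a + c *\<^sub>R b) a) (at s)"
      if "0 \<le> s" "s < d" "0 \<le> c" "c < d" for s c
    proof -
      have "((\<lambda>s. x + s *\<^sub>R a + c *\<^sub>R b) has_derivative (\<lambda>h. h *\<^sub>R a)) (at s)"
        by (auto intro!: derivative_eq_intros)
      from has_derivative_compose[OF this fd1[OF in'[OF that]]]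
      show ?thesis unfolding has_field_derivative_def
        by (simp add: linear_cmul[OF lin1[OF in'[OF that]]] mult.commute[of _ "fd f _ _"] cong: if_cong) 
    qed
    have "\<exists>\<sigma>>0. \<sigma> < t \<and> (\<lambda>s. f (x + s *\<^sub>R a + t *\<^sub>R b) - f (x + s *\<^sub>R a + 0 *\<^sub>R b)) t
       - (\<lambda>s. f (x + s *\<^sub>R a + t *\<^sub>R b) - f (x + s *\<^sub>R a + 0 *\<^sub>R b)) 0
       = (t - 0) * (fd f (x + \<sigma> *\<^sub>R a + t *\<^sub>R b) a - fd f (x + \<sigma> *\<^sub>R a + 0 *\<^sub>R b) a)"
      by (rule MVT2[OF t(1)], rule DERIV_diff; rule D1) (use t d in auto)
    then obtain \<sigma> where \<sigma>: "0 < \<sigma>" "\<sigma> < t" and 1: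
       "f (x + t *\<^sub>R a + t *\<^sub>R b) - f (x + t *\<^sub>R a) - f (x + t *\<^sub>R b) + f x
       = t * (fd f (x + \<sigma> *\<^sub>R a + t *\<^sub>R b) a - fd f (x + \<sigma> *\<^sub>R a + 0 *\<^sub>R b) a)"
      by (auto simp: algebra_simps)
    have D2: "((\<lambda>s. fd f (x + \<sigma> *\<^sub>R a + s *\<^sub>R b) a) has_real_derivative A a b (x + \<sigma> *\<^sub>R a + s *\<^sub>R b)) (at s)"
      if "0 \<le> s" "s < d" for s
    proof -
      have i: "x + \<sigma> *\<^sub>R a + s *\<^sub>R b \<in> S" using that \<sigma> t by (intro in') auto
      have "((\<lambda>s. x + \<sigma> *\<^sub>R a + s *\<^sub>R b) has_derivative (\<lambda>h. h *\<^sub>R b)) (at s)"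
        by (auto intro!: derivative_eq_intros)
      from has_derivative_compose[OF this fd2[OF i]]
      show ?thesis unfolding has_field_derivative_def A_def
        by (simp add: linear_cmul[OF lin2[OF i]] mult.commute[of _ "fd _ _ _"])
    qed
    have "\<exists>\<tau>>0. \<tau> < t \<and> fd f (x + \<sigma> *\<^sub>R a + t *\<^sub>R b) a - fd f (x + \<sigma> *\<^sub>R a + 0 *\<^sub>R b) a
       = (t - 0) * A a b (x + \<sigma> *\<^sub>R a + \<tau> *\<^sub>R b)"
      by (rule MVT2[OF t(1)], rule D2) (use t in auto)
    then show ?thesis using \<sigma> 1 by auto
  qed
  have cA: "isCont (A a b) x" for a b
  proof -
    have "continuous_on S (A a b)" using assms(2) by (simp add: numeral_2_eq_2 A_def)
    then show ?thesis using assms(1,3) by (simp add: continuous_on_eq_continuous_at)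
  qed
  have "dist (A u v x) (A v u x) \<le> 0 + \<epsilon>" if \<epsilon>: "\<epsilon> > 0" for \<epsilon>
  proof -
    have "\<exists>\<delta>>0. \<forall>y. dist y x < \<delta> \<longrightarrow> dist (A a b y) (A a b x) < \<epsilon> / 2" for a b
      using cA[of a b] \<epsilon> unfolding continuous_at_eps_delta by (metis half_gt_zero)
    then obtain \<delta>1 \<delta>2 where \<delta>: "\<delta>1 > 0" "\<delta>2 > 0" and
       1: "\<And>y. dist y x < \<delta>1 \<Longrightarrow> dist (A u v y) (A u v x) < \<epsilon> / 2" and
       2: "\<And>y. dist y x < \<delta>2 \<Longrightarrow> dist (A v u y) (A v u x) < \<epsilon> / 2"
      by metis
    define t where "t = min (d / 2) (min \<delta>1 \<delta>2 / (norm u + norm v + 1))"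
    have n: "norm u + norm v + 1 > 0" by (simp add: add_nonneg_pos)
    have t: "t > 0" "t < d" using d \<delta> n by (auto simp: t_def)
    have close: "dist (x + \<sigma> *\<^sub>R a + \<tau> *\<^sub>R b) x < min \<delta>1 \<delta>2"
      if "0 < \<sigma>" "\<sigma> < t" "0 < \<tau>" "\<tau> < t" "norm a + norm b = norm u + norm v" for \<sigma> \<tau> a b
    proof -
      have "dist (x + \<sigma> *\<^sub>R a + \<tau> *\<^sub>R b) x \<le> \<sigma> * norm a + \<tau> * norm b"
        using norm_triangle_ineq[of "\<sigma> *\<^sub>R a" "\<tau> *\<^sub>R b"] that by (simp add: dist_norm)
      also have "\<dots> \<le> t * norm a + t * norm b" using that by (intro add_mono mult_right_mono) auto
      also have "\<dots> < t * (norm u + norm v + 1)" using t that(5) by (simp add: distrib_left[symmetric])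
      also have "\<dots> \<le> min \<delta>1 \<delta>2 / (norm u + norm v + 1) * (norm u + norm v + 1)"
        using n by (intro mult_right_mono) (auto simp: t_def)
      also have "\<dots> = min \<delta>1 \<delta>2" using n by simp
      finally show ?thesis .
    qed
    obtain \<sigma> \<tau> where 3: "0 < \<sigma>" "\<sigma> < t" "0 < \<tau>" "\<tau> < t" "\<Delta> t = t * t * A u v (x + \<sigma> *\<^sub>R u + \<tau> *\<^sub>R v)"
      using mvt[OF t, of u v] by (auto simp: \<Delta>_def)
    obtain \<sigma>' \<tau>' where 4: "0 < \<sigma>'" "\<sigma>' < t" "0 < \<tau>'" "\<tau>' < t" "\<Delta> t = t * t * A v u (x + \<sigma>' *\<^sub>R v + \<tau>' *\<^sub>R u)"
      using mvt[OF t, of v u] by (auto simp: \<Delta>_def algebra_simps)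
    have "A u v (x + \<sigma> *\<^sub>R u + \<tau> *\<^sub>R v) = A v u (x + \<sigma>' *\<^sub>R v + \<tau>' *\<^sub>R u)"
      using 3(5) 4(5) t(1) by simp
    moreover have "dist (A u v (x + \<sigma> *\<^sub>R u + \<tau> *\<^sub>R v)) (A u v x) < \<epsilon> / 2"
      using close[OF 3(1-4), of u v] by (intro 1) simp
    moreover have "dist (A v u (x + \<sigma>' *\<^sub>R v + \<tau>' *\<^sub>R u)) (A v u x) < \<epsilon> / 2"
      using close[OF 4(1-4), of v u] by (intro 2) simp
    ultimately show ?thesis unfolding dist_real_def by linarith
  qed
  then have "dist (A u v x) (A v u x) \<le> 0" by (rule field_le_epsilon)
  then show ?thesis by (simp add: A_def)
qed

lemma fd_symmetric:
  fixes f :: "'a::real_normed_vector \<Rightarrow> 'b::euclidean_space"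
  assumes "open S" "smooth_on S f" "x \<in> S"
  shows "fd (\<lambda>y. fd f y u) x v = fd (\<lambda>y. fd f y v) x u"
proof (rule euclidean_eqI)
  fix b :: 'b assume "b \<in> Basis"
  have 1: "fd (\<lambda>y. f y \<bullet> b) y w = fd f y w \<bullet> b" if "y \<in> S" for y w
    using fd_eq[OF has_derivative_inner_left[OF smooth_on_works[OF assms(2) that], of b]] by simp
  have 2: "fd (\<lambda>y. fd (\<lambda>y. f y \<bullet> b) y w) x w' = fd (\<lambda>y. fd f y w) x w' \<bullet> b" for w w'
  proof -
    have "fd (\<lambda>y. fd (\<lambda>y. f y \<bullet> b) y w) x = fd (\<lambda>y. fd f y w \<bullet> b) x"
      by (rule fd_cong[OF assms(1,3)]) (rule 1)
    also have "\<dots> = (\<lambda>w'. fd (\<lambda>y. fd f y w) x w' \<bullet> b)"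
      by (rule fd_eq[OF has_derivative_inner_left[OF smooth_on_works[OF smooth_on_fd_const[OF assms(2)] assms(3)]]])
    finally show ?thesis by simp
  qed
  have "smooth_on S (\<lambda>y. f y \<bullet> b)"
    by (rule smooth_on_bounded_linear[OF assms(1) bounded_linear_inner_left assms(2)])
  from real_fd_symmetric[OF assms(1) smooth_onD[OF this] assms(3), of u v]
  show "fd (\<lambda>y. fd f y u) x v \<bullet> b = fd (\<lambda>y. fd f y v) x u \<bullet> b"
    by (simp add: 2)
qed

subsection \<open>A smooth step function\<close>

text \<open>The powers of 1 / x make the family closed under differentiation up to linear
  combinations, so all orders of smoothness follow from one derivative formula.\<close>

definition flat_exp :: "nat \<Rightarrow> real \<Rightarrow> real" where
  "flat_exp k x = (if x > 0 then (1 / x) ^ k * exp (- (1 / x)) else 0)"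

lemma power_le_fact_exp:
  assumes "(y::real) \<ge> 0" shows "y ^ n \<le> fact n * exp y"
proof -
  have s: "(\<lambda>n. y ^ n /\<^sub>R fact n) sums exp y" by (rule exp_converges)
  have "(\<Sum>i\<in>{n}. y ^ i /\<^sub>R fact i) \<le> (\<Sum>i. y ^ i /\<^sub>R fact i)"
    using assms by (intro sum_le_suminf sums_summable[OF s]) auto
  then have "y ^ n /\<^sub>R fact n \<le> exp y" using sums_unique[OF s] by simp
  then show ?thesis by (simp add: field_simps)
qed

text \<open>A quadratic bound is what gives derivative 0 at the origin. It comes from the term of
  degree k + 2 of the exponential series.\<close>

lemma flat_exp_le: "\<bar>flat_exp k x\<bar> \<le> fact (k + 2) * x\<^sup>2"
proof (cases "x > 0")
  case True
  have "(1 / x) ^ (k + 2) \<le> fact (k + 2) * exp (1 / x)" using True by (intro power_le_fact_exp) simp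
  then have "(1 / x) ^ k * exp (- (1 / x)) \<le> fact (k + 2) * x\<^sup>2"
    using True by (simp add: exp_minus power_add field_simps power2_eq_square)
  then show ?thesis using True by (simp add: flat_exp_def abs_mult)
qed (simp add: flat_exp_def)

lemma flat_exp_has_derivative:
  "(flat_exp k has_real_derivative (flat_exp (k + 2) x - real k * flat_exp (k + 1) x)) (at x)"
proof -
  consider "x > 0" | "x < 0" | "x = 0" by linarith
  then show ?thesis
  proof cases
    case 1
    have "((\<lambda>x. (1 / x) ^ k * exp (- (1 / x))) has_real_derivative
       (flat_exp (k + 2) x - real k * flat_exp (k + 1) x)) (at x)"
    proof -
      have i: "((\<lambda>x. 1 / x) has_real_derivative - ((1 / x)\<^sup>2)) (at x)"
        using 1 by (auto intro!: derivative_eq_intros simp: power2_eq_square)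
      have "real k * (- ((1 / x)\<^sup>2) * (1 / x) ^ (k - Suc 0)) = - (real k * (1 / x) ^ (k + 1))"
        by (cases k) (simp_all add: power2_eq_square)
      then show ?thesis using 1
        by (intro DERIV_cong[OF DERIV_mult[OF DERIV_power[OF i] DERIV_chain2[OF DERIV_exp DERIV_minus[OF i]]]])
          (simp add: flat_exp_def power_add power2_eq_square algebra_simps)
    qed
    then show ?thesis
      by (rule has_field_derivative_transform_within_open[of _ _ _ "{0<..}"]) (use 1 in \<open>auto simp: flat_exp_def\<close>)
  next
    case 2
    have "((\<lambda>x. 0) has_real_derivative 0) (at x)" by simp
    then have "(flat_exp k has_real_derivative 0) (at x)"
      by (rule has_field_derivative_transform_within_open[of _ _ _ "{..<0}"]) (use 2 in \<open>auto simp: flat_exp_def\<close>)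
    then show ?thesis using 2 by (simp add: flat_exp_def)
  next
    case 3
    have "((\<lambda>y. (flat_exp k y - flat_exp k 0) / (y - 0)) \<longlongrightarrow> 0) (at 0)"
    proof (rule Lim_null_comparison)
      show "\<forall>\<^sub>F y in at 0. norm ((flat_exp k y - flat_exp k 0) / (y - 0)) \<le> fact (k + 2) * \<bar>y\<bar>"
      proof (rule eventually_mono[OF eventually_neq_at_within[of 0 0 UNIV]])
        fix y :: real assume "y \<noteq> 0"
        moreover define C :: real where "C = fact (k + 2)"
        moreover have "\<bar>flat_exp k y\<bar> \<le> C * (\<bar>y\<bar> * \<bar>y\<bar>)"
          using flat_exp_le[of k y] by (simp add: C_def power2_eq_square)
        ultimately show "norm ((flat_exp k y - flat_exp k 0) / (y - 0)) \<le> fact (k + 2) * \<bar>y\<bar>"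
          by (simp add: flat_exp_def[of k 0] divide_le_eq mult_ac del: fact_Suc add_2_eq_Suc')
      qed
      have "((\<lambda>y::real. fact (k + 2) * \<bar>y\<bar>) \<longlongrightarrow> fact (k + 2) * \<bar>0\<bar>) (at 0)"
        by (intro tendsto_intros)
      then show "((\<lambda>y::real. fact (k + 2) * \<bar>y\<bar>) \<longlongrightarrow> 0) (at 0)" by simp
    qed
    then show ?thesis using 3
      by (simp add: has_field_derivative_iff flat_exp_def[of _ 0])
  qed
qed

lemma Ck_on_flat_exp: "Ck_on n UNIV (flat_exp k)"
proof (induction n arbitrary: k)
  case 0
  show ?case
    using DERIV_isCont[OF flat_exp_has_derivative] by (auto intro!: continuous_at_imp_continuous_on)
next
  case (Suc n)
  show ?case
  proof (rule Ck_on_SucI[where f'="\<lambda>x v. v *\<^sub>R (flat_exp (k + 2) x + (- real k) *\<^sub>R flat_exp (k + 1) x)"])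
    show "(flat_exp k has_derivative (\<lambda>v. v *\<^sub>R (flat_exp (k + 2) x + (- real k) *\<^sub>R flat_exp (k + 1) x))) (at x)" for x
      by (rule has_derivative_eq_rhs[OF flat_exp_has_derivative[unfolded has_field_derivative_def]])
        (simp add: fun_eq_iff algebra_simps)
    show "Ck_on n UNIV (\<lambda>x. v *\<^sub>R (flat_exp (k + 2) x + (- real k) *\<^sub>R flat_exp (k + 1) x))" for v
      by (intro Ck_on_bounded_linear[OF _ bounded_linear_scaleR_right] Ck_on_add open_UNIV Suc.IH)
  qed simp
qed

text \<open>Being constant near both ends matters: a curve reparametrised by such a function is
  stationary there and can be continued smoothly by another one.\<close>

lemma smooth_step_exists:
  obtains s :: "real \<Rightarrow> real" where "smooth_on UNIV s" "\<And>t. s t \<in> {0..1}"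
    "\<And>t. t \<le> 1/4 \<Longrightarrow> s t = 0" "\<And>t. t \<ge> 3/4 \<Longrightarrow> s t = 1"
proof -
  define a where "a t = flat_exp 0 (t - 1/4)" for t
  define b where "b t = flat_exp 0 (3/4 - t)" for t
  have fs: "smooth_on UNIV (flat_exp 0)" by (simp add: smooth_on_def Ck_on_flat_exp)
  have as: "smooth_on UNIV a" "smooth_on UNIV b"
    unfolding a_def b_def by (intro smooth_on_compose[OF _ _ fs] smooth_intros; simp)+
  have pos: "a t + b t > 0" "a t \<ge> 0" "b t \<ge> 0" for t
  proof -
    have f: "flat_exp 0 x \<ge> 0" "x > 0 \<Longrightarrow> flat_exp 0 x > 0" for x by (simp_all add: flat_exp_def)
    show "a t \<ge> 0" "b t \<ge> 0" by (simp_all add: a_def b_def f)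
    show "a t + b t > 0"
      using f(1)[of "t - 1/4"] f(1)[of "3/4 - t"] f(2)[of "t - 1/4"] f(2)[of "3/4 - t"]
      by (cases "t > 1/4") (auto simp: a_def b_def intro: add_pos_nonneg add_nonneg_pos)
  qed
  let ?s = "\<lambda>t. a t / (a t + b t)"
  \<comment> \<open>The quotient is viewed as the solution of a one-dimensional positive definite
    linear system, which replaces a quotient rule.\<close>
  have "smooth_on UNIV ?s"
  proof (rule smooth_on_linear_system[where B="\<lambda>t u v. (a t + b t) * (u * v)" and r="\<lambda>t z. a t * z"])
    fix t :: real
    show "inner_product (\<lambda>u v. (a t + b t) * (u * v))"
      unfolding inner_product_def
    proof (intro conjI allI impI)
      show "bilinear (\<lambda>u v. (a t + b t) * (u * v))" by (auto simp: bilinear_def linear_iff algebra_simps)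
      show "(a t + b t) * (u * v) = (a t + b t) * (v * u)" for u v by (simp add: mult.commute)
      show "(a t + b t) * (u * u) > 0" if "u \<noteq> 0" for u
        by (rule mult_pos_pos[OF pos(1)]) (use that in \<open>auto simp: zero_less_mult_iff\<close>)
    qed
    show "linear (\<lambda>z. a t * z)" by (auto simp: linear_iff algebra_simps)
  next
    show "smooth_on UNIV (\<lambda>t. (a t + b t) * (u * v))" for u v
      by (intro smooth_intros as open_UNIV)
    show "smooth_on UNIV (\<lambda>t. a t * z)" for z
      by (intro smooth_intros as open_UNIV)
    show "(a t + b t) * (?s t * z) = a t * z" for t z using pos(1)[of t] by simp
  qed simp
  moreover have "?s t \<in> {0..1}" for t using pos[of t] by (simp add: divide_le_eq)
  moreover have "?s t = 0" if "t \<le> 1/4" for t using that by (simp add: a_def flat_exp_def)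
  moreover have "?s t = 1" if "t \<ge> 3/4" for t using that pos(1)[of t] by (simp add: b_def flat_exp_def)
  ultimately show thesis by (rule that)
qed

subsection \<open>Skew forms in odd dimensions\<close>

text \<open>Two vectors on which the form is nonzero span a nondegenerate plane. Its orthogonal
  complement in \<open>U\<close> with respect to the form is again nondegenerate and has two
  dimensions less.\<close>

lemma nondegenerate_skew_even:
  fixes w :: "'a::euclidean_space \<Rightarrow> 'a \<Rightarrow> real"
  assumes bil: "bilinear w" and skew: "\<And>u v. w u v = - w v u"
    and "subspace U" "\<And>u. u \<in> U \<Longrightarrow> u \<noteq> 0 \<Longrightarrow> \<exists>v\<in>U. w u v \<noteq> 0"
  shows "even (dim U)"
  using assms(3,4)
proof (induction "dim U" arbitrary: U rule: less_induct)
  case less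
  show ?case
  proof (cases "dim U = 0")
    case False
    then obtain u where u: "u \<in> U" "u \<noteq> 0" by (metis dim_eq_0 subsetI singletonI)
    then obtain v where v: "v \<in> U" "w u v \<noteq> 0" using less.prems(2) by blast
    note lin = bilinear_ladd[OF bil] bilinear_radd[OF bil] bilinear_lmul[OF bil] bilinear_rmul[OF bil]
      bilinear_lzero[OF bil] bilinear_rzero[OF bil] bilinear_rsub[OF bil]
    have w0: "w x x = 0" for x using skew[of x x] by simp
    define U' where "U' = {x\<in>U. w u x = 0 \<and> w v x = 0}"
    have sub': "subspace U'"
      using less.prems(1) by (auto simp: U'_def subspace_def lin)
    have decomp: "\<exists>\<alpha> \<beta>. y + \<alpha> *\<^sub>R u + \<beta> *\<^sub>R v \<in> U'" if "y \<in> U" for y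
    proof (intro exI)
      \<comment> \<open>The coefficients are forced by requiring the form to vanish against
        \<open>u\<close> and against \<open>v\<close>; recall that
        \<open>w u u = w v v = 0\<close>.\<close>
      show "y + (w v y / w u v) *\<^sub>R u + (- w u y / w u v) *\<^sub>R v \<in> U'"
        using v less.prems(1) that u(1)
        by (auto simp: U'_def lin w0 skew[of v u] intro!: subspace_add subspace_diff subspace_scale)
    qed
    have nd: "\<exists>y\<in>U'. w x y \<noteq> 0" if x: "x \<in> U'" "x \<noteq> 0" for x
    proof -
      have xU: "x \<in> U" "w x u = 0" "w x v = 0" using x skew[of x] by (auto simp: U'_def)
      then obtain y where y: "y \<in> U" "w x y \<noteq> 0" using less.prems(2) x(2) by blast
      then obtain \<alpha> \<beta> where "y + \<alpha> *\<^sub>R u + \<beta> *\<^sub>R v \<in> U'" using decomp by blast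
      moreover have "w x (y + \<alpha> *\<^sub>R u + \<beta> *\<^sub>R v) \<noteq> 0" using y xU by (simp add: lin)
      ultimately show ?thesis by blast
    qed
    let ?T = "span {u, v}"
    have spanT: "?T = {\<alpha> *\<^sub>R u + \<beta> *\<^sub>R v | \<alpha> \<beta>. True}"
      by (auto simp: span_insert span_singleton) (metis add_diff_cancel_left' diff_add_cancel add.commute)+
    have int0: "U' \<inter> ?T = {0}"
    proof -
      have "x = 0" if xU: "x \<in> U'" and xT: "x \<in> ?T" for x
      proof -
        obtain \<alpha> \<beta> where x: "x = \<alpha> *\<^sub>R u + \<beta> *\<^sub>R v" using xT spanT by auto
        have "w u x = 0" "w v x = 0" using xU by (auto simp: U'_def)
        then have "\<beta> = 0" "\<alpha> = 0" using v(2) skew[of v u] by (auto simp: x lin w0)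
        then show ?thesis by (simp add: x)
      qed
      then show ?thesis using subspace_0[OF sub'] span_zero by blast
    qed
    have ind: "independent {u, v}"
    proof -
      have "u \<notin> span {v}"
      proof
        assume "u \<in> span {v}"
        then obtain k where "u = k *\<^sub>R v" by (auto simp: span_singleton)
        then show False using v(2) by (simp add: lin w0)
      qed
      moreover have "v \<noteq> 0" using v(2) by (auto simp: lin)
      ultimately show ?thesis by (simp add: independent_insert)
    qed
    moreover have "u \<noteq> v" using v(2) w0 by auto
    ultimately have dT: "dim ?T = 2" using dim_eq_card_independent[OF ind] by (simp add: dim_span)
    have "{x + y |x y. x \<in> U' \<and> y \<in> ?T} = U"
    proof (intro set_eqI iffI)
      fix z assume "z \<in> {x + y |x y. x \<in> U' \<and> y \<in> ?T}"
      moreover have "?T \<subseteq> U" using span_minimal[OF _ less.prems(1)] u v by simp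
      ultimately show "z \<in> U" using subspace_add[OF less.prems(1)] by (auto simp: U'_def)
    next
      fix y assume "y \<in> U"
      then obtain \<alpha> \<beta> where "y + \<alpha> *\<^sub>R u + \<beta> *\<^sub>R v \<in> U'" using decomp by blast
      moreover have "(- \<alpha>) *\<^sub>R u + (- \<beta>) *\<^sub>R v \<in> ?T" unfolding spanT by blast
      moreover have "y = (y + \<alpha> *\<^sub>R u + \<beta> *\<^sub>R v) + ((- \<alpha>) *\<^sub>R u + (- \<beta>) *\<^sub>R v)" by simp
      ultimately show "y \<in> {x + y |x y. x \<in> U' \<and> y \<in> ?T}" by blast
    qed
    then have "dim U = dim U' + 2"
      using dim_sums_Int[OF sub' subspace_span[of "{u, v}"]] int0 dT by simp
    moreover from this have "even (dim U')" by (intro less.hyps sub' nd) auto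
    ultimately show ?thesis by simp
  qed presburger
qed

lemma odd_skew_kernel:
  fixes w :: "'a::euclidean_space \<Rightarrow> 'a \<Rightarrow> real"
  assumes "bilinear w" "\<And>u v. w u v = - w v u" "odd DIM('a)"
  shows "\<exists>u. u \<noteq> 0 \<and> (\<forall>v. w u v = 0)"
  using nondegenerate_skew_even[OF assms(1,2) subspace_UNIV] assms(3) by (auto simp: dim_UNIV)

subsection \<open>Local solutions of differential equations\<close>

text \<open>The difference of integrals is the primitive that vanishes at 0, written so that it also
  makes sense for negative \<open>t\<close>.\<close>

lemma primitive_bound:
  fixes g :: "real \<Rightarrow> 'a::banach"
  assumes "continuous_on {-T..T} g" "\<And>s. s \<in> {-T..T} \<Longrightarrow> norm (g s) \<le> C" "t \<in> {-T..T}"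
  shows "norm (integral {-T..t} g - integral {-T..0} g) \<le> T * C"
proof -
  have T: "T \<ge> 0" using assms(3) by auto
  have C: "C \<ge> 0" using assms(2)[OF assms(3)] norm_ge_zero order_trans by blast
  have int: "g integrable_on {a..b}" if "-T \<le> a" "b \<le> T" for a b
    by (rule integrable_continuous_real, rule continuous_on_subset[OF assms(1)]) (use that in auto)
  have b: "norm (integral {a..b} g) \<le> T * C" if "-T \<le> a" "a \<le> b" "b \<le> T" "b - a \<le> T" for a b
  proof -
    have "norm (integral {a..b} g) \<le> C * (b - a)"
      by (rule integral_bound[OF that(2) continuous_on_subset[OF assms(1)]]) (use that assms(2) in auto)
    also have "\<dots> \<le> C * T" using C that by (intro mult_left_mono) auto
    finally show ?thesis by (simp add: mult.commute)
  qed
  show ?thesis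
  proof (cases "t \<ge> 0")
    case True
    have "integral {-T..0} g + integral {0..t} g = integral {-T..t} g"
      by (rule Henstock_Kurzweil_Integration.integral_combine) (use True T assms(3) int in auto)
    then have "integral {-T..t} g - integral {-T..0} g = integral {0..t} g" by (simp add: algebra_simps)
    then show ?thesis using b[of 0 t] True T assms(3) by simp
  next
    case False
    have "integral {-T..t} g + integral {t..0} g = integral {-T..0} g"
      by (rule Henstock_Kurzweil_Integration.integral_combine) (use False T assms(3) int in auto)
    then have "integral {-T..t} g - integral {-T..0} g = - integral {t..0} g" by (simp add: algebra_simps)
    then show ?thesis using b[of t 0] False T assms(3) by simp
  qed
qed

text \<open>The integral operator maps curves in the ball to such curves because
  \<open>T * B \<le> r\<close>, and contracts the supremum norm because \<open>T * K < 1\<close>.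
  Solving to both sides of 0 gives two-sided derivatives at interior times.\<close>

lemma picard_local:
  fixes f :: "real \<Rightarrow> 'a::euclidean_space \<Rightarrow> 'a"
  assumes T: "T > 0" and r: "r \<ge> 0"
    and cont: "continuous_on ({-T..T} \<times> cball x0 r) (\<lambda>(t, x). f t x)"
    and bound: "\<And>t x. t \<in> {-T..T} \<Longrightarrow> x \<in> cball x0 r \<Longrightarrow> norm (f t x) \<le> B" and TB: "T * B \<le> r"
    and lip: "\<And>t x y. t \<in> {-T..T} \<Longrightarrow> x \<in> cball x0 r \<Longrightarrow> y \<in> cball x0 r \<Longrightarrow> norm (f t x - f t y) \<le> K * norm (x - y)"
    and K: "0 \<le> K" "T * K < 1"
  shows "\<exists>x. x 0 = x0 \<and> (\<forall>t\<in>{-T..T}. x t \<in> cball x0 r \<and>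
      (x has_vector_derivative f t (x t)) (at t within {-T..T}))"
proof -
  \<comment> \<open>Clamping time to [-T, T] extends curves to the whole line, so that the fixed
    point can be sought among bounded continuous functions on \<open>UNIV\<close>.\<close>
  define cl where "cl t = max (-T) (min T t)" for t :: real
  have cl: "cl t \<in> {-T..T}" "t \<in> {-T..T} \<Longrightarrow> cl t = t" for t using T by (auto simp: cl_def)
  have clc: "continuous_on UNIV cl" unfolding cl_def by (intro continuous_intros)
  define J where "J g t = integral {-T..t} g - integral {-T..0} g" for g :: "real \<Rightarrow> 'a" and t
  define S where "S = (PiC UNIV (\<lambda>_. cball x0 r) :: (real \<Rightarrow>\<^sub>C 'a) set)"
  have S: "x \<in> S \<longleftrightarrow> (\<forall>t. apply_bcontfun x t \<in> cball x0 r)" for x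
    by (auto simp: S_def mem_PiC_iff)
  have gc: "continuous_on {-T..T} (\<lambda>s. f s (apply_bcontfun x s))" if "x \<in> S" for x
  proof -
    have "continuous_on {-T..T} (\<lambda>s. (\<lambda>(t, x). f t x) (s, apply_bcontfun x s))"
      by (rule continuous_on_compose2[OF cont]) (use that in \<open>auto simp: S intro!: continuous_intros\<close>)
    then show ?thesis by simp
  qed
  define P where "P x t = x0 + J (\<lambda>s. f s (apply_bcontfun x s)) (cl t)" for x t
  have J_deriv: "(J g has_vector_derivative g t) (at t within {-T..T})"
    if "continuous_on {-T..T} g" "t \<in> {-T..T}" for g t
    using has_vector_derivative_diff[OF integral_has_vector_derivative[OF that] has_vector_derivative_const]
    by (simp add: J_def[abs_def])
  have Pb: "P x t \<in> cball x0 r" if "x \<in> S" for x t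
  proof -
    have "norm (J (\<lambda>s. f s (apply_bcontfun x s)) (cl t)) \<le> T * B"
      unfolding J_def using that by (intro primitive_bound gc bound cl) (auto simp: S)
    then show ?thesis using TB by (simp add: P_def dist_norm)
  qed
  have Pc: "P x \<in> bcontfun" if "x \<in> S" for x
  proof -
    have "continuous_on {-T..T} (J (\<lambda>s. f s (apply_bcontfun x s)))"
      using J_deriv[OF gc[OF that]]
      by (meson continuous_on_eq_continuous_within has_vector_derivative_continuous)
    then have "continuous_on UNIV (P x)"
      unfolding P_def by (intro continuous_intros continuous_on_compose2[OF _ clc]) (use cl in auto)
    moreover have "bounded (range (P x))"
      by (rule bounded_subset[OF bounded_cball]) (use Pb[OF that] in blast)
    ultimately show ?thesis by (simp add: bcontfun_def)
  qed
  have Pa: "apply_bcontfun (Bcontfun (P x)) = P x" if "x \<in> S" for x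
    using Pc[OF that] by (rule Bcontfun_inverse)
  have "\<exists>!x\<in>S. Bcontfun (P x) = x"
  proof (rule Banach_fix)
    show "complete S" unfolding S_def complete_eq_closed by (intro closed_PiC) auto
    have "const_bcontfun x0 \<in> S" using r by (simp add: S const_bcontfun.rep_eq)
    then show "S \<noteq> {}" by blast
    show "0 \<le> T * K" "T * K < 1" using T K by auto
    show "(\<lambda>x. Bcontfun (P x)) ` S \<subseteq> S" using Pa Pb by (auto simp: S)
  next
    fix x y assume xy: "x \<in> S" "y \<in> S"
    show "dist (Bcontfun (P x)) (Bcontfun (P y)) \<le> T * K * dist x y"
    proof (rule dist_bound)
      fix t
      let ?g = "\<lambda>x s. f s (apply_bcontfun x s)"
      have int: "?g x integrable_on {-T..b}" if "b \<le> T" "x \<in> S" for b x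
        by (rule integrable_continuous_real, rule continuous_on_subset[OF gc[OF that(2)]]) (use that in auto)
      have "P x t - P y t = J (\<lambda>s. ?g x s - ?g y s) (cl t)"
        using integral_diff[OF int[of "cl t" x] int[of "cl t" y]] integral_diff[OF int[of 0 x] int[of 0 y]] xy T cl(1)[of t]
        by (simp add: P_def J_def)
      also have "norm \<dots> \<le> T * (K * dist x y)"
        unfolding J_def
      proof (intro primitive_bound cl continuous_on_diff gc xy)
        fix s assume "s \<in> {-T..T}"
        then have "norm (?g x s - ?g y s) \<le> K * norm (apply_bcontfun x s - apply_bcontfun y s)"
          using xy by (intro lip) (auto simp: S)
        also have "\<dots> \<le> K * dist x y"
          using dist_bounded[of x s y] K by (intro mult_left_mono) (auto simp: dist_norm)
        finally show "norm (?g x s - ?g y s) \<le> K * dist x y" .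
      qed
      finally show "dist (apply_bcontfun (Bcontfun (P x)) t) (apply_bcontfun (Bcontfun (P y)) t) \<le> T * K * dist x y"
        using Pa xy by (simp add: dist_norm mult.assoc)
    qed
  qed
  then obtain x where x: "x \<in> S" "Bcontfun (P x) = x" by blast
  define y where "y = apply_bcontfun x"
  have y: "y t = P x t" for t using Pa[OF x(1)] x(2) by (simp add: y_def)
  have "y 0 = x0" using cl(2)[of 0] T by (simp add: y P_def J_def)
  moreover have "y t \<in> cball x0 r" for t using x(1) by (simp add: S y_def)
  moreover have "(y has_vector_derivative f t (y t)) (at t within {-T..T})" if t: "t \<in> {-T..T}" for t
  proof -
    have "((\<lambda>t. x0 + J (\<lambda>s. f s (apply_bcontfun x s)) t) has_vector_derivative 0 + f t (apply_bcontfun x t)) (at t within {-T..T})"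
      by (intro has_vector_derivative_add has_vector_derivative_const J_deriv gc x t)
    then have "((\<lambda>t. x0 + J (\<lambda>s. f s (apply_bcontfun x s)) t) has_vector_derivative f t (y t)) (at t within {-T..T})"
      by (simp add: y_def)
    then show ?thesis
      by (rule has_vector_derivative_transform[OF t, rotated]) (simp add: y P_def cl)
  qed
  ultimately show ?thesis by blast
qed

text \<open>The variant for fields along a map \<open>p\<close>, within a set, as required for
  one-sided derivatives at the ends of [0,1]. It is the chain rule for the pair of \<open>p\<close>
  and \<open>u\<close>.\<close>

lemma has_derivative_linear_family_compose:
  fixes L :: "'c::real_normed_vector \<Rightarrow> 'a::euclidean_space \<Rightarrow> 'b::real_normed_vector"
  assumes "open S" "p a \<in> S" "\<And>x. x \<in> S \<Longrightarrow> linear (L x)" "\<And>b. (\<lambda>y. L y b) differentiable (at (p a))"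
    and p: "(p has_derivative p') (at a within A)" and u: "(u has_derivative u') (at a within A)"
  shows "((\<lambda>y. L (p y) (u y)) has_derivative
     (\<lambda>w. fd (\<lambda>y. L y (u a)) (p a) (p' w) + L (p a) (u' w))) (at a within A)"
proof -
  let ?z = "(p a, u a)"
  have 1: "((\<lambda>z. L (fst z) b) has_derivative (\<lambda>w. fd (\<lambda>y. L y b) (p a) (fst w))) (at ?z)" for b
    using has_derivative_compose[OF has_derivative_fst[OF has_derivative_ident], of "\<lambda>y. L y b" "fd (\<lambda>y. L y b) (p a)" ?z UNIV]
      fd_works[OF assms(4)] by simp
  have "((\<lambda>z. L (fst z) (snd z)) has_derivative
    (\<lambda>w. fd (\<lambda>z. L (fst z) (snd ?z)) ?z w + L (fst ?z) (snd w))) (at ?z)"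
  proof (rule has_derivative_linear_family[where S="S \<times> UNIV" and L="\<lambda>z. L (fst z)"])
    show "open (S \<times> (UNIV :: 'a set))" using assms(1) by (simp add: open_Times)
    show "(snd has_derivative snd) (at ?z)" by (rule has_derivative_snd[OF has_derivative_ident])
  qed (use assms(2,3) 1 in \<open>auto intro: differentiableI\<close>)
  then have 2: "((\<lambda>z. L (fst z) (snd z)) has_derivative
    (\<lambda>w. fd (\<lambda>y. L y (u a)) (p a) (fst w) + L (p a) (snd w))) (at ?z)"
    by (simp add: fd_eq[OF 1])
  show ?thesis
    using has_derivative_compose[OF has_derivative_Pair[OF p u] 2] by simp
qed

lemma has_derivative_bilinear_family_compose:
  fixes B :: "'c::real_normed_vector \<Rightarrow> 'a::euclidean_space \<Rightarrow> 'a2::euclidean_space \<Rightarrow> 'b::real_normed_vector"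
  assumes "open S" "p a \<in> S" "\<And>x. x \<in> S \<Longrightarrow> bilinear (B x)" "\<And>b c. (\<lambda>y. B y b c) differentiable (at (p a))"
    and p: "(p has_derivative p') (at a within A)" and u: "(u has_derivative u') (at a within A)"
    and v: "(v has_derivative v') (at a within A)"
  shows "((\<lambda>y. B (p y) (u y) (v y)) has_derivative
     (\<lambda>w. fd (\<lambda>y. B y (u a) (v a)) (p a) (p' w) + B (p a) (u' w) (v a) + B (p a) (u a) (v' w))) (at a within A)"
proof -
  let ?z = "(p a, v a)"
  have d: "((\<lambda>z. B (fst z) b (snd z)) has_derivative
     (\<lambda>w. fd (\<lambda>y. B y b (v a)) (p a) (fst w) + B (p a) b (snd w))) (at ?z)" for b
    using has_derivative_linear_family_compose[where L="\<lambda>x. B x b" and p=fst and u=snd and a="?z" and A=UNIV, 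
        OF assms(1) _ _ _ has_derivative_fst[OF has_derivative_ident] has_derivative_snd[OF has_derivative_ident]]
      assms(2,3,4) by (simp add: bilinear_def)
  have "((\<lambda>y. (\<lambda>z u. B (fst z) u (snd z)) (p y, v y) (u y)) has_derivative
     (\<lambda>w. fd (\<lambda>z. B (fst z) (u a) (snd z)) (p a, v a) (p' w, v' w) + B (fst (p a, v a)) (u' w) (snd (p a, v a)))) (at a within A)"
  proof (rule has_derivative_linear_family_compose[where S="S \<times> UNIV"])
    show "open (S \<times> (UNIV :: 'a2 set))" using assms(1) by (simp add: open_Times)
    show "linear (\<lambda>u. B (fst z) u (snd z))" if "z \<in> S \<times> UNIV" for z
      using assms(3)[of "fst z"] that by (auto simp: bilinear_def)
    show "((\<lambda>y. (p y, v y)) has_derivative (\<lambda>w. (p' w, v' w))) (at a within A)"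
      by (rule has_derivative_Pair[OF p v])
  qed (use assms(2) d u in \<open>auto intro: differentiableI\<close>)
  then show ?thesis by (simp add: fd_eq[OF d] algebra_simps)
qed

section \<open>Riemannian metrics on open sets\<close>

locale metric_patch =
  fixes S :: "'e::euclidean_space set" and G :: "'e \<Rightarrow> 'e \<Rightarrow> 'e \<Rightarrow> real"
  assumes open_S: "open S" and metric: "metric_on S G"
begin

lemma ip: "x \<in> S \<Longrightarrow> inner_product (G x)" using metric by (simp add: metric_on_def)
lemma G_bil: "x \<in> S \<Longrightarrow> bilinear (G x)" using ip by (simp add: inner_product_def)
lemma G_sym: "x \<in> S \<Longrightarrow> G x u v = G x v u" using ip[of x] unfolding inner_product_def by blast
lemma G_pos: "x \<in> S \<Longrightarrow> u \<noteq> 0 \<Longrightarrow> G x u u > 0" using ip[of x] unfolding inner_product_def by blast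
lemma G_smooth: "smooth_on S (\<lambda>x. G x u v)" using metric by (simp add: metric_on_def)
lemma G_diff: "x \<in> S \<Longrightarrow> (\<lambda>x. G x u v) differentiable (at x)" using G_smooth smooth_on_differentiable by blast
lemma G_eq0: "x \<in> S \<Longrightarrow> G x u u = 0 \<Longrightarrow> u = 0" using G_pos[of x u] by force
lemma G_nonneg: "x \<in> S \<Longrightarrow> G x u u \<ge> 0"
  using G_pos[of x u] bilinear_lzero[OF G_bil[of x], of u] by (cases "u = 0") auto

lemmas G_lin = bilinear_ladd[OF G_bil] bilinear_radd[OF G_bil] bilinear_lsub[OF G_bil] bilinear_rsub[OF G_bil]
  bilinear_lmul[OF G_bil] bilinear_rmul[OF G_bil] bilinear_lneg[OF G_bil] bilinear_rneg[OF G_bil]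
  bilinear_lzero[OF G_bil] bilinear_rzero[OF G_bil]

definition dG :: "'e \<Rightarrow> 'e \<Rightarrow> 'e \<Rightarrow> 'e \<Rightarrow> real" where
  "dG x w u v = fd (\<lambda>y. G y u v) x w"

lemma dG_linear:
  assumes x: "x \<in> S"
  shows "linear (\<lambda>w. dG x w u v)" "linear (\<lambda>u. dG x w u v)" "linear (\<lambda>v. dG x w u v)"
  unfolding dG_def
  by (rule fd_linear[OF G_diff[OF x]],
      (rule linear_fd_family[OF open_S x]; use G_bil G_diff[OF x] in \<open>simp add: bilinear_def\<close>)+)

lemma dG_sym: "x \<in> S \<Longrightarrow> dG x w u v = dG x w v u"
  unfolding dG_def by (subst fd_cong[OF open_S, of x "\<lambda>y. G y u v" "\<lambda>y. G y v u"]) (auto simp: G_sym)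

abbreviation Gam :: "'e \<Rightarrow> 'e \<Rightarrow> 'e \<Rightarrow> 'e" where "Gam \<equiv> christoffel G"

lemma koszul_linear:
  assumes x: "x \<in> S" shows "linear (\<lambda>z. (dG x u v z + dG x v u z - dG x z u v) / 2)"
proof -
  have "linear (\<lambda>z. (1/2) *\<^sub>R (dG x u v z + dG x v u z - dG x z u v))"
    by (intro linear_compose_scale_right linear_compose_add linear_compose_sub dG_linear x)
  then show ?thesis by simp
qed

lemma Gam_koszul:
  assumes x: "x \<in> S"
  shows "G x (Gam x u v) z = (dG x u v z + dG x v u z - dG x z u v) / 2"
proof -
  have "\<exists>!w. \<forall>z. G x w z = (dG x u v z + dG x v u z - dG x z u v) / 2"
    by (rule inner_product_riesz[OF ip[OF x] koszul_linear[OF x]])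
  then have "\<exists>!w. \<forall>z. 2 * G x w z = dG x u v z + dG x v u z - dG x z u v"
    by (simp add: field_simps)
  from theI'[OF this] show ?thesis
    by (simp add: christoffel_def dG_def field_simps)
qed

lemma Gam_unique:
  assumes x: "x \<in> S" and "\<And>z. 2 * G x w z = dG x u v z + dG x v u z - dG x z u v"
  shows "Gam x u v = w"
  by (rule inner_product_eqI[OF ip[OF x]]) (use assms(2) in \<open>simp add: Gam_koszul[OF x] field_simps\<close>)

lemma Gam_sym: "x \<in> S \<Longrightarrow> Gam x u v = Gam x v u"
proof (rule inner_product_eqI[OF ip])
  show "G x (Gam x u v) z = G x (Gam x v u) z" if "x \<in> S" for z
    using dG_sym[OF that, of z u v] by (simp add: Gam_koszul that)
qed

lemma Gam_bil: assumes x: "x \<in> S" shows "bilinear (Gam x)"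
proof -
  note l = linear_add[OF dG_linear(1)[OF x]] linear_add[OF dG_linear(2)[OF x]] linear_add[OF dG_linear(3)[OF x]]
    linear_cmul[OF dG_linear(1)[OF x]] linear_cmul[OF dG_linear(2)[OF x]] linear_cmul[OF dG_linear(3)[OF x]]
  have lin: "linear (\<lambda>v. Gam x u v)" for u
  proof (rule linearI)
    show "Gam x u (a + b) = Gam x u a + Gam x u b" for a b
      by (rule inner_product_eqI[OF ip[OF x]]) (simp add: Gam_koszul[OF x] G_lin x l field_simps)
    show "Gam x u (r *\<^sub>R a) = r *\<^sub>R Gam x u a" for r a
      by (rule inner_product_eqI[OF ip[OF x]]) (simp add: Gam_koszul[OF x] G_lin x l field_simps)
  qed
  moreover have "(\<lambda>u. Gam x u v) = Gam x v" for v using Gam_sym[OF x] by auto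
  ultimately have "linear (\<lambda>u. Gam x u v)" for v by simp
  then show ?thesis using lin by (simp add: bilinear_def)
qed

lemmas Gam_lin = bilinear_ladd[OF Gam_bil] bilinear_radd[OF Gam_bil] bilinear_lsub[OF Gam_bil] bilinear_rsub[OF Gam_bil]
  bilinear_lmul[OF Gam_bil] bilinear_rmul[OF Gam_bil] bilinear_lneg[OF Gam_bil] bilinear_rneg[OF Gam_bil]
  bilinear_lzero[OF Gam_bil] bilinear_rzero[OF Gam_bil]

lemma Gam_smooth: "smooth_on S (\<lambda>x. Gam x u v)"
proof (rule smooth_on_linear_system[where B=G and r="\<lambda>x z. (1/2) *\<^sub>R (dG x u v z + dG x v u z - dG x z u v)"])
  show "smooth_on S (\<lambda>x. (1/2) *\<^sub>R (dG x u v z + dG x v u z - dG x z u v))" for z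
    unfolding dG_def by (intro smooth_intros open_S smooth_on_fd_const G_smooth)
  show "linear (\<lambda>z. (1/2) *\<^sub>R (dG x u v z + dG x v u z - dG x z u v))" if "x \<in> S" for x
    using koszul_linear[OF that] by simp
qed (simp_all add: open_S ip G_smooth Gam_koszul)

lemma Gam_diff: "x \<in> S \<Longrightarrow> (\<lambda>x. Gam x u v) differentiable (at x)"
  using Gam_smooth smooth_on_differentiable by blast

text \<open>The Levi-Civita connection is metric: in the sum of the two Koszul expressions the terms
  differentiated along \<open>u\<close> and \<open>v\<close> cancel.\<close>

lemma metric_compat:
  assumes x: "x \<in> S" shows "dG x w u v = G x (Gam x w u) v + G x u (Gam x w v)"
  using G_sym[OF x, of u "Gam x w v"] dG_sym[OF x, of w u v] dG_sym[OF x, of u w v] dG_sym[OF x, of v w u]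
  by (simp add: Gam_koszul[OF x] field_simps)

lemma metric_has_derivative:
  assumes x: "p a \<in> S" and p: "(p has_derivative p') (at a within A)" and u: "(u has_derivative u') (at a within A)"
    and v: "(v has_derivative v') (at a within A)"
  shows "((\<lambda>y. G (p y) (u y) (v y)) has_derivative
     (\<lambda>w. G (p a) (u' w + Gam (p a) (p' w) (u a)) (v a) + G (p a) (u a) (v' w + Gam (p a) (p' w) (v a)))) (at a within A)"
proof -
  have "((\<lambda>y. G (p y) (u y) (v y)) has_derivative
     (\<lambda>w. fd (\<lambda>y. G y (u a) (v a)) (p a) (p' w) + G (p a) (u' w) (v a) + G (p a) (u a) (v' w))) (at a within A)"
    by (rule has_derivative_bilinear_family_compose[OF open_S x G_bil G_diff[OF x] p u v])
  then show ?thesis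
    using metric_compat[OF x] by (simp add: dG_def G_lin x algebra_simps)
qed

definition cov :: "'e \<Rightarrow> ('e \<Rightarrow> 'e) \<Rightarrow> 'e \<Rightarrow> 'e" where
  "cov x X u = fd X x u + Gam x u (X x)"

lemma fd_metric:
  assumes x: "x \<in> S" and "X differentiable (at x)" "Y differentiable (at x)"
  shows "fd (\<lambda>y. G y (X y) (Y y)) x w = G x (cov x X w) (Y x) + G x (X x) (cov x Y w)"
  using fd_eq[OF metric_has_derivative[where p="\<lambda>y. y" and A=UNIV, OF x has_derivative_ident fd_works[OF assms(2)] fd_works[OF assms(3)]]]
  by (simp add: cov_def)

lemma cov_smooth:
  "smooth_on S X \<Longrightarrow> smooth_on S u \<Longrightarrow> smooth_on S (\<lambda>x. cov x X (u x))"
  unfolding cov_def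
  by (intro smooth_on_add open_S smooth_on_fd smooth_on_bilinear_family[OF open_S Gam_bil Gam_smooth])

end

section \<open>Riemannian submersions of open sets\<close>

locale submersion_patch = metric_patch S G
  for S :: "'e::euclidean_space set" and G +
  fixes \<pi> :: "'e \<Rightarrow> 'h::euclidean_space" and k :: "'h \<Rightarrow> 'h \<Rightarrow> 'h \<Rightarrow> real"
  assumes pi_smooth: "smooth_on S \<pi>" and open_img: "open (\<pi> ` S)" and k_metric: "metric_on (\<pi> ` S) k"
    and pi_surj: "x \<in> S \<Longrightarrow> surj (fd \<pi> x)"
    and isometric: "x \<in> S \<Longrightarrow> (\<And>z. fd \<pi> x z = 0 \<Longrightarrow> G x u z = 0 \<and> G x w z = 0) \<Longrightarrow>
       k (\<pi> x) (fd \<pi> x u) (fd \<pi> x w) = G x u w"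
begin

abbreviation vert :: "'e \<Rightarrow> 'e \<Rightarrow> bool" where "vert x v \<equiv> fd \<pi> x v = 0"
definition hor :: "'e \<Rightarrow> 'e \<Rightarrow> bool" where "hor x u \<longleftrightarrow> (\<forall>z. vert x z \<longrightarrow> G x u z = 0)"

lemma pi_diff: "x \<in> S \<Longrightarrow> \<pi> differentiable (at x)" using pi_smooth smooth_on_differentiable by blast
lemma pi_lin: "x \<in> S \<Longrightarrow> linear (fd \<pi> x)" using fd_linear[OF pi_diff] .
lemmas pi_simps = linear_add[OF pi_lin] linear_diff[OF pi_lin] linear_cmul[OF pi_lin] linear_0[OF pi_lin] linear_neg[OF pi_lin]

lemma k_ip: "x \<in> S \<Longrightarrow> inner_product (k (\<pi> x))" using k_metric by (simp add: metric_on_def)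

lemma k_pi_smooth: "smooth_on S (\<lambda>x. k (\<pi> x) b c)"
  using k_metric by (intro smooth_on_compose[OF open_img open_S _ pi_smooth]) (auto simp: metric_on_def)

text \<open>The adjoint of \<open>fd \<pi> x\<close> with respect to \<open>k\<close> and
  \<open>G\<close>. It is the horizontal lift, by \<open>lift_hor\<close> and
  \<open>pi_lift\<close>; given as the solution of a linear system, it is smooth in
  \<open>x\<close>.\<close>

definition lift :: "'e \<Rightarrow> 'h \<Rightarrow> 'e" where
  "lift x \<beta> = (THE w. \<forall>z. G x w z = k (\<pi> x) \<beta> (fd \<pi> x z))"

lemma lift_rhs_linear: "x \<in> S \<Longrightarrow> linear (\<lambda>z. k (\<pi> x) \<beta> (fd \<pi> x z))"
  using linear_compose[OF pi_lin inner_product_linear(1)[OF k_ip]] by (simp add: o_def)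

lemma lift_eq: assumes x: "x \<in> S" shows "G x (lift x \<beta>) z = k (\<pi> x) \<beta> (fd \<pi> x z)"
  using theI'[OF inner_product_riesz[OF ip[OF x] lift_rhs_linear[OF x]]] unfolding lift_def by blast

lemma lift_hor: "x \<in> S \<Longrightarrow> hor x (lift x \<beta>)"
  using linear_0[OF inner_product_linear(1)[OF k_ip]] by (simp add: hor_def lift_eq)

lemma lift_linear: assumes x: "x \<in> S" shows "linear (lift x)"
proof (rule linearI)
  note l = inner_product_linear(2)[OF k_ip[OF x]]
  show "lift x (a + b) = lift x a + lift x b" for a b
    by (rule inner_product_eqI[OF ip[OF x]]) (simp add: lift_eq x G_lin linear_add[OF l])
  show "lift x (r *\<^sub>R a) = r *\<^sub>R lift x a" for r a
    by (rule inner_product_eqI[OF ip[OF x]]) (simp add: lift_eq x G_lin linear_cmul[OF l])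
qed

lemmas lift_simps = linear_add[OF lift_linear] linear_diff[OF lift_linear] linear_cmul[OF lift_linear] linear_0[OF lift_linear]

lemma hor_vert_zero: "x \<in> S \<Longrightarrow> hor x u \<Longrightarrow> vert x u \<Longrightarrow> u = 0"
  by (rule G_eq0) (auto simp: hor_def)

text \<open>A lift that projects to 0 is both horizontal and vertical, so projecting after lifting
  is injective, hence onto. The isometry condition then compares it with the identity through
  \<open>k\<close>.\<close>

lemma pi_lift: assumes x: "x \<in> S" shows "fd \<pi> x (lift x \<beta>) = \<beta>"
proof -
  define M where "M \<gamma> = fd \<pi> x (lift x \<gamma>)" for \<gamma>
  have lM: "linear M"
    using linear_compose[OF lift_linear[OF x] pi_lin[OF x]] by (simp add: o_def M_def[abs_def])
  have "inj M" unfolding linear_injective_0[OF lM]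
  proof (intro allI impI)
    fix \<gamma> assume "M \<gamma> = 0"
    then have "lift x \<gamma> = 0" using lift_hor[OF x] hor_vert_zero[OF x] by (simp add: M_def)
    then have "k (\<pi> x) \<gamma> (fd \<pi> x z) = 0" for z using lift_eq[OF x, of \<gamma> z] by (simp add: G_lin x)
    then have "k (\<pi> x) \<gamma> \<gamma> = 0" using pi_surj[OF x] by (metis surjD)
    then show "\<gamma> = 0" using k_ip[OF x] unfolding inner_product_def by (metis less_irrefl)
  qed
  then have "surj M" by (rule linear_inj_imp_surj[OF lM])
  show ?thesis
  proof (rule inner_product_eqI[OF k_ip[OF x]])
    fix z
    obtain \<gamma> where \<gamma>: "z = M \<gamma>" using \<open>surj M\<close> by (metis surjD)
    have "k (\<pi> x) (fd \<pi> x (lift x \<beta>)) (fd \<pi> x (lift x \<gamma>)) = G x (lift x \<beta>) (lift x \<gamma>)"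
      using lift_hor[OF x] by (intro isometric[OF x]) (auto simp: hor_def)
    also have "\<dots> = k (\<pi> x) \<beta> (fd \<pi> x (lift x \<gamma>))" by (rule lift_eq[OF x])
    finally show "k (\<pi> x) (fd \<pi> x (lift x \<beta>)) z = k (\<pi> x) \<beta> z" by (simp add: \<gamma> M_def)
  qed
qed

lemma lift_smooth: "smooth_on S (\<lambda>x. lift x \<beta>)"
proof (rule smooth_on_linear_system[where B=G and r="\<lambda>x z. k (\<pi> x) \<beta> (fd \<pi> x z)"])
  show "smooth_on S (\<lambda>x. k (\<pi> x) \<beta> (fd \<pi> x z))" for z
    by (rule smooth_on_linear_family[OF open_S _ k_pi_smooth smooth_on_fd_const[OF pi_smooth]])
      (rule inner_product_linear(1)[OF k_ip])
qed (simp_all add: open_S ip G_smooth lift_eq lift_rhs_linear)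

lemma lift_diff: "x \<in> S \<Longrightarrow> (\<lambda>x. lift x \<beta>) differentiable (at x)"
  using lift_smooth smooth_on_differentiable by blast

text \<open>The orthogonal projection onto the vertical space.\<close>

definition Q :: "'e \<Rightarrow> 'e \<Rightarrow> 'e" where "Q x v = v - lift x (fd \<pi> x v)"

lemma Q_vert: "x \<in> S \<Longrightarrow> vert x (Q x v)" by (simp add: Q_def pi_simps pi_lift)
lemma Q_id: "x \<in> S \<Longrightarrow> vert x v \<Longrightarrow> Q x v = v" by (simp add: Q_def lift_simps)
lemma G_Q: "x \<in> S \<Longrightarrow> vert x w \<Longrightarrow> G x (Q x v) w = G x v w"
  using lift_hor[of x "fd \<pi> x v"] by (simp add: Q_def G_lin hor_def)
lemma Q_linear: "x \<in> S \<Longrightarrow> linear (Q x)"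
  by (rule linearI) (simp_all add: Q_def pi_simps lift_simps algebra_simps)
lemma Q_smooth: "smooth_on S (\<lambda>x. Q x v)"
  unfolding Q_def
  by (intro smooth_intros open_S smooth_on_linear_family[OF open_S lift_linear lift_smooth] smooth_on_fd_const pi_smooth)
lemma Q_diff: "x \<in> S \<Longrightarrow> (\<lambda>x. Q x v) differentiable (at x)"
  using Q_smooth smooth_on_differentiable by blast
lemma hor_eq_lift: assumes x: "x \<in> S" and u: "hor x u" shows "u = lift x (fd \<pi> x u)"
proof -
  have "hor x (Q x u)" using u lift_hor[OF x, of "fd \<pi> x u"] by (simp add: hor_def Q_def G_lin x)
  then show ?thesis using hor_vert_zero[OF x _ Q_vert[OF x]] by (simp add: Q_def)
qed

text \<open>\<open>T \<beta>\<close> is \<open>\<nabla>X\<close> for the basic field \<open>X\<close> over the constant vector \<open>\<beta>\<close>. On vertical vectors its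
  vertical part is \<open>-S\<^sub>X\<close> and its horizontal part is \<open>-A\<^sup>*\<^sub>X\<close>.\<close>

definition T :: "'h \<Rightarrow> 'e \<Rightarrow> 'e \<Rightarrow> 'e" where "T \<beta> x v = cov x (\<lambda>x. lift x \<beta>) v"

lemma T_alt: "T \<beta> x v = fd (\<lambda>x. lift x \<beta>) x v + Gam x v (lift x \<beta>)"
  by (simp add: T_def cov_def)

lemma T_linear: assumes x: "x \<in> S" shows "linear (T \<beta> x)"
  unfolding T_def cov_def using Gam_bil[OF x] fd_linear[OF lift_diff[OF x]]
  by (intro linear_compose_add) (simp_all add: bilinear_def)

lemma T_linear2: assumes x: "x \<in> S" shows "linear (\<lambda>\<beta>. T \<beta> x v)"
  unfolding T_alt
proof (intro linear_compose_add)
  show "linear (\<lambda>\<beta>. fd (\<lambda>x. lift x \<beta>) x v)"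
    by (rule linear_fd_family[OF open_S x lift_linear lift_diff[OF x]])
  show "linear (\<lambda>\<beta>. Gam x v (lift x \<beta>))"
    using linear_compose[OF lift_linear[OF x], of "Gam x v"] Gam_bil[OF x] by (simp add: bilinear_def o_def)
qed

lemma T_smooth: "smooth_on S u \<Longrightarrow> smooth_on S (\<lambda>x. T \<beta> x (u x))"
  unfolding T_def by (rule cov_smooth[OF lift_smooth])

lemma T_diff: "x \<in> S \<Longrightarrow> (\<lambda>x. T \<beta> x v) differentiable (at x)"
  using T_smooth[OF smooth_on_const] smooth_on_differentiable by blast

text \<open>The right-hand side depends on \<open>Y\<close> only through \<open>Y x\<close>: the vertical part of a covariant
  derivative is tensorial on horizontal fields.\<close>

lemma cov_horizontal_field:
  assumes "open W" "x \<in> W" "W \<subseteq> S" and Y: "\<And>y. y \<in> W \<Longrightarrow> hor y (Y y)" "Y differentiable (at x)" and w: "vert x w"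
  shows "G x (cov x Y u) w = - G x (Y x) (cov x (\<lambda>y. Q y w) u)"
proof -
  have x: "x \<in> S" using assms by auto
  \<comment> \<open>\<open>Q y w\<close> extends \<open>w\<close> to a vertical field, so its
    product with the horizontal field \<open>Y\<close> vanishes identically near \<open>x\<close>.
    Differentiating that product moves the covariant derivative from \<open>Y\<close> to the
    extension.\<close>
  have "fd (\<lambda>y. G y (Y y) (Q y w)) x = fd (\<lambda>y. 0) x"
    by (rule fd_cong[OF assms(1,2)]) (use Y(1) Q_vert assms(3) in \<open>auto simp: hor_def\<close>)
  then have "G x (cov x Y u) (Q x w) + G x (Y x) (cov x (\<lambda>y. Q y w) u) = 0"
    using fd_metric[OF x Y(2) Q_diff[OF x, of w], of u] by simp
  then show ?thesis by (simp add: Q_id[OF x w])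
qed

section \<open>Brackets of projectable fields and the symmetries of the fundamental tensors\<close>

lemma projectable_fd:
  assumes x: "x \<in> S" and A: "A differentiable (at x)" "\<And>y. y \<in> S \<Longrightarrow> fd \<pi> y (A y) = c"
  shows "fd \<pi> x (fd A x w) = - fd (\<lambda>y. fd \<pi> y (A x)) x w"
proof -
  have "((\<lambda>y. fd \<pi> y (A y)) has_derivative (\<lambda>w. fd (\<lambda>y. fd \<pi> y (A x)) x w + fd \<pi> x (fd A x w))) (at x)"
    using smooth_on_differentiable[OF smooth_on_fd_const[OF pi_smooth] x]
    by (intro has_derivative_linear_family[OF open_S x pi_lin _ fd_works[OF A(1)]])
  note 1 = fd_eq[OF this]
  have "fd (\<lambda>y. fd \<pi> y (A y)) x = fd (\<lambda>y. c) x"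
    by (rule fd_cong[OF open_S x]) (rule A(2))
  then have "fd (\<lambda>y. fd \<pi> y (A x)) x w + fd \<pi> x (fd A x w) = 0"
    unfolding 1 by (simp add: fun_eq_iff)
  then show ?thesis by (simp add: eq_neg_iff_add_eq_0 add.commute)
qed

text \<open>Fields related by \<pi> to constant fields have a bracket related to 0. In coordinates
  both projected terms are the same second derivative of \<pi>, which is symmetric.\<close>

lemma bracket_vertical:
  assumes x: "x \<in> S" and A: "A differentiable (at x)" "\<And>y. y \<in> S \<Longrightarrow> fd \<pi> y (A y) = c"
    and B: "B differentiable (at x)" "\<And>y. y \<in> S \<Longrightarrow> fd \<pi> y (B y) = d"
  shows "vert x (fd A x (B x) - fd B x (A x))"
  using projectable_fd[OF x A, of "B x"] projectable_fd[OF x B, of "A x"]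
    fd_symmetric[OF open_S pi_smooth x, of "A x" "B x"] by (simp add: pi_simps x)

text \<open>Self-adjointness of the shape operator. It reflects integrability of the fibres: the
  vertical extensions of \<open>v\<close> and \<open>w\<close> have a vertical bracket, on which the
  horizontal field pairs to 0.\<close>

lemma T_symmetric:
  assumes x: "x \<in> S" and v: "vert x v" and w: "vert x w"
  shows "G x (T \<beta> x v) w = G x v (T \<beta> x w)"
proof -
  have 1: "G x (T \<beta> x a) b = - G x (lift x \<beta>) (fd (\<lambda>y. Q y b) x a + Gam x a b)" if "vert x b" for a b
    unfolding T_def using cov_horizontal_field[OF open_S x subset_refl lift_hor lift_diff[OF x] that] that
    by (simp add: cov_def Q_id x)
  have "vert x (fd (\<lambda>y. Q y w) x v - fd (\<lambda>y. Q y v) x w)"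
    using bracket_vertical[OF x Q_diff[OF x, of w] Q_vert Q_diff[OF x, of v] Q_vert] v w by (simp add: Q_id x)
  then have "G x (lift x \<beta>) (fd (\<lambda>y. Q y w) x v - fd (\<lambda>y. Q y v) x w) = 0"
    using lift_hor[OF x] by (simp add: hor_def)
  then have "G x (T \<beta> x v) w = G x (T \<beta> x w) v"
    unfolding 1[OF v] 1[OF w] Gam_sym[OF x, of w v] by (simp add: G_lin x)
  then show ?thesis using G_sym[OF x] by simp
qed

text \<open>The bracket of the basic field X and a vertical field V is vertical, so \<nabla>_V X and
  \<nabla>_X V have the same horizontal part. Pairing with a basic field Y and moving the derivative
  from V to Y gives the formula; this links the horizontal part of \<open>T\<close> to the O'Neill
  tensor.\<close>

lemma T_adjoint:
  assumes x: "x \<in> S" and v: "vert x v"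
  shows "G x (T \<beta> x v) (lift x \<beta>') = - G x v (T \<beta>' x (lift x \<beta>))"
proof -
  have 1: "G x (T \<beta>' x (lift x \<beta>)) v = - G x (lift x \<beta>') (fd (\<lambda>y. Q y v) x (lift x \<beta>) + Gam x (lift x \<beta>) v)"
    unfolding T_def using cov_horizontal_field[OF open_S x subset_refl lift_hor lift_diff[OF x] v] v
    by (simp add: cov_def Q_id x)
  have "vert x (fd (\<lambda>y. Q y v) x (lift x \<beta>) - fd (\<lambda>x. lift x \<beta>) x v)"
    using bracket_vertical[OF x Q_diff[OF x, of v] Q_vert lift_diff[OF x, of \<beta>] pi_lift] v by (simp add: Q_id x)
  then have "G x (lift x \<beta>') (fd (\<lambda>y. Q y v) x (lift x \<beta>) - fd (\<lambda>x. lift x \<beta>) x v) = 0"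
    using lift_hor[OF x] by (simp add: hor_def)
  then have "G x (T \<beta>' x (lift x \<beta>)) v = - G x (lift x \<beta>') (T \<beta> x v)"
    unfolding 1 unfolding T_alt Gam_sym[OF x, of "lift x \<beta>" v] by (simp add: G_lin x)
  then show ?thesis using G_sym[OF x] by simp
qed

text \<open>The inner product of two basic fields is constant along the fibres.\<close>

lemma T_skew:
  assumes x: "x \<in> S" and v: "vert x v"
  shows "G x (T \<beta> x v) (lift x \<beta>') = - G x (T \<beta>' x v) (lift x \<beta>)"
proof -
  have c: "G y (lift y \<beta>) (lift y \<beta>') = k (\<pi> y) \<beta> \<beta>'" if "y \<in> S" for y
    by (simp add: lift_eq that pi_lift)
  have "((\<lambda>y. k (\<pi> y) \<beta> \<beta>') has_derivative (\<lambda>w. fd (\<lambda>b. k b \<beta> \<beta>') (\<pi> x) (fd \<pi> x w))) (at x)"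
    using k_metric x
    by (intro has_derivative_compose[OF fd_works[OF pi_diff[OF x]]] smooth_on_works[of "\<pi> ` S"]) (auto simp: metric_on_def)
  moreover have "linear (fd (\<lambda>b. k b \<beta> \<beta>') (\<pi> x))"
    using k_metric x by (intro smooth_on_fd_linear[of "\<pi> ` S"]) (auto simp: metric_on_def)
  ultimately have "fd (\<lambda>y. k (\<pi> y) \<beta> \<beta>') x v = 0" using v by (simp add: fd_eq linear_0)
  moreover have "fd (\<lambda>y. G y (lift y \<beta>) (lift y \<beta>')) x = fd (\<lambda>y. k (\<pi> y) \<beta> \<beta>') x"
    by (rule fd_cong[OF open_S x c])
  ultimately show ?thesis
    using fd_metric[OF x lift_diff[OF x, of \<beta>] lift_diff[OF x, of \<beta>'], of v] G_sym[OF x]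
    by (simp add: T_def)
qed

text \<open>This is A_X X = 0: for equal arguments the adjoint formula and skewness leave a number
  equal to its negative.\<close>

lemma accel_hor: assumes x: "x \<in> S" shows "hor x (T \<beta> x (lift x \<beta>))"
proof -
  have "G x (T \<beta> x (lift x \<beta>)) v = 0" if v: "vert x v" for v
    using T_adjoint[OF x v, of \<beta> \<beta>] T_skew[OF x v, of \<beta> \<beta>] G_sym[OF x, of v] by simp
  then show ?thesis by (simp add: hor_def)
qed

text \<open>Along the integral curves of the basic field over \<open>\<beta>\<close>, \<open>dual_rhs \<beta>\<close> is the right-hand side of the
  equation of dual holonomy fields \<open>\<nu>\<close>, and \<open>len_deriv \<beta>\<close> is the derivative of \<open>\<parallel>\<nu>\<parallel>\<^sup>2\<close> as long as \<open>\<nu>\<close> is vertical.\<close>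

definition len_deriv :: "'h \<Rightarrow> 'e \<times> 'e \<Rightarrow> real" where
  "len_deriv \<beta> z = - 2 * G (fst z) (T \<beta> (fst z) (snd z)) (snd z)"

definition dual_rhs :: "'h \<Rightarrow> 'e \<Rightarrow> 'e \<Rightarrow> 'e" where
  "dual_rhs \<beta> x \<nu> = fd (\<lambda>x. lift x \<beta>) x \<nu> - 2 *\<^sub>R Q x (T \<beta> x \<nu>)"

text \<open>Position and dual vector form one autonomous system on pairs; its integral curves are
  used in place of separate fields along curves.\<close>

definition dual_vf :: "'h \<Rightarrow> 'e \<times> 'e \<Rightarrow> 'e \<times> 'e" where
  "dual_vf \<beta> z = (lift (fst z) \<beta>, dual_rhs \<beta> (fst z) (snd z))"

section \<open>Second variation of the squared length\<close>

lemma len_deriv_has_derivative: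
  assumes x: "x \<in> S"
  shows "(len_deriv \<beta> has_derivative (\<lambda>w. - 2 * (
      G x (fd (\<lambda>y. T \<beta> y \<nu>) x (fst w) + T \<beta> x (snd w) + Gam x (fst w) (T \<beta> x \<nu>)) \<nu>
    + G x (T \<beta> x \<nu>) (snd w + Gam x (fst w) \<nu>)))) (at (x, \<nu>))"
proof -
  have 1: "((\<lambda>z. T \<beta> (fst z) (snd z)) has_derivative
      (\<lambda>w. fd (\<lambda>y. T \<beta> y \<nu>) x (fst w) + T \<beta> x (snd w))) (at (x, \<nu>))"
    using has_derivative_linear_family_compose[where p=fst and u=snd and a="(x, \<nu>)" and A=UNIV and L="T \<beta>", OF open_S _ T_linear _
        has_derivative_fst[OF has_derivative_ident] has_derivative_snd[OF has_derivative_ident]] T_diff x by simp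
  have "((\<lambda>z. G (fst z) (T \<beta> (fst z) (snd z)) (snd z)) has_derivative
     (\<lambda>w. G x (fd (\<lambda>y. T \<beta> y \<nu>) x (fst w) + T \<beta> x (snd w) + Gam x (fst w) (T \<beta> x \<nu>)) \<nu>
    + G x (T \<beta> x \<nu>) (snd w + Gam x (fst w) \<nu>))) (at (x, \<nu>))"
    using metric_has_derivative[where p=fst and v=snd and a="(x, \<nu>)" and A=UNIV, OF _
        has_derivative_fst[OF has_derivative_ident] 1 has_derivative_snd[OF has_derivative_ident]] x by simp
  from has_derivative_mult_right[OF this, of "- 2"] show ?thesis
    by (simp add: len_deriv_def[abs_def])
qed

text \<open>Exchanging the covariant derivatives along X and \<nu> in \<nabla>_X \<nabla>_\<nu> X
  produces the curvature term and \<nabla>_\<nu> (\<nabla>_X X), which \<open>crit\<close> removes.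
  By \<open>TV\<close> the term with the adjoint of A in the general formula is 0 here.\<close>

theorem second_variation:
  assumes x: "x \<in> S" and \<nu>: "vert x \<nu>" and TV: "vert x (T \<beta> x \<nu>)"
    and crit: "\<And>\<beta>'. G x (T \<beta>' x \<nu>) \<nu> = 0"
  shows "fd (len_deriv \<beta>) (x, \<nu>) (dual_vf \<beta> (x, \<nu>))
    = 2 * G x (curvature G x \<nu> (lift x \<beta>) (lift x \<beta>)) \<nu> + 6 * G x (T \<beta> x \<nu>) (T \<beta> x \<nu>)"
proof -
  let ?X = "\<lambda>x. lift x \<beta>"
  let ?T = "T \<beta> x" and ?a = "lift x \<beta>"
  \<comment> \<open>The acceleration field \<nabla>_X X of the basic field.\<close>
  define Y where "Y y = T \<beta> y (?X y)" for y
  have Xw: "(?X has_derivative fd ?X x) (at x)" by (rule fd_works[OF lift_diff[OF x]])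
  have dT: "fd (\<lambda>y. T \<beta> y c) x w = fd (\<lambda>y. fd ?X y c) x w + fd (\<lambda>y. Gam y c ?a) x w + Gam x c (fd ?X x w)" for c w
  proof -
    have "((\<lambda>y. fd ?X y c) has_derivative fd (\<lambda>y. fd ?X y c) x) (at x)"
      by (rule smooth_on_works[OF smooth_on_fd_const[OF lift_smooth] x])
    moreover have "((\<lambda>y. Gam y c (?X y)) has_derivative (\<lambda>w. fd (\<lambda>y. Gam y c ?a) x w + Gam x c (fd ?X x w))) (at x)"
      using Gam_bil Gam_diff[OF x] by (intro has_derivative_linear_family[OF open_S x _ _ Xw]) (auto simp: bilinear_def)
    ultimately have "((\<lambda>y. T \<beta> y c) has_derivative
      (\<lambda>w. fd (\<lambda>y. fd ?X y c) x w + (fd (\<lambda>y. Gam y c ?a) x w + Gam x c (fd ?X x w)))) (at x)"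
      unfolding T_alt by (rule has_derivative_add)
    from fd_eq[OF this] show ?thesis by simp
  qed
  have dY: "fd Y x w = fd (\<lambda>y. T \<beta> y ?a) x w + ?T (fd ?X x w)" for w
  proof -
    have "(Y has_derivative (\<lambda>w. fd (\<lambda>y. T \<beta> y ?a) x w + ?T (fd ?X x w))) (at x)"
      unfolding Y_def by (rule has_derivative_linear_family[OF open_S x T_linear T_diff[OF x] Xw])
    from fd_eq[OF this] show ?thesis by simp
  qed
  have Ydiff: "Y differentiable (at x)"
    unfolding Y_def using T_smooth[OF lift_smooth] smooth_on_differentiable x by blast
  \<comment> \<open>\<open>Y\<close> is horizontal by \<open>accel_hor\<close>, so by tensoriality
    it may be replaced by the basic field with the same value at \<open>x\<close>; for that field
    the claim is an instance of \<open>crit\<close>.\<close>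
  have covY: "G x (cov x Y \<nu>) \<nu> = 0"
  proof -
    have "G x (cov x Y \<nu>) \<nu> = - G x (Y x) (cov x (\<lambda>y. Q y \<nu>) \<nu>)"
      by (rule cov_horizontal_field[OF open_S x subset_refl _ Ydiff \<nu>]) (simp add: Y_def accel_hor)
    also have "Y x = lift x (fd \<pi> x (Y x))" by (rule hor_eq_lift[OF x]) (simp add: Y_def accel_hor x)
    also have "- G x (lift x (fd \<pi> x (Y x))) (cov x (\<lambda>y. Q y \<nu>) \<nu>) = G x (T (fd \<pi> x (Y x)) x \<nu>) \<nu>"
      unfolding T_def by (rule cov_horizontal_field[OF open_S x subset_refl lift_hor lift_diff[OF x] \<nu>, symmetric])
    finally show ?thesis using crit by simp
  qed
  define n where "n = dual_rhs \<beta> x \<nu>"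
  have n: "n = fd ?X x \<nu> - 2 *\<^sub>R ?T \<nu>" by (simp add: n_def dual_rhs_def Q_id x TV)
  note Tl = linear_diff[OF T_linear[OF x]] linear_cmul[OF T_linear[OF x]]
  \<comment> \<open>The covariant derivative of the dual field. Since \<open>?T \<nu>\<close> is
    vertical, subtracting twice its vertical part just reverses its sign.\<close>
  have 1: "n + Gam x ?a \<nu> = - ?T \<nu>"
    using Gam_sym[OF x, of ?a \<nu>] by (simp add: n T_alt scaleR_2)
  have sym: "fd (\<lambda>y. fd ?X y \<nu>) x ?a = fd (\<lambda>y. fd ?X y ?a) x \<nu>"
    by (rule fd_symmetric[OF open_S lift_smooth x])
  have 2: "fd (\<lambda>y. T \<beta> y \<nu>) x ?a + ?T n + Gam x ?a (?T \<nu>)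
     = cov x Y \<nu> - curvature G x \<nu> ?a ?a - 2 *\<^sub>R ?T (?T \<nu>)"
  proof -
    have "fd (\<lambda>y. T \<beta> y \<nu>) x ?a = fd (\<lambda>y. fd ?X y ?a) x \<nu> + fd (\<lambda>y. Gam y \<nu> ?a) x ?a + Gam x \<nu> (fd ?X x ?a)"
      using dT[of \<nu> ?a] sym by simp
    moreover have "cov x Y \<nu> = fd (\<lambda>y. fd ?X y ?a) x \<nu> + fd (\<lambda>y. Gam y ?a ?a) x \<nu> + Gam x ?a (fd ?X x \<nu>)
        + ?T (fd ?X x \<nu>) + Gam x \<nu> (fd ?X x ?a) + Gam x \<nu> (Gam x ?a ?a)"
      by (simp add: cov_def dY dT) (simp add: Y_def T_alt Gam_lin x)
    moreover have "Gam x ?a (?T \<nu>) = Gam x ?a (fd ?X x \<nu>) + Gam x ?a (Gam x \<nu> ?a)"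
      by (simp add: T_alt Gam_lin x)
    moreover have "?T n = ?T (fd ?X x \<nu>) - 2 *\<^sub>R ?T (?T \<nu>)" by (simp add: n Tl)
    ultimately show ?thesis by (simp add: curvature_def)
  qed
  have "fd (len_deriv \<beta>) (x, \<nu>) (dual_vf \<beta> (x, \<nu>)) = - 2 * (
      G x (fd (\<lambda>y. T \<beta> y \<nu>) x ?a + ?T n + Gam x ?a (?T \<nu>)) \<nu> + G x (?T \<nu>) (n + Gam x ?a \<nu>))"
    by (simp add: fd_eq[OF len_deriv_has_derivative[OF x]] dual_vf_def n_def)
  also have "\<dots> = 2 * G x (curvature G x \<nu> ?a ?a) \<nu> + 4 * G x (?T (?T \<nu>)) \<nu> + 2 * G x (?T \<nu>) (?T \<nu>)"
    unfolding 1 2 by (simp add: G_lin x covY)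
  \<comment> \<open>Both arguments are vertical, so self-adjointness applies and turns 4 + 2 into
    the coefficient 6.\<close>
  also have "G x (?T (?T \<nu>)) \<nu> = G x (?T \<nu>) (?T \<nu>)" by (rule T_symmetric[OF x TV \<nu>])
  finally show ?thesis by simp
qed

text \<open>Up to sign the form pairs the adjoint of A applied to \<nu> with a lift. It is skew by
  \<open>T_skew\<close>, hence degenerate in odd codimension. For a kernel vector \<beta> the
  horizontal part of \<open>T \<beta> x \<nu>\<close> is orthogonal to all lifts, itself
  included.\<close>

lemma kernel_direction:
  assumes x: "x \<in> S" and \<nu>: "vert x \<nu>" and odd: "odd DIM('h)"
  shows "\<exists>\<beta>. \<beta> \<noteq> 0 \<and> vert x (T \<beta> x \<nu>)"
proof -
  have bil: "bilinear (\<lambda>\<beta> \<beta>'. G x (T \<beta> x \<nu>) (lift x \<beta>'))"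
    by (simp add: bilinear_def linear_iff G_lin x lift_simps linear_add[OF T_linear2[OF x]] linear_cmul[OF T_linear2[OF x]])
  obtain \<beta> where \<beta>: "\<beta> \<noteq> 0" "\<And>\<beta>'. G x (T \<beta> x \<nu>) (lift x \<beta>') = 0"
    using odd_skew_kernel[OF bil T_skew[OF x \<nu>] odd] by blast
  let ?v = "T \<beta> x \<nu>" and ?l = "lift x (fd \<pi> x (T \<beta> x \<nu>))"
  have "G x ?l (Q x ?v) = 0" using lift_hor[OF x] Q_vert[OF x] by (simp add: hor_def)
  then have "G x ?l ?l = 0" using \<beta>(2)[of "fd \<pi> x ?v"] G_sym[OF x, of ?l ?v] by (simp add: Q_def G_lin x)
  then have "?l = 0" by (rule G_eq0[OF x])
  then have "fd \<pi> x ?v = 0" using pi_lift[OF x, of "fd \<pi> x ?v"] by (simp add: pi_simps x)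
  then show ?thesis using \<beta>(1) by blast
qed

end

section \<open>Charts\<close>

lemma chart_open: "is_chart c \<Longrightarrow> open (cdom c)" "is_chart c \<Longrightarrow> open (cimg c)"
  by (simp_all add: is_chart_def)

lemma chart_inv [simp]:
  assumes "is_chart c"
  shows "p \<in> cdom c \<Longrightarrow> cinv c (cmap c p) = p" "x \<in> cimg c \<Longrightarrow> cmap c (cinv c x) = x"
    "p \<in> cdom c \<Longrightarrow> cmap c p \<in> cimg c" "x \<in> cimg c \<Longrightarrow> cinv c x \<in> cdom c"
  using assms unfolding is_chart_def homeomorphism_def by auto

lemma chart_continuous:
  assumes "is_chart c" shows "continuous_on (cdom c) (cmap c)" "continuous_on (cimg c) (cinv c)"
  using assms unfolding is_chart_def homeomorphism_def by auto

lemma chart_image: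
  assumes "is_chart c" shows "cmap c ` (cdom c \<inter> U) = {x \<in> cimg c. cinv c x \<in> U}"
proof -
  have "x \<in> cmap c ` (cdom c \<inter> U)" if "x \<in> cimg c" "cinv c x \<in> U" for x
    by (rule image_eqI[of _ _ "cinv c x"]) (use assms that in auto)
  then show ?thesis using assms by auto
qed

lemma chart_image_open:
  assumes "is_chart c" "open U" shows "open (cmap c ` (cdom c \<inter> U))"
proof -
  have "open (cimg c \<inter> cinv c -` U)"
    using chart_continuous(2)[OF assms(1)] chart_open(2)[OF assms(1)] assms(2)
    by (rule continuous_open_preimage)
  moreover have "cimg c \<inter> cinv c -` U = cmap c ` (cdom c \<inter> U)" unfolding chart_image[OF assms(1)] by blast
  ultimately show ?thesis by simp
qed

lemma chart_image_open_subset: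
  assumes "is_chart c" "open U" "U \<subseteq> cdom c" shows "open (cmap c ` U)"
  using chart_image_open[OF assms(1,2)] assms(3) by (simp add: Int_absorb1)

lemma smoothly_compatible_sym: "smoothly_compatible c d \<Longrightarrow> smoothly_compatible d c"
  by (simp add: smoothly_compatible_def Int_commute)

definition transition :: "('m, 'e::euclidean_space) chart \<Rightarrow> ('m, 'f::euclidean_space) chart \<Rightarrow> 'm \<Rightarrow> 'e \<Rightarrow> 'f" where
  "transition c d p = fd (cmap d \<circ> cinv c) (cmap c p)"

text \<open>The model spaces may differ, so the same facts serve two charts of the atlas as well as
  an atlas chart and a foliated one.\<close>

locale chart_pair =
  fixes c :: "('m::topological_space, 'e::euclidean_space) chart" and d :: "('m, 'f::euclidean_space) chart"
  assumes c: "is_chart c" and d: "is_chart d" and cd: "smoothly_compatible c d"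
begin

definition overlap where "overlap = cmap c ` (cdom c \<inter> cdom d)"

lemma open_overlap: "open overlap" unfolding overlap_def by (rule chart_image_open[OF c chart_open(1)[OF d]])
lemma mem_overlap: "p \<in> cdom c \<Longrightarrow> p \<in> cdom d \<Longrightarrow> cmap c p \<in> overlap" by (auto simp: overlap_def)
lemma smooth_tr: "smooth_on overlap (cmap d \<circ> cinv c)" using cd by (simp add: smoothly_compatible_def overlap_def)

lemma overlap_D: assumes "y \<in> overlap" shows "cinv c y \<in> cdom c" "cinv c y \<in> cdom d" "cmap c (cinv c y) = y"
  using assms c by (auto simp: overlap_def)

lemma tr_has_derivative:
  "p \<in> cdom c \<Longrightarrow> p \<in> cdom d \<Longrightarrow> (cmap d \<circ> cinv c has_derivative transition c d p) (at (cmap c p))"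
  unfolding transition_def by (rule smooth_on_works[OF smooth_tr mem_overlap])

lemma transition_linear: "p \<in> cdom c \<Longrightarrow> p \<in> cdom d \<Longrightarrow> linear (transition c d p)"
  using tr_has_derivative has_derivative_linear by blast

lemma chain:
  assumes p: "p \<in> cdom c" "p \<in> cdom d" and f: "(f \<circ> cinv d has_derivative F) (at (cmap d p))"
  shows "(f \<circ> cinv c has_derivative (\<lambda>u. F (transition c d p u))) (at (cmap c p))"
proof -
  have "((\<lambda>y. (f \<circ> cinv d) ((cmap d \<circ> cinv c) y)) has_derivative (\<lambda>u. F (transition c d p u))) (at (cmap c p))"
    by (rule has_derivative_compose[OF tr_has_derivative[OF p]]) (use p c f in \<open>simp add: o_def\<close>)
  then show ?thesis
    by (rule has_derivative_transform_within_open[OF _ open_overlap mem_overlap[OF p]]) (use overlap_D d in simp)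
qed

lemma chain_fd:
  assumes p: "p \<in> cdom c" "p \<in> cdom d" and f: "(f \<circ> cinv d) differentiable (at (cmap d p))"
  shows "fd (f \<circ> cinv c) (cmap c p) u = fd (f \<circ> cinv d) (cmap d p) (transition c d p u)"
  using fd_eq[OF chain[OF p fd_works[OF f]]] by simp

lemma transition_inverse:
  assumes p: "p \<in> cdom c" "p \<in> cdom d" shows "transition d c p (transition c d p u) = u"
proof -
  interpret dc: chart_pair d c by (rule chart_pair.intro[OF d c smoothly_compatible_sym[OF cd]])
  have 1: "(cmap c \<circ> cinv c has_derivative (\<lambda>u. transition d c p (transition c d p u))) (at (cmap c p))"
    by (rule chain[OF p dc.tr_has_derivative[OF p(2,1)]])
  have "((\<lambda>x. x) has_derivative (\<lambda>u. transition d c p (transition c d p u))) (at (cmap c p))"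
    by (rule has_derivative_transform_within_open[OF 1 open_overlap mem_overlap[OF p]]) (use overlap_D in simp)
  from fd_eq[OF this] fd_eq[OF has_derivative_ident[of "at (cmap c p)"]] show ?thesis by metis
qed

end

section \<open>Tangent vectors and their components in charts\<close>

locale manifold =
  fixes A :: "('m::topological_space, 'e::euclidean_space) chart set"
  assumes atlas: "smooth_atlas A"
begin

lemma is_chart: "c \<in> A \<Longrightarrow> is_chart c" using atlas by (simp add: smooth_atlas_def)

lemma chart_at: "chart_at A p \<in> A" "p \<in> cdom (chart_at A p)"
proof -
  have "p \<in> (\<Union>c\<in>A. cdom c)" using atlas by (simp add: smooth_atlas_def)
  then have "\<exists>c. c \<in> A \<and> p \<in> cdom c" by blast
  from someI_ex[OF this] show "chart_at A p \<in> A" "p \<in> cdom (chart_at A p)" by (auto simp: chart_at_def)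
qed

lemma pair: "c \<in> A \<Longrightarrow> d \<in> A \<Longrightarrow> chart_pair c d"
  using atlas by (simp add: smooth_atlas_def chart_pair_def)

abbreviation comp :: "('m, 'e) chart \<Rightarrow> 'm \<Rightarrow> 'e \<Rightarrow> 'e" where "comp c p \<equiv> tdiff A (cmap c) p"
text \<open>The inverse of \<open>comp c p\<close>, indexed by the point instead of its coordinates
  so that the two cancel directly.\<close>

definition vec :: "('m, 'e) chart \<Rightarrow> 'm \<Rightarrow> 'e \<Rightarrow> 'e" where "vec c p = tvec A c (cmap c p)"

lemma comp_trd: "comp c p = transition (chart_at A p) c p" by (simp add: tdiff_def transition_def)

lemma vec_trd: "c \<in> A \<Longrightarrow> p \<in> cdom c \<Longrightarrow> vec c p = transition c (chart_at A p) p"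
  using is_chart[of c] by (simp add: vec_def tvec_def transition_def)

lemma comp_vec [simp]: "c \<in> A \<Longrightarrow> p \<in> cdom c \<Longrightarrow> comp c p (vec c p u) = u"
  using chart_pair.transition_inverse[OF pair[OF _ chart_at(1)]] chart_at(2) by (simp add: comp_trd vec_trd)

lemma vec_comp [simp]: "c \<in> A \<Longrightarrow> p \<in> cdom c \<Longrightarrow> vec c p (comp c p u) = u"
  using chart_pair.transition_inverse[OF pair[OF chart_at(1)]] chart_at(2) by (simp add: comp_trd vec_trd)

lemma comp_linear: "c \<in> A \<Longrightarrow> p \<in> cdom c \<Longrightarrow> linear (comp c p)"
  using chart_pair.transition_linear[OF pair[OF chart_at(1)]] chart_at(2) by (simp add: comp_trd)

lemma vec_linear: "c \<in> A \<Longrightarrow> p \<in> cdom c \<Longrightarrow> linear (vec c p)"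
  using chart_pair.transition_linear[OF pair[OF _ chart_at(1)]] chart_at(2) by (simp add: vec_trd)

lemmas comp_simps = linear_add[OF comp_linear] linear_diff[OF comp_linear] linear_cmul[OF comp_linear]
  linear_0[OF comp_linear] linear_neg[OF comp_linear]
lemmas vec_simps = linear_add[OF vec_linear] linear_diff[OF vec_linear] linear_cmul[OF vec_linear]
  linear_0[OF vec_linear] linear_neg[OF vec_linear]

lemma tdiff_chart:
  assumes "c \<in> A" "p \<in> cdom c" "(f \<circ> cinv c) differentiable (at (cmap c p))"
  shows "tdiff A f p u = fd (f \<circ> cinv c) (cmap c p) (comp c p u)"
  unfolding comp_trd unfolding tdiff_def
  by (rule chart_pair.chain_fd[OF pair[OF chart_at(1) assms(1)] chart_at(2) assms(2,3)])

lemma comp_change: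
  assumes "c \<in> A" "d \<in> A" "p \<in> cdom c" "p \<in> cdom d"
  shows "comp d p u = transition c d p (comp c p u)"
  using tdiff_chart[OF assms(1,3), of "cmap d"] chart_pair.tr_has_derivative[OF pair[OF assms(1,2)] assms(3,4)]
  by (auto simp: transition_def intro: differentiableI)

lemma comp_chart_at: "comp (chart_at A p) p u = u"
  using chart_pair.transition_inverse[OF pair[OF chart_at(1) chart_at(1)] chart_at(2) chart_at(2), of p]
    comp_vec[OF chart_at(1) chart_at(2)] comp_change[OF chart_at(1) chart_at(1) chart_at(2) chart_at(2), of p]
  by (metis vec_comp[OF chart_at] comp_trd vec_trd[OF chart_at])

lemma vec_chart_at: "vec (chart_at A p) p u = u"
  using vec_comp[OF chart_at, of p u] comp_chart_at by simp

end

section \<open>Riemannian manifolds\<close>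

locale riem_manifold = manifold A
  for A :: "('m::topological_space, 'e::euclidean_space) chart set" +
  fixes g :: "'m \<Rightarrow> 'e \<Rightarrow> 'e \<Rightarrow> real"
  assumes riem: "riemannian_metric A g"
begin

abbreviation GG :: "('m, 'e) chart \<Rightarrow> 'e \<Rightarrow> 'e \<Rightarrow> 'e \<Rightarrow> real" where "GG \<equiv> metric_in_chart A g"

lemma g_ip: "inner_product (g p)" using riem by (simp add: riemannian_metric_def)
lemma g_bil: "bilinear (g p)" using g_ip by (simp add: inner_product_def)
lemma g_pos: "u \<noteq> 0 \<Longrightarrow> g p u u > 0" using g_ip[of p] unfolding inner_product_def by blast
lemmas g_lin = bilinear_ladd[OF g_bil] bilinear_radd[OF g_bil] bilinear_lsub[OF g_bil] bilinear_rsub[OF g_bil]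
  bilinear_lmul[OF g_bil] bilinear_rmul[OF g_bil] bilinear_lneg[OF g_bil] bilinear_rneg[OF g_bil]
  bilinear_lzero[OF g_bil] bilinear_rzero[OF g_bil]

lemma patch: "c \<in> A \<Longrightarrow> metric_patch (cimg c) (GG c)"
  using riem chart_open(2)[OF is_chart] by (simp add: riemannian_metric_def metric_patch_def)

lemma GG_vec: "c \<in> A \<Longrightarrow> p \<in> cdom c \<Longrightarrow> GG c (cmap c p) u v = g p (vec c p u) (vec c p v)"
  using is_chart[of c] by (simp add: metric_in_chart_def vec_def)

lemma GG_comp: "c \<in> A \<Longrightarrow> p \<in> cdom c \<Longrightarrow> GG c (cmap c p) (comp c p u) (comp c p v) = g p u v"
  by (simp add: GG_vec)

lemma GG_chart_at: "GG (chart_at A p) (cmap (chart_at A p) p) u v = g p u v"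
  by (simp add: GG_vec chart_at vec_chart_at)

lemma GG_change:
  assumes "c \<in> A" "d \<in> A" "p \<in> cdom c" "p \<in> cdom d"
  shows "GG d (cmap d p) (transition c d p u) (transition c d p v) = GG c (cmap c p) u v"
  using GG_comp[OF assms(2,4), of "vec c p u" "vec c p v"] GG_vec[OF assms(1,3), of u v]
  by (simp add: comp_change[OF assms] assms)

text \<open>The classical transformation law. It is derived from the uniqueness of the solution of
  the Koszul equations in the chart \<open>c\<close>.\<close>

lemma christoffel_change:
  assumes "c \<in> A" "d \<in> A" and p: "p \<in> cdom c" "p \<in> cdom d"
  shows "transition c d p (christoffel (GG c) (cmap c p) u v)
    = fd (\<lambda>y. fd (cmap d \<circ> cinv c) y v) (cmap c p) u
      + christoffel (GG d) (cmap d p) (transition c d p u) (transition c d p v)"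
proof -
  interpret cd: chart_pair c d by (rule pair[OF assms(1,2)])
  interpret dc: chart_pair d c by (rule pair[OF assms(2,1)])
  interpret C: metric_patch "cimg c" "GG c" by (rule patch[OF assms(1)])
  interpret D: metric_patch "cimg d" "GG d" by (rule patch[OF assms(2)])
  define \<tau> where "\<tau> = cmap d \<circ> cinv c"
  let ?x = "cmap c p" and ?y = "cmap d p"
  have x: "?x \<in> cimg c" and y: "?y \<in> cimg d" using p is_chart assms by auto
  have \<tau>x: "\<tau> ?x = ?y" using p cd.c by (simp add: \<tau>_def)
  have transition: "transition c d p = fd \<tau> ?x" by (simp add: transition_def \<tau>_def)
  have \<tau>s: "smooth_on cd.overlap \<tau>" using cd.smooth_tr by (simp add: \<tau>_def)
  note xO = cd.mem_overlap[OF p]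
  \<comment> \<open>\<open>e w a\<close> is the covariant derivative, computed in the chart
    \<open>d\<close>, of the a-th coordinate field of \<open>c\<close> along \<open>w\<close>. It is
    symmetric, so the Koszul combination of metric derivatives collapses to twice the product with
    \<open>e u v\<close>.\<close>
  define e where "e w a = fd (\<lambda>y. fd \<tau> y a) ?x w + D.Gam ?y (fd \<tau> ?x w) (fd \<tau> ?x a)" for w a
  have esym: "e w a = e a w" for w a
    using fd_symmetric[OF cd.open_overlap \<tau>s xO, of a w] D.Gam_sym[OF y] by (simp add: e_def)
  have eq: "GG c z a b = GG d (\<tau> z) (fd \<tau> z a) (fd \<tau> z b)" if "z \<in> cd.overlap" for z a b
    using GG_change[OF assms(1,2), of "cinv c z" a b] cd.overlap_D[OF that] by (simp add: transition_def \<tau>_def)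
  have dG: "C.dG ?x w a b = GG d ?y (e w a) (fd \<tau> ?x b) + GG d ?y (fd \<tau> ?x a) (e w b)" for w a b
  proof -
    have w: "((\<lambda>y. fd \<tau> y a) has_derivative fd (\<lambda>y. fd \<tau> y a) ?x) (at ?x)" for a
      by (rule smooth_on_works[OF smooth_on_fd_const[OF \<tau>s] xO])
    have "C.dG ?x w a b = fd (\<lambda>z. GG d (\<tau> z) (fd \<tau> z a) (fd \<tau> z b)) ?x w"
      unfolding C.dG_def by (subst fd_cong[OF cd.open_overlap xO, of "\<lambda>z. GG c z a b"]) (auto simp: eq)
    also have "\<dots> = GG d ?y (e w a) (fd \<tau> ?x b) + GG d ?y (fd \<tau> ?x a) (e w b)"
      using fd_eq[OF D.metric_has_derivative[where p=\<tau> and A=UNIV, OF _ smooth_on_works[OF \<tau>s xO] w[of a] w[of b]]] y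
      by (simp add: \<tau>x e_def)
    finally show ?thesis .
  qed
  let ?w = "transition d c p (e u v)"
  have \<tau>w: "fd \<tau> ?x ?w = e u v" using dc.transition_inverse[OF p(2,1)] by (simp add: transition)
  have "C.Gam ?x u v = ?w"
  proof (rule C.Gam_unique[OF x])
    fix z
    have "GG c ?x ?w z = GG d ?y (e u v) (fd \<tau> ?x z)" using eq[OF xO] by (simp add: \<tau>w \<tau>x)
    then show "2 * GG c ?x ?w z = C.dG ?x u v z + C.dG ?x v u z - C.dG ?x z u v"
      unfolding dG using esym[of u v] esym[of u z] esym[of v z] D.G_sym[OF y] by simp
  qed
  then show ?thesis using \<tau>w by (simp add: transition e_def \<tau>_def)
qed

text \<open>\<open>nabla\<close> is defined in one selected chart. The second derivatives of the
  coordinate change that arise from differentiating the components cancel against those in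
  \<open>christoffel_change\<close>.\<close>

lemma nabla_chart:
  assumes c: "c \<in> A" and p: "p \<in> cdom c" and X: "field_in_chart A c X differentiable (at (cmap c p))"
  shows "nabla A g p u X = vec c p (metric_patch.cov (GG c) (cmap c p) (field_in_chart A c X) (comp c p u))"
proof -
  define d where "d = chart_at A p"
  have d: "d \<in> A" "p \<in> cdom d" using chart_at by (auto simp: d_def)
  interpret cd: chart_pair c d by (rule pair[OF c d(1)])
  interpret dc: chart_pair d c by (rule pair[OF d(1) c])
  interpret C: metric_patch "cimg c" "GG c" by (rule patch[OF c])
  define \<tau> where "\<tau> = cmap d \<circ> cinv c"
  define \<sigma> where "\<sigma> = cmap c \<circ> cinv d"
  define Xc where "Xc = field_in_chart A c X"
  let ?x = "cmap c p" and ?y = "cmap d p"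
  have \<sigma>y: "\<sigma> ?y = ?x" using d is_chart by (simp add: \<sigma>_def)
  have \<tau>s: "smooth_on cd.overlap \<tau>" using cd.smooth_tr by (simp add: \<tau>_def)
  note xO = cd.mem_overlap[OF p d(2)] and yO = dc.mem_overlap[OF d(2) p]
  have Xcx: "Xc ?x = comp c p (X p)" using p c is_chart by (simp add: Xc_def field_in_chart_def)
  have eq: "field_in_chart A d X z = fd \<tau> (\<sigma> z) (Xc (\<sigma> z))" if "z \<in> dc.overlap" for z
    using comp_change[OF c d(1), of "cinv d z" "X (cinv d z)"] dc.overlap_D[OF that] is_chart[OF c]
    by (simp add: field_in_chart_def transition_def \<tau>_def Xc_def \<sigma>_def)
  have sd: "(\<sigma> has_derivative transition d c p) (at ?y)"
    unfolding \<sigma>_def by (rule dc.tr_has_derivative[OF d(2) p])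
  have "((\<lambda>y. fd \<tau> y (Xc y)) has_derivative
      (\<lambda>w. fd (\<lambda>y. fd \<tau> y (Xc ?x)) ?x w + fd \<tau> ?x (fd Xc ?x w))) (at ?x)"
    using smooth_on_differentiable[OF smooth_on_fd_const[OF \<tau>s] xO]
    by (intro has_derivative_linear_family[OF cd.open_overlap xO smooth_on_fd_linear[OF \<tau>s] _ fd_works])
      (use X in \<open>auto simp: Xc_def\<close>)
  then have "((\<lambda>z. fd \<tau> (\<sigma> z) (Xc (\<sigma> z))) has_derivative
      (\<lambda>w. fd (\<lambda>y. fd \<tau> y (Xc ?x)) ?x (transition d c p w) + fd \<tau> ?x (fd Xc ?x (transition d c p w)))) (at ?y)"
    by (intro has_derivative_compose[OF sd]) (simp add: \<sigma>y)
  then have "(field_in_chart A d X has_derivative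
      (\<lambda>w. fd (\<lambda>y. fd \<tau> y (Xc ?x)) ?x (transition d c p w) + fd \<tau> ?x (fd Xc ?x (transition d c p w)))) (at ?y)"
    by (rule has_derivative_transform_within_open[OF _ dc.open_overlap yO]) (use eq in simp)
  from fd_eq[OF this] have fdX: "fd (field_in_chart A d X) ?y u
     = fd (\<lambda>y. fd \<tau> y (Xc ?x)) ?x (comp c p u) + fd \<tau> ?x (fd Xc ?x (comp c p u))"
    by (simp add: comp_trd d_def)
  have vec: "vec c p = fd \<tau> ?x" by (simp add: vec_trd[OF c p] transition_def \<tau>_def d_def)
  have "transition c d p (comp c p u) = u" "transition c d p (Xc ?x) = X p"
    using vec_comp[OF c p] vec_trd[OF c p] by (simp_all add: Xcx d_def)
  then have "fd \<tau> ?x (C.Gam ?x (comp c p u) (Xc ?x)) = fd (\<lambda>y. fd \<tau> y (Xc ?x)) ?x (comp c p u)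
      + christoffel (GG d) ?y u (X p)"
    using christoffel_change[OF c d(1) p d(2), of "comp c p u" "Xc ?x"] by (simp add: transition_def \<tau>_def)
  then have "nabla A g p u X = fd \<tau> ?x (fd Xc ?x (comp c p u)) + fd \<tau> ?x (C.Gam ?x (comp c p u) (Xc ?x))"
    using fdX by (simp add: nabla_def Let_def d_def)
  also have "\<dots> = vec c p (C.cov ?x Xc (comp c p u))"
    using linear_add[OF vec_linear[OF c p]] by (simp add: vec C.cov_def)
  finally show ?thesis by (simp add: Xc_def)
qed

lemma velocity_chart:
  assumes c: "c \<in> A" and p: "\<gamma> t \<in> cdom c" and "isCont \<gamma> t"
    and x: "((cmap c \<circ> \<gamma>) has_vector_derivative x') (at t)"
  shows "velocity A \<gamma> t = vec c (\<gamma> t) x'"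
    "((cmap (chart_at A (\<gamma> t)) \<circ> \<gamma>) has_vector_derivative vec c (\<gamma> t) x') (at t)"
proof -
  define d where "d = chart_at A (\<gamma> t)"
  have d: "d \<in> A" "\<gamma> t \<in> cdom d" using chart_at by (auto simp: d_def)
  interpret cd: chart_pair c d by (rule pair[OF c d(1)])
  have "((\<lambda>s. (cmap d \<circ> cinv c) ((cmap c \<circ> \<gamma>) s)) has_derivative (\<lambda>h. transition c d (\<gamma> t) (h *\<^sub>R x'))) (at t)"
    using cd.tr_has_derivative[OF p d(2)]
    by (intro has_derivative_compose[OF x[unfolded has_vector_derivative_def]]) (simp add: o_def)
  then have "((\<lambda>s. (cmap d \<circ> cinv c) ((cmap c \<circ> \<gamma>) s)) has_derivative (\<lambda>h. h *\<^sub>R transition c d (\<gamma> t) x')) (at t)"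
    by (simp add: linear_cmul[OF cd.transition_linear[OF p d(2)]])
  moreover obtain W where W: "open W" "t \<in> W" "\<And>s. s \<in> W \<Longrightarrow> \<gamma> s \<in> cdom c"
    using assms(3) p chart_open(1)[OF cd.c] unfolding continuous_at_open by metis
  ultimately have "((cmap d \<circ> \<gamma>) has_derivative (\<lambda>h. h *\<^sub>R transition c d (\<gamma> t) x')) (at t)"
    by (elim has_derivative_transform_within_open) (use cd.c in auto)
  then show 1: "((cmap (chart_at A (\<gamma> t)) \<circ> \<gamma>) has_vector_derivative vec c (\<gamma> t) x') (at t)"
    by (simp add: has_vector_derivative_def vec_trd[OF c p] d_def)
  show "velocity A \<gamma> t = vec c (\<gamma> t) x'"
    unfolding velocity_def by (rule vector_derivative_at[OF 1])
qed

text \<open>The analogue of \<open>nabla_chart\<close> along a curve: any chart around the point may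
  be used to verify the covariant derivative.\<close>

lemma covariant_derivative_chart:
  assumes c: "c \<in> A" and p: "\<gamma> t \<in> cdom c" and cont: "isCont \<gamma> t" and t: "t \<in> {0..1}"
    and x: "((cmap c \<circ> \<gamma>) has_vector_derivative x') (at t)"
    and \<xi>: "((\<lambda>s. comp c (\<gamma> s) (\<xi> s)) has_vector_derivative \<xi>') (at t within {0..1})"
  shows "has_covariant_derivative A g \<gamma> \<xi>
    (vec c (\<gamma> t) (\<xi>' + christoffel (GG c) (cmap c (\<gamma> t)) x' (comp c (\<gamma> t) (\<xi> t)))) t"
proof -
  define d where "d = chart_at A (\<gamma> t)"
  have d: "d \<in> A" "\<gamma> t \<in> cdom d" using chart_at by (auto simp: d_def)
  interpret cd: chart_pair c d by (rule pair[OF c d(1)])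
  define \<tau> where "\<tau> = cmap d \<circ> cinv c"
  define \<xi>c where "\<xi>c s = comp c (\<gamma> s) (\<xi> s)" for s
  let ?x = "cmap c (\<gamma> t)" and ?y = "cmap d (\<gamma> t)"
  have \<tau>s: "smooth_on cd.overlap \<tau>" using cd.smooth_tr by (simp add: \<tau>_def)
  note xO = cd.mem_overlap[OF p d(2)]
  have "((\<lambda>s. fd \<tau> ((cmap c \<circ> \<gamma>) s) (\<xi>c s)) has_derivative
      (\<lambda>h. fd (\<lambda>y. fd \<tau> y (\<xi>c t)) ?x (h *\<^sub>R x') + fd \<tau> ?x (h *\<^sub>R \<xi>'))) (at t within {0..1})"
    using has_derivative_linear_family_compose[where p="cmap c \<circ> \<gamma>" and u=\<xi>c and a=t and L="fd \<tau>",
        OF cd.open_overlap _ smooth_on_fd_linear[OF \<tau>s] _ has_derivative_at_withinI[OF x[unfolded has_vector_derivative_def]]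
         \<xi>[unfolded has_vector_derivative_def, folded \<xi>c_def]] 
      smooth_on_differentiable[OF smooth_on_fd_const[OF \<tau>s] xO] xO by simp
  then have der: "((\<lambda>s. fd \<tau> ((cmap c \<circ> \<gamma>) s) (\<xi>c s)) has_vector_derivative
      (fd (\<lambda>y. fd \<tau> y (\<xi>c t)) ?x x' + fd \<tau> ?x \<xi>')) (at t within {0..1})"
    using linear_cmul[OF smooth_on_fd_linear[OF \<tau>s xO]]
      linear_cmul[OF smooth_on_fd_linear[OF smooth_on_fd_const[OF \<tau>s] xO]]
    by (simp add: has_vector_derivative_def scaleR_add_right)
  obtain W where W: "open W" "t \<in> W" "\<And>s. s \<in> W \<Longrightarrow> \<gamma> s \<in> cdom c \<inter> cdom d"
    using cont p d(2) chart_open(1)[OF cd.c] chart_open(1)[OF cd.d] unfolding continuous_at_open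
    by (metis Int_iff open_Int)
  have der2: "((\<lambda>s. comp d (\<gamma> s) (\<xi> s)) has_vector_derivative
      (fd (\<lambda>y. fd \<tau> y (\<xi>c t)) ?x x' + fd \<tau> ?x \<xi>')) (at t within {0..1})"
    unfolding has_vector_derivative_def
  proof (rule has_derivative_transform_within_open[OF der[unfolded has_vector_derivative_def] W(1,2)])
    fix s assume s: "s \<in> W"
    then show "fd \<tau> ((cmap c \<circ> \<gamma>) s) (\<xi>c s) = comp d (\<gamma> s) (\<xi> s)"
      using comp_change[OF c d(1), of "\<gamma> s" "\<xi> s"] W(3)[OF s] by (simp add: transition_def \<tau>_def \<xi>c_def)
  qed
  have vec: "vec c (\<gamma> t) = fd \<tau> ?x" by (simp add: vec_trd[OF c p] transition_def \<tau>_def d_def)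
  have v: "velocity A \<gamma> t = fd \<tau> ?x x'" using velocity_chart(1)[OF c p cont x] by (simp add: vec)
  have \<xi>t: "\<xi> t = fd \<tau> ?x (\<xi>c t)" using vec_comp[OF c p, of "\<xi> t"] by (simp add: vec \<xi>c_def)
  have "fd \<tau> ?x (christoffel (GG c) ?x x' (\<xi>c t)) = fd (\<lambda>y. fd \<tau> y (\<xi>c t)) ?x x'
     + christoffel (GG d) ?y (velocity A \<gamma> t) (\<xi> t)"
    using christoffel_change[OF c d(1) p d(2), of x' "\<xi>c t"] v \<xi>t by (simp add: transition_def \<tau>_def)
  then show ?thesis
    using der2 linear_add[OF vec_linear[OF c p]] unfolding has_covariant_derivative_def Let_def d_def[symmetric] vec
    by (simp add: \<xi>c_def[symmetric] algebra_simps)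
qed

end

section \<open>Riemannian foliations\<close>

locale foliated_manifold = riem_manifold A g
  for A :: "('m::topological_space, 'e::euclidean_space) chart set" and g +
  fixes F :: "('m, 'v::euclidean_space \<times> 'h::euclidean_space) chart set"
  assumes fol: "riemannian_foliation A g F"
begin

lemma fol_chart: "\<phi> \<in> F \<Longrightarrow> is_chart \<phi>"
  using fol by (simp add: riemannian_foliation_def foliation_def)

lemma fol_pair: "c \<in> A \<Longrightarrow> \<phi> \<in> F \<Longrightarrow> chart_pair c \<phi>" "c \<in> A \<Longrightarrow> \<phi> \<in> F \<Longrightarrow> chart_pair \<phi> c"
  using fol is_chart[of c] smoothly_compatible_sym[of c \<phi>]
  by (simp_all add: riemannian_foliation_def foliation_def chart_pair_def)

lemma snd_foliated_has_derivative:
  assumes "c \<in> A" "\<phi> \<in> F" "p \<in> cdom c" "p \<in> cdom \<phi>"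
  shows "((snd \<circ> cmap \<phi>) \<circ> cinv c has_derivative (\<lambda>u. snd (transition c \<phi> p u))) (at (cmap c p))"
  using has_derivative_snd[OF chart_pair.tr_has_derivative[OF fol_pair(1)[OF assms(1,2)] assms(3,4)]]
  by (simp add: o_def)

lemma tdiff_snd:
  assumes "\<phi> \<in> F" "p \<in> cdom \<phi>"
  shows "tdiff A (snd \<circ> cmap \<phi>) p u = snd (transition (chart_at A p) \<phi> p u)"
  unfolding tdiff_def by (simp add: fd_eq[OF snd_foliated_has_derivative[OF chart_at(1) assms(1) chart_at(2) assms(2)]])

text \<open>The transverse coordinate of one foliated chart is constant along the plaques of another one.\<close>

lemma vertical_change:
  assumes \<phi>: "\<phi> \<in> F" "p \<in> cdom \<phi>" and \<psi>: "\<psi> \<in> F" "p \<in> cdom \<psi>"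
    and u: "tdiff A (snd \<circ> cmap \<phi>) p u = 0"
  shows "tdiff A (snd \<circ> cmap \<psi>) p u = 0"
proof -
  define c where "c = chart_at A p"
  have c: "c \<in> A" "p \<in> cdom c" using chart_at by (auto simp: c_def)
  interpret c\<phi>: chart_pair c \<phi> by (rule fol_pair[OF c(1) \<phi>(1)])
  interpret \<phi>c: chart_pair \<phi> c by (rule fol_pair(2)[OF c(1) \<phi>(1)])
  obtain W \<gamma> where W: "open W" "p \<in> W" "W \<subseteq> cdom \<phi> \<inter> cdom \<psi>"
    and \<gamma>: "\<And>q. q \<in> W \<Longrightarrow> snd (cmap \<psi> q) = \<gamma> (snd (cmap \<phi> q))"
    using fol \<phi> \<psi> unfolding riemannian_foliation_def foliation_def by (metis (no_types, lifting) IntI)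
  let ?f = "snd \<circ> cmap \<psi>"
  define Df where "Df = (\<lambda>w. snd (transition c \<psi> p (transition \<phi> c p w)))"
  have f\<phi>: "(?f \<circ> cinv \<phi> has_derivative Df) (at (cmap \<phi> p))"
    unfolding Df_def using \<phi>c.chain[OF \<phi>(2) c(2) snd_foliated_has_derivative[OF c(1) \<psi>(1) c(2) \<psi>(2)]] .
  define O\<phi> where "O\<phi> = cmap \<phi> ` (cdom \<phi> \<inter> W)"
  have O\<phi>: "open O\<phi>" "cmap \<phi> p \<in> O\<phi>"
    unfolding O\<phi>_def using chart_image_open[OF c\<phi>.d W(1)] \<phi> W by auto
  \<comment> \<open>Along a line in the first factor the transverse coordinate of
    \<open>\<phi>\<close> stays fixed, so that of \<open>\<psi>\<close>, a function of it on
    \<open>W\<close>, is constant too. Hence \<open>Df\<close> kills the plaque directions.\<close>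
  have Df0: "Df (a, 0) = 0" for a
  proof -
    let ?l = "\<lambda>s::real. cmap \<phi> p + s *\<^sub>R (a, 0)"
    have l: "(?l has_derivative (\<lambda>h. h *\<^sub>R (a, 0))) (at 0)"
      by (auto intro!: derivative_eq_intros)
    have "((\<lambda>s. (?f \<circ> cinv \<phi>) (?l s)) has_derivative (\<lambda>h. Df (h *\<^sub>R (a, 0)))) (at 0)"
      by (rule has_derivative_compose[OF l]) (use f\<phi> in \<open>simp add: o_def zero_prod_def[symmetric]\<close>)
    moreover have "open (?l -` O\<phi>)"
      by (intro open_vimage O\<phi> continuous_intros)
    moreover have "0 \<in> ?l -` O\<phi>" using O\<phi>(2) by (simp add: zero_prod_def[symmetric])
    moreover have "(?f \<circ> cinv \<phi>) (?l s) = ?f p" if "s \<in> ?l -` O\<phi>" for s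
    proof -
      have "?l s \<in> cmap \<phi> ` (cdom \<phi> \<inter> W)" using that unfolding O\<phi>_def vimage_def by blast
      then obtain q where q: "q \<in> cdom \<phi>" "q \<in> W" "?l s = cmap \<phi> q" by blast
      from arg_cong[OF q(3), of snd] have "snd (cmap \<phi> q) = snd (cmap \<phi> p)" by simp
      then show ?thesis using \<gamma>[OF q(2)] \<gamma>[OF W(2)] q c\<phi>.d by simp
    qed
    ultimately have "((\<lambda>s. ?f p) has_derivative (\<lambda>h. Df (h *\<^sub>R (a, 0)))) (at 0)"
      by (rule has_derivative_transform_within_open)
    then have "(\<lambda>h. Df (h *\<^sub>R (a, 0))) = (\<lambda>h. 0)"
      using has_derivative_unique[OF _ has_derivative_const] by blast
    then show ?thesis by (metis scaleR_one)
  qed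
  have "snd (transition c \<phi> p u) = 0" using u by (simp add: tdiff_snd[OF \<phi>] c_def)
  then have "Df (transition c \<phi> p u) = 0" using Df0 by (metis prod.collapse)
  then show ?thesis using c\<phi>.transition_inverse[OF c(2) \<phi>(2)] by (simp add: Df_def tdiff_snd[OF \<psi>] c_def)
qed

lemma vertical_iff:
  assumes "\<phi> \<in> F" "p \<in> cdom \<phi>"
  shows "u \<in> vertical A F p \<longleftrightarrow> tdiff A (snd \<circ> cmap \<phi>) p u = 0"
  unfolding vertical_def using vertical_change[OF _ _ assms] assms by blast

text \<open>Leaves have positive dimension because the type of leaf coordinates is nonzero. This
  supplies the initial dual vector.\<close>

lemma vertical_nonzero: "\<exists>u\<in>vertical A F p. u \<noteq> 0"
proof -
  have "p \<in> (\<Union>\<phi>\<in>F. cdom \<phi>)" using fol by (simp add: riemannian_foliation_def foliation_def)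
  then obtain \<phi> where \<phi>: "\<phi> \<in> F" "p \<in> cdom \<phi>" by blast
  obtain b :: 'v where b: "b \<in> Basis" using nonempty_Basis by blast
  define u where "u = transition \<phi> (chart_at A p) p (b, 0)"
  have e: "transition (chart_at A p) \<phi> p u = (b, 0)"
    unfolding u_def by (rule chart_pair.transition_inverse[OF fol_pair(2)[OF chart_at(1) \<phi>(1)] \<phi>(2) chart_at(2)])
  have "u \<noteq> 0"
    using e b linear_0[OF chart_pair.transition_linear[OF fol_pair(1)[OF chart_at(1) \<phi>(1)] chart_at(2) \<phi>(2)]]
    by (auto simp: zero_prod_def)
  moreover have "u \<in> vertical A F p" using e by (simp add: vertical_iff[OF \<phi>] tdiff_snd[OF \<phi>])
  ultimately show ?thesis by blast
qed

end

section \<open>The tensors of the foliation in the coordinates of an atlas chart\<close>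

locale foliated_patch = foliated_manifold A g F
  for A :: "('m::topological_space, 'e::euclidean_space) chart set" and g
    and F :: "('m, 'v::euclidean_space \<times> 'h::euclidean_space) chart set" +
  fixes c \<phi> U and k :: "'h \<Rightarrow> 'h \<Rightarrow> 'h \<Rightarrow> real"
  assumes cA: "c \<in> A" and \<phi>F: "\<phi> \<in> F" and open_U: "open U" and Uc: "U \<subseteq> cdom c" and U\<phi>: "U \<subseteq> cdom \<phi>"
    and sub: "riemannian_submersion A g U (snd \<circ> cmap \<phi>) k"
begin

definition S where "S = cmap c ` U"
definition pr where "pr = (snd \<circ> cmap \<phi>) \<circ> cinv c"

lemma cchart: "is_chart c" by (rule is_chart[OF cA])
lemma S_mem: "q \<in> U \<Longrightarrow> cmap c q \<in> S" by (simp add: S_def)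
lemma S_D: assumes "x \<in> S" shows "cinv c x \<in> U" "cmap c (cinv c x) = x" "x \<in> cimg c"
  using assms Uc cchart by (auto simp: S_def subset_eq)

lemma tdiff_pr: "q \<in> U \<Longrightarrow> tdiff A (snd \<circ> cmap \<phi>) q u = fd pr (cmap c q) (comp c q u)"
  unfolding pr_def using Uc U\<phi>
  by (intro tdiff_chart[OF cA] differentiableI[OF snd_foliated_has_derivative[OF cA \<phi>F]]) auto

lemma pr_comp_vec: "x \<in> S \<Longrightarrow> fd pr x u = tdiff A (snd \<circ> cmap \<phi>) (cinv c x) (vec c (cinv c x) u)"
  using S_D[of x] Uc cA by (subst tdiff_pr) auto

sublocale P: submersion_patch S "GG c" pr k
proof
  interpret C: metric_patch "cimg c" "GG c" by (rule patch[OF cA])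
  show "open S" unfolding S_def by (rule chart_image_open_subset[OF cchart open_U Uc])
  show "metric_on S (GG c)"
    using C.metric S_D(3) unfolding metric_on_def by (metis smooth_on_subset subsetI)
  have UU: "cdom c \<inter> U = U" using Uc by blast
  show "smooth_on S pr"
    using sub cA UU unfolding riemannian_submersion_def smooth_map_on_def S_def pr_def by metis
  have img: "pr ` S = (snd \<circ> cmap \<phi>) ` U"
    unfolding S_def pr_def image_image using Uc cchart by (intro image_cong) auto
  show "open (pr ` S)" "metric_on (pr ` S) k"
    using sub unfolding img riemannian_submersion_def by auto
  fix x assume x: "x \<in> S"
  note xD = S_D[OF x]
  have q: "cinv c x \<in> cdom c" using xD Uc by auto
  show "surj (fd pr x)"
  proof -
    have "surj (tdiff A (snd \<circ> cmap \<phi>) (cinv c x))" using sub xD by (simp add: riemannian_submersion_def)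
    then have "\<exists>u. h = fd pr x u" for h unfolding surj_def tdiff_pr[OF xD(1)] xD(2) by blast
    then show ?thesis by (simp add: surj_def)
  qed
  fix u w assume *: "\<And>z. fd pr x z = 0 \<Longrightarrow> GG c x u z = 0 \<and> GG c x w z = 0"
  let ?q = "cinv c x"
  have G: "GG c x a b = g ?q (vec c ?q a) (vec c ?q b)" for a b
    using GG_vec[OF cA q, of a b] by (simp add: xD)
  have "k ((snd \<circ> cmap \<phi>) ?q) (tdiff A (snd \<circ> cmap \<phi>) ?q (vec c ?q u)) (tdiff A (snd \<circ> cmap \<phi>) ?q (vec c ?q w))
     = g ?q (vec c ?q u) (vec c ?q w)"
  proof -
    have "g ?q (vec c ?q u) z = 0 \<and> g ?q (vec c ?q w) z = 0" if "tdiff A (snd \<circ> cmap \<phi>) ?q z = 0" for z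
      using *[of "comp c ?q z"] that unfolding tdiff_pr[OF xD(1)] xD(2) G by (simp add: cA q)
    then show ?thesis using sub xD(1) unfolding riemannian_submersion_def by blast
  qed
  then show "k (pr x) (fd pr x u) (fd pr x w) = GG c x u w"
    unfolding G pr_comp_vec[OF x] by (simp add: pr_def)
qed

lemma vert_iff: "q \<in> U \<Longrightarrow> u \<in> vertical A F q \<longleftrightarrow> P.vert (cmap c q) (comp c q u)"
  using vertical_iff[OF \<phi>F] U\<phi> tdiff_pr by auto

lemma vert_vec: "q \<in> U \<Longrightarrow> vec c q w \<in> vertical A F q \<longleftrightarrow> P.vert (cmap c q) w"
  using vert_iff[of q "vec c q w"] cA Uc by auto

lemma g_vec: "q \<in> U \<Longrightarrow> g q (vec c q u) (vec c q v) = GG c (cmap c q) u v"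
  using GG_vec[OF cA] Uc by auto

lemma hor_iff: assumes q: "q \<in> U" shows "u \<in> horizontal A g F q \<longleftrightarrow> P.hor (cmap c q) (comp c q u)"
proof -
  have qc: "q \<in> cdom c" using q Uc by blast
  have "g q u v = GG c (cmap c q) (comp c q u) (comp c q v)" for v using GG_comp[OF cA qc] by simp
  then have "u \<in> horizontal A g F q \<longleftrightarrow> (\<forall>v. P.vert (cmap c q) (comp c q v) \<longrightarrow> GG c (cmap c q) (comp c q u) (comp c q v) = 0)"
    by (simp add: horizontal_def Ball_def vert_iff[OF q])
  also have "\<dots> \<longleftrightarrow> P.hor (cmap c q) (comp c q u)"
    unfolding P.hor_def by (metis comp_vec[OF cA qc])
  finally show ?thesis .
qed

lemma hor_vec: "q \<in> U \<Longrightarrow> vec c q w \<in> horizontal A g F q \<longleftrightarrow> P.hor (cmap c q) w"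
  using hor_iff[of q "vec c q w"] cA Uc by auto

lemma vproj_eq: assumes q: "q \<in> U" shows "vproj A g F q u = vec c q (P.Q (cmap c q) (comp c q u))"
proof -
  let ?x = "cmap c q"
  have qc: "q \<in> cdom c" using q Uc by blast
  note x = S_mem[OF q]
  show ?thesis unfolding vproj_def
  proof (rule the_equality)
    have "u - vec c q (P.Q ?x (comp c q u)) = vec c q (P.lift ?x (fd pr ?x (comp c q u)))"
      unfolding P.Q_def using vec_comp[OF cA qc, of u] by (simp add: linear_diff[OF vec_linear[OF cA qc]])
    then show "vec c q (P.Q ?x (comp c q u)) \<in> vertical A F q \<and> u - vec c q (P.Q ?x (comp c q u)) \<in> horizontal A g F q"
      using P.Q_vert[OF x] P.lift_hor[OF x] by (simp add: vert_vec[OF q] hor_vec[OF q])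
  next
    fix v assume v: "v \<in> vertical A F q \<and> u - v \<in> horizontal A g F q"
    have vv: "P.vert ?x (comp c q v)" and h: "P.hor ?x (comp c q u - comp c q v)"
      using v by (auto simp: vert_iff[OF q] hor_iff[OF q] linear_diff[OF comp_linear[OF cA qc]])
    have "comp c q u - comp c q v = P.lift ?x (fd pr ?x (comp c q u))"
      using P.hor_eq_lift[OF x h] vv by (simp add: P.pi_simps x)
    then have "P.Q ?x (comp c q u) = comp c q v" by (simp add: P.Q_def algebra_simps)
    then show "v = vec c q (P.Q ?x (comp c q u))" by (simp add: cA qc)
  qed
qed

text \<open>The basic field over the constant vector \<beta>; it serves as the horizontal extension
  that witnesses the description in \<open>vnabla\<close>.\<close>

definition basic :: "'h \<Rightarrow> 'm \<Rightarrow> 'e" where "basic \<beta> q = vec c q (P.lift (cmap c q) \<beta>)"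

lemma basic_in_chart:
  assumes "x \<in> S" shows "field_in_chart A c (basic \<beta>) x = P.lift x \<beta>"
  using S_D[OF assms] Uc cA by (auto simp: field_in_chart_def basic_def)

lemma basic_smooth: "smooth_field_on A U (basic \<beta>)"
  unfolding smooth_field_on_def
proof
  fix d assume d: "d \<in> A"
  interpret cd: chart_pair c d by (rule pair[OF cA d])
  interpret dc: chart_pair d c by (rule pair[OF d cA])
  define \<tau> where "\<tau> = cmap d \<circ> cinv c"
  define \<sigma> where "\<sigma> = cmap c \<circ> cinv d"
  let ?O = "cmap d ` (cdom d \<inter> U)"
  have opn: "open ?O" by (rule chart_image_open[OF cd.d open_U])
  have zD: "cinv d z \<in> cdom d" "cinv d z \<in> U" "cmap d (cinv d z) = z" if "z \<in> ?O" for z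
    using that cd.d by auto
  have \<sigma>s: "smooth_on ?O \<sigma>"
    unfolding \<sigma>_def by (rule smooth_on_subset[OF dc.smooth_tr]) (use Uc in \<open>auto simp: dc.overlap_def\<close>)
  define R where "R = cd.overlap \<inter> S"
  have oR: "open R" unfolding R_def using cd.open_overlap P.open_S by auto
  have \<sigma>R: "\<sigma> z \<in> R" if "z \<in> ?O" for z
    using zD[OF that] Uc by (auto simp: R_def \<sigma>_def S_def cd.overlap_def)
  have "smooth_on R (\<lambda>y. fd \<tau> y (P.lift y \<beta>))"
    using cd.smooth_tr P.lift_smooth unfolding \<tau>_def R_def
    by (intro smooth_on_fd) (auto intro: smooth_on_subset oR[unfolded R_def])
  then have "smooth_on ?O (\<lambda>z. fd \<tau> (\<sigma> z) (P.lift (\<sigma> z) \<beta>))"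
    by (rule smooth_on_compose[OF oR opn _ \<sigma>s \<sigma>R])
  then show "smooth_on ?O (field_in_chart A d (basic \<beta>))"
  proof (rule smooth_on_cong[OF _ opn])
    fix z assume z: "z \<in> ?O"
    then show "fd \<tau> (\<sigma> z) (P.lift (\<sigma> z) \<beta>) = field_in_chart A d (basic \<beta>) z"
      using comp_change[OF cA d, of "cinv d z" "basic \<beta> (cinv d z)"] zD[OF z] Uc cA
      by (auto simp: field_in_chart_def basic_def transition_def \<tau>_def \<sigma>_def)
  qed
qed

text \<open>A basic field shows that an extension exists, and \<open>cov_horizontal_field\<close>
  that all extensions give the same value. Together they resolve the unique description.\<close>

lemma vnabla_eq:
  assumes q: "q \<in> U" and X: "X \<in> horizontal A g F q"
  shows "vnabla A g F q u X = vec c q (P.Q (cmap c q) (P.T (fd pr (cmap c q) (comp c q X)) (cmap c q) (comp c q u)))"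
proof -
  let ?x = "cmap c q" and ?\<beta> = "fd pr (cmap c q) (comp c q X)" and ?u = "comp c q u"
  have qc: "q \<in> cdom c" using q Uc by blast
  note x = S_mem[OF q]
  have lX: "P.lift ?x ?\<beta> = comp c q X"
    using P.hor_eq_lift[OF x] X hor_iff[OF q] by simp
  show ?thesis unfolding vnabla_def
  proof (rule the_equality, intro exI conjI)
    show "open U" "q \<in> U" "smooth_field_on A U (basic ?\<beta>)" by (rule open_U q basic_smooth)+
    show "\<forall>q\<in>U. basic ?\<beta> q \<in> horizontal A g F q"
      using P.lift_hor S_mem by (simp add: basic_def hor_vec)
    show "basic ?\<beta> q = X" by (simp add: basic_def lX cA qc)
    have fd: "fd (field_in_chart A c (basic ?\<beta>)) ?x = fd (\<lambda>x. P.lift x ?\<beta>) ?x"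
      by (rule fd_cong[OF P.open_S x basic_in_chart])
    have "field_in_chart A c (basic ?\<beta>) differentiable (at ?x)"
      using differentiable_cong_open[OF P.open_S x basic_in_chart] P.lift_diff[OF x] by simp
    from nabla_chart[OF cA qc this, of u]
    have "nabla A g q u (basic ?\<beta>) = vec c q (P.T ?\<beta> ?x ?u)"
      by (simp add: P.T_def P.cov_def metric_patch.cov_def[OF patch[OF cA]] fd basic_in_chart[OF x])
    then show "vec c q (P.Q ?x (P.T ?\<beta> ?x ?u)) = vproj A g F q (nabla A g q u (basic ?\<beta>))"
      by (simp add: vproj_eq[OF q] cA qc)
  next
    fix a assume "\<exists>X' W. open W \<and> q \<in> W \<and> smooth_field_on A W X' \<and>
       (\<forall>q\<in>W. X' q \<in> horizontal A g F q) \<and> X' q = X \<and> a = vproj A g F q (nabla A g q u X')"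
    then obtain X' W where W: "open W" "q \<in> W" and X's: "smooth_field_on A W X'"
      and hX': "\<And>q. q \<in> W \<Longrightarrow> X' q \<in> horizontal A g F q" and X'q: "X' q = X"
      and a: "a = vproj A g F q (nabla A g q u X')" by blast
    define Y where "Y = field_in_chart A c X'"
    define R where "R = cmap c ` (U \<inter> W)"
    have R: "open R" "?x \<in> R" "R \<subseteq> S"
      unfolding R_def S_def using chart_image_open_subset[OF cchart, of "U \<inter> W"] open_U W q Uc by auto
    have Yeq: "Y (cmap c p) = comp c p (X' p)" if "p \<in> U" for p
      using that Uc cchart by (auto simp: Y_def field_in_chart_def)
    have Yx: "Y ?x = P.lift ?x ?\<beta>" using Yeq[OF q] by (simp add: X'q lX)
    have Yd: "Y differentiable (at ?x)"
      using X's cA W(2) qc unfolding smooth_field_on_def Y_def by (blast intro: smooth_on_differentiable)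
    have Yh: "P.hor y (Y y)" if "y \<in> R" for y
    proof -
      obtain p where p: "p \<in> U" "p \<in> W" "y = cmap c p" using \<open>y \<in> R\<close> by (auto simp: R_def)
      then show ?thesis using hX'[OF p(2)] Yeq[OF p(1)] hor_iff[OF p(1)] by simp
    qed
    have nab: "nabla A g q u X' = vec c q (P.cov ?x Y ?u)"
      using nabla_chart[OF cA qc Yd[unfolded Y_def], of u]
      by (simp add: P.cov_def metric_patch.cov_def[OF patch[OF cA]] Y_def)
    have eq: "GG c ?x (P.cov ?x Y ?u) w = GG c ?x (P.T ?\<beta> ?x ?u) w" if w: "P.vert ?x w" for w
      using P.cov_horizontal_field[OF R Yh Yd w] P.cov_horizontal_field[OF P.open_S x subset_refl P.lift_hor P.lift_diff[OF x] w]
      by (simp add: Yx P.T_def)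
    have "P.Q ?x (P.cov ?x Y ?u) = P.Q ?x (P.T ?\<beta> ?x ?u)"
    proof -
      let ?d = "P.Q ?x (P.cov ?x Y ?u) - P.Q ?x (P.T ?\<beta> ?x ?u)"
      have v: "P.vert ?x ?d" by (simp add: P.pi_simps x P.Q_vert)
      have "GG c ?x ?d ?d = 0"
        using P.G_Q[OF x v] eq[OF v] by (simp add: P.G_lin(3)[OF x])
      from P.G_eq0[OF x this] show ?thesis by (simp only: right_minus_eq)
    qed
    then show "a = vec c q (P.Q ?x (P.T ?\<beta> ?x ?u))"
      by (simp add: a nab vproj_eq[OF q] cA qc)
  qed
qed

text \<open>The shape operator contributes the vertical part and, by \<open>T_adjoint\<close>, the
  adjoint of A the horizontal part of \<nabla>_\<xi> X. So the holonomy equation becomes \<nabla>_X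
  \<xi> = \<nabla>_\<xi> X; in coordinates the Christoffel terms cancel by symmetry.\<close>

lemma holonomy_rhs:
  assumes q: "q \<in> U" and X: "X \<in> horizontal A g F q" and \<xi>: "\<xi> \<in> vertical A F q"
  shows "- oneill_adjoint A g F q X \<xi> - shape A g F q X \<xi>
     = vec c q (P.T (fd pr (cmap c q) (comp c q X)) (cmap c q) (comp c q \<xi>))"
proof -
  let ?x = "cmap c q" and ?\<beta> = "fd pr (cmap c q) (comp c q X)" and ?\<xi> = "comp c q \<xi>"
  have qc: "q \<in> cdom c" using q Uc by blast
  note x = S_mem[OF q]
  note lX = P.hor_eq_lift[OF x X[unfolded hor_iff[OF q]]]
  have v\<xi>: "P.vert ?x ?\<xi>" using \<xi> vert_iff[OF q] by simp
  let ?t = "P.T ?\<beta> ?x ?\<xi>"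
  let ?h = "P.lift ?x (fd pr ?x ?t)"
  have split: "?t = P.Q ?x ?t + ?h" by (simp add: P.Q_def)
  have on: "g q \<xi> (oneill A g F q X Y) = GG c ?x (- ?h) (comp c q Y)" if Y: "Y \<in> horizontal A g F q" for Y
  proof -
    note lY = P.hor_eq_lift[OF x Y[unfolded hor_iff[OF q]]]
    let ?\<gamma> = "fd pr ?x (comp c q Y)"
    have "g q \<xi> (oneill A g F q X Y) = g q (vec c q ?\<xi>) (vec c q (P.Q ?x (P.T ?\<gamma> ?x (comp c q X))))"
      unfolding oneill_def vnabla_eq[OF q Y] by (simp add: cA qc)
    also have "\<dots> = GG c ?x ?\<xi> (P.Q ?x (P.T ?\<gamma> ?x (comp c q X)))" by (rule g_vec[OF q])
    also have "\<dots> = GG c ?x ?\<xi> (P.T ?\<gamma> ?x (comp c q X))"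
      using P.G_Q[OF x v\<xi>] P.G_sym[OF x, of ?\<xi>] by metis
    also have "\<dots> = - GG c ?x ?t (P.lift ?x ?\<gamma>)"
      using P.T_adjoint[OF x v\<xi>, of ?\<beta> ?\<gamma>] lX by simp
    also have "\<dots> = - GG c ?x ?h (P.lift ?x ?\<gamma>)"
    proof -
      have "GG c ?x (P.Q ?x ?t) (P.lift ?x ?\<gamma>) = 0"
        using P.lift_hor[OF x, of ?\<gamma>] P.Q_vert[OF x] P.G_sym[OF x] unfolding P.hor_def by metis
      then show ?thesis using arg_cong[OF split, of "\<lambda>a. GG c ?x a (P.lift ?x ?\<gamma>)"] by (simp add: P.G_lin(1)[OF x])
    qed
    also have "\<dots> = GG c ?x (- ?h) (comp c q Y)" using lY by (simp add: P.G_lin x)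
    finally show ?thesis .
  qed
  have "oneill_adjoint A g F q X \<xi> = vec c q (- ?h)"
    unfolding oneill_adjoint_def
  proof (rule the_equality, intro conjI ballI)
    show "vec c q (- ?h) \<in> horizontal A g F q"
      using P.lift_hor[OF x] by (simp add: hor_vec[OF q] P.hor_def P.G_lin x)
    show "g q (vec c q (- ?h)) Y = g q \<xi> (oneill A g F q X Y)" if "Y \<in> horizontal A g F q" for Y
      using g_vec[OF q, of "- ?h" "comp c q Y"] by (simp add: on[OF that] cA qc)
  next
    fix w assume w: "w \<in> horizontal A g F q \<and> (\<forall>Y\<in>horizontal A g F q. g q w Y = g q \<xi> (oneill A g F q X Y))"
    let ?d = "w - vec c q (- ?h)"
    have hd: "?d \<in> horizontal A g F q"
      using w P.lift_hor[OF x, of "fd pr ?x ?t"] hor_vec[OF q, of "- ?h"]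
      by (simp add: horizontal_def g_lin P.hor_def P.G_lin x)
    have "g q w ?d = g q (vec c q (- ?h)) ?d"
      using w hd on[OF hd] g_vec[OF q, of "- ?h" "comp c q ?d"] by (simp add: cA qc)
    then have "g q ?d ?d = 0" by (simp add: g_lin)
    then show "w = vec c q (- ?h)" using g_pos[of ?d q] by force
  qed
  moreover have "shape A g F q X \<xi> = - vec c q (P.Q ?x ?t)"
    by (simp add: shape_def vnabla_eq[OF q X])
  ultimately show ?thesis
    using arg_cong[OF split, of "vec c q"] by (simp add: vec_simps cA qc)
qed

end

text \<open>The set on which the foliation is a submersion is cut down to the domain of
  \<open>c\<close>. Its image remains open because foliated charts and projections are open
  maps.\<close>

lemma (in foliated_manifold) foliated_patch_exists:
  assumes c: "c \<in> A" and p: "p \<in> cdom c"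
  obtains \<phi> U k where "foliated_patch A g F c \<phi> U k" "p \<in> U"
proof -
  obtain \<phi> U k where \<phi>: "\<phi> \<in> F" and U: "open U" "p \<in> U" "U \<subseteq> cdom \<phi>"
    and sub: "riemannian_submersion A g U (snd \<circ> cmap \<phi>) k"
    using fol unfolding riemannian_foliation_def by blast
  let ?V = "U \<inter> cdom c" and ?f = "snd \<circ> cmap \<phi>"
  have oc: "open (cdom c)" by (rule chart_open(1)[OF is_chart[OF c]])
  have "riemannian_submersion A g ?V ?f k"
    unfolding riemannian_submersion_def
  proof (intro conjI)
    show "smooth_map_on A ?V ?f"
      using sub unfolding riemannian_submersion_def smooth_map_on_def
      by (meson Int_lower1 Int_mono image_mono order_refl smooth_on_subset)
    have "open (cmap \<phi> ` ?V)" by (rule chart_image_open_subset[OF fol_chart[OF \<phi>]]) (use U oc in auto)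
    then have "open (snd ` cmap \<phi> ` ?V)" by (rule open_image_snd)
    then show "open (?f ` ?V)" by (simp add: image_comp)
    have "?f ` ?V \<subseteq> ?f ` U" by blast
    then show "metric_on (?f ` ?V) k"
      using sub unfolding riemannian_submersion_def metric_on_def by (meson smooth_on_subset subsetD)
    show "\<forall>p\<in>?V. surj (tdiff A ?f p) \<and> (\<forall>u w. (\<forall>z. tdiff A ?f p z = 0 \<longrightarrow> g p u z = 0 \<and> g p w z = 0) \<longrightarrow>
           k (?f p) (tdiff A ?f p u) (tdiff A ?f p w) = g p u w)"
      using sub unfolding riemannian_submersion_def by blast
  qed
  then have "foliated_patch A g F c \<phi> ?V k"
    using c \<phi> U oc by unfold_locales auto
  then show thesis by (rule that) (use U p in simp)
qed

section \<open>Flows in a submersion patch\<close>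

lemma smooth_fd_bound:
  fixes V :: "'a::euclidean_space \<Rightarrow> 'b::real_normed_vector"
  assumes "smooth_on \<Omega> V" "compact B" "B \<subseteq> \<Omega>"
  shows "\<exists>M>0. \<forall>x\<in>B. \<forall>v. norm (fd V x v) \<le> M * norm v"
proof -
  have "continuous_on B (\<lambda>x. \<Sum>b\<in>Basis. norm (fd V x b))"
    by (intro continuous_intros continuous_on_subset[OF smooth_on_continuous[OF smooth_on_fd_const[OF assms(1)]] assms(3)])
  then have "bounded ((\<lambda>x. \<Sum>b\<in>Basis. norm (fd V x b)) ` B)"
    using assms(2) compact_continuous_image compact_imp_bounded by blast
  then obtain M where M: "M > 0" "\<And>x. x \<in> B \<Longrightarrow> norm (\<Sum>b\<in>Basis. norm (fd V x b)) \<le> M"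
    by (auto simp: bounded_pos)
  have "norm (fd V x v) \<le> M * norm v" if x: "x \<in> B" for x v
  proof -
    have l: "linear (fd V x)" using smooth_on_fd_linear[OF assms(1)] x assms(3) by blast
    have "norm (fd V x v) = norm (\<Sum>b\<in>Basis. (v \<bullet> b) *\<^sub>R fd V x b)" by (subst linear_basis_sum[OF l, of v]) simp
    also have "\<dots> \<le> (\<Sum>b\<in>Basis. norm v * norm (fd V x b))"
      by (rule order_trans[OF norm_sum]) (auto intro!: sum_mono mult_right_mono simp: Basis_le_norm)
    also have "\<dots> = (\<Sum>b\<in>Basis. norm (fd V x b)) * norm v"
      by (simp add: sum_distrib_left[symmetric] mult.commute)
    also have "\<dots> \<le> M * norm v"
      using M(2)[OF x] by (intro mult_right_mono) auto
    finally show ?thesis .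
  qed
  then show ?thesis using M(1) by blast
qed

lemma smooth_lipschitz:
  fixes V :: "'a::euclidean_space \<Rightarrow> 'b::real_normed_vector"
  assumes "smooth_on \<Omega> V" "compact B" "convex B" "B \<subseteq> \<Omega>"
  shows "\<exists>K>0. \<forall>x\<in>B. \<forall>y\<in>B. norm (V x - V y) \<le> K * norm (x - y)"
proof -
  obtain M where M: "M > 0" "\<And>x v. x \<in> B \<Longrightarrow> norm (fd V x v) \<le> M * norm v"
    using smooth_fd_bound[OF assms(1,2,4)] by blast
  have "norm (V x - V y) \<le> M * norm (x - y)" if "x \<in> B" "y \<in> B" for x y
  proof (rule differentiable_bound[OF assms(3)])
    show "(V has_derivative fd V z) (at z within B)" if "z \<in> B" for z
      using smooth_on_works[OF assms(1)] that assms(4) by (blast intro: has_derivative_at_withinI)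
    show "onorm (fd V z) \<le> M" if "z \<in> B" for z using M(2)[OF that] by (rule onorm_le)
  qed (use that in auto)
  then show ?thesis using M(1) by blast
qed

lemma smooth_on_family_snd:
  fixes L :: "'c::euclidean_space \<Rightarrow> 'a::euclidean_space \<Rightarrow> 'b::real_normed_vector"
  assumes "open S" "\<And>x. x \<in> S \<Longrightarrow> linear (L x)" "\<And>b. smooth_on S (\<lambda>x. L x b)"
  shows "smooth_on (S \<times> UNIV) (\<lambda>z. L (fst z) (snd z))"
proof (rule smooth_on_linear_family[where L="\<lambda>z. L (fst z)"])
  show o: "open (S \<times> (UNIV :: 'a set))" using assms(1) by (simp add: open_Times)
  show "smooth_on (S \<times> (UNIV :: 'a set)) (\<lambda>z. L (fst z) b)" for b
    using smooth_on_compose[OF assms(1) o assms(3)[of b] smooth_on_fst[OF o smooth_on_id[OF o]]] by auto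
  show "smooth_on (S \<times> (UNIV :: 'a set)) snd" using smooth_on_snd[OF o smooth_on_id[OF o]] .
qed (use assms(2) in auto)

context submersion_patch
begin

abbreviation "\<Omega> \<equiv> S \<times> (UNIV :: 'e set)"

lemma open_Omega: "open \<Omega>" using open_S by (simp add: open_Times)

lemma fst_smooth: "smooth_on S f \<Longrightarrow> smooth_on \<Omega> (\<lambda>z. f (fst z))" for f :: "'e \<Rightarrow> 'b::real_normed_vector"
  by (rule smooth_on_compose[where f=f and g=fst, OF open_S open_Omega])
    (use smooth_on_fst[OF open_Omega smooth_on_id[OF open_Omega]] in auto)

lemma snd_smooth: "smooth_on \<Omega> snd" using smooth_on_snd[OF open_Omega smooth_on_id[OF open_Omega]] .

lemma dual_rhs_linear: "x \<in> S \<Longrightarrow> linear (dual_rhs \<beta> x)"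
  unfolding dual_rhs_def using linear_compose[OF T_linear[of x \<beta>] Q_linear[of x]]
  by (intro linear_compose_sub linear_compose_scale_right fd_linear lift_diff) (simp_all add: o_def)

lemma dual_rhs_smooth: "smooth_on S (\<lambda>x. dual_rhs \<beta> x \<nu>)"
  unfolding dual_rhs_def
  by (intro smooth_intros open_S smooth_on_fd_const lift_smooth
      smooth_on_linear_family[OF open_S Q_linear Q_smooth T_smooth])

lemma dual_vf_smooth: "smooth_on \<Omega> (dual_vf \<beta>)"
  unfolding dual_vf_def[abs_def]
  by (intro smooth_on_Pair open_Omega fst_smooth lift_smooth smooth_on_family_snd[OF open_S dual_rhs_linear dual_rhs_smooth])

lemma GG_smooth_Omega: "smooth_on \<Omega> u \<Longrightarrow> smooth_on \<Omega> v \<Longrightarrow> smooth_on \<Omega> (\<lambda>z. G (fst z) (u z) (v z))"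
  by (rule smooth_on_bilinear_family[OF open_Omega]) (auto intro: G_bil fst_smooth G_smooth)

lemma len_deriv_smooth: "smooth_on \<Omega> (len_deriv \<beta>)"
  unfolding len_deriv_def[abs_def]
  by (intro smooth_on_mult smooth_on_const open_Omega GG_smooth_Omega snd_smooth
      smooth_on_family_snd[OF open_S T_linear T_smooth[OF smooth_on_const]])

text \<open>Differentiating the identity that X projects to \<beta> shows that the homogeneous
  equation preserves the projection of \<open>u\<close>; a vertical \<open>q\<close> does not affect
  it. The case \<open>q = 0\<close> is that of holonomy fields,
  \<open>q = - 2 *\<^sub>R Q x (T \<beta> x \<nu>)\<close> that of dual ones.\<close>

lemma vertical_transport:
  assumes x: "p a \<in> S" and p: "(p has_derivative (\<lambda>h. h *\<^sub>R (r *\<^sub>R lift (p a) \<beta>))) (at a within A)"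
    and u: "(u has_derivative (\<lambda>h. h *\<^sub>R (r *\<^sub>R fd (\<lambda>y. lift y \<beta>) (p a) (u a) + q))) (at a within A)"
    and q: "vert (p a) q"
  shows "((\<lambda>t. fd \<pi> (p t) (u t)) has_derivative (\<lambda>h. 0)) (at (a::real) within A)"
proof -
  have d: "(\<lambda>y. fd \<pi> y b) differentiable (at (p a))" for b
    by (rule smooth_on_differentiable[OF smooth_on_fd_const[OF pi_smooth] x])
  have l2: "linear (fd (\<lambda>y. fd \<pi> y b) (p a))" for b by (rule fd_linear[OF d])
  have "((\<lambda>t. fd \<pi> (p t) (u t)) has_derivative
     (\<lambda>h. fd (\<lambda>y. fd \<pi> y (u a)) (p a) (h *\<^sub>R (r *\<^sub>R lift (p a) \<beta>))
        + fd \<pi> (p a) (h *\<^sub>R (r *\<^sub>R fd (\<lambda>y. lift y \<beta>) (p a) (u a) + q)))) (at a within A)"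
    by (rule has_derivative_linear_family_compose[OF open_S x pi_lin d p u])
  moreover have "fd \<pi> (p a) (fd (\<lambda>y. lift y \<beta>) (p a) (u a)) = - fd (\<lambda>y. fd \<pi> y (lift (p a) \<beta>)) (p a) (u a)"
    by (rule projectable_fd[OF x lift_diff[OF x] pi_lift])
  moreover have "fd (\<lambda>y. fd \<pi> y (lift (p a) \<beta>)) (p a) (u a) = fd (\<lambda>y. fd \<pi> y (u a)) (p a) (lift (p a) \<beta>)"
    by (rule fd_symmetric[OF open_S pi_smooth x])
  ultimately show ?thesis using q by (simp add: pi_simps x linear_cmul[OF l2])
qed

lemma vertical_transport_const:
  assumes conv: "convex A" and a: "a \<in> A" "vert (p a) (u a)" and t: "t \<in> A"
    and x: "\<And>t. t \<in> A \<Longrightarrow> p t \<in> S"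
    and p: "\<And>t. t \<in> A \<Longrightarrow> (p has_vector_derivative r *\<^sub>R lift (p t) \<beta>) (at t within A)"
    and u: "\<And>t. t \<in> A \<Longrightarrow> (u has_vector_derivative r *\<^sub>R fd (\<lambda>y. lift y \<beta>) (p t) (u t) + q t) (at t within A)"
    and q: "\<And>t. t \<in> A \<Longrightarrow> vert (p t) (q t)"
  shows "vert (p t) (u t)"
proof -
  have "\<And>s. s \<in> A \<Longrightarrow> ((\<lambda>t. fd \<pi> (p t) (u t)) has_derivative (\<lambda>h. 0)) (at s within A)"
    using vertical_transport[OF x p[unfolded has_vector_derivative_def] u[unfolded has_vector_derivative_def] q] by blast
  from has_derivative_zero_unique[OF conv this a(1) t] show ?thesis using a(2) by simp
qed

text \<open>The derivative is a multiple of G(T n - 2 Q T n, u) + G(n, T u) = - G(T n, u) + G(n, T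
  u), which vanishes by self-adjointness. The factor \<open>r\<close> allows the curve to be run
  backwards.\<close>

lemma dual_pairing:
  assumes x: "p a \<in> S" and p: "(p has_vector_derivative r *\<^sub>R lift (p a) \<beta>) (at a within A)"
    and n: "(n has_vector_derivative r *\<^sub>R dual_rhs \<beta> (p a) (n a)) (at a within A)"
    and u: "(u has_vector_derivative r *\<^sub>R fd (\<lambda>y. lift y \<beta>) (p a) (u a)) (at a within A)"
    and v: "vert (p a) (n a)" "vert (p a) (u a)"
  shows "((\<lambda>t. G (p t) (n t) (u t)) has_derivative (\<lambda>h. 0)) (at a within A)"
proof -
  note Gs = Gam_sym[OF x, of "lift (p a) \<beta>"]
  have e1: "h *\<^sub>R (r *\<^sub>R dual_rhs \<beta> (p a) (n a)) + Gam (p a) (h *\<^sub>R (r *\<^sub>R lift (p a) \<beta>)) (n a)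
     = (h * r) *\<^sub>R (T \<beta> (p a) (n a) - 2 *\<^sub>R Q (p a) (T \<beta> (p a) (n a)))" for h
    by (simp add: dual_rhs_def T_alt Gam_lin x Gs algebra_simps)
  have e2: "h *\<^sub>R (r *\<^sub>R fd (\<lambda>y. lift y \<beta>) (p a) (u a)) + Gam (p a) (h *\<^sub>R (r *\<^sub>R lift (p a) \<beta>)) (u a)
     = (h * r) *\<^sub>R T \<beta> (p a) (u a)" for h
    by (simp add: T_alt Gam_lin x Gs algebra_simps)
  show ?thesis
    using metric_has_derivative[OF x p[unfolded has_vector_derivative_def] n[unfolded has_vector_derivative_def] u[unfolded has_vector_derivative_def]]
      T_symmetric[OF x v, of \<beta>]
    unfolding e1 e2 by (simp add: G_lin x G_Q v algebra_simps)
qed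

lemma norm_derivative:
  assumes x: "p a \<in> S" and p: "(p has_vector_derivative lift (p a) \<beta>) (at a within A)"
    and n: "(n has_vector_derivative dual_rhs \<beta> (p a) (n a)) (at a within A)"
    and v: "vert (p a) (n a)"
  shows "((\<lambda>t. G (p t) (n t) (n t)) has_vector_derivative len_deriv \<beta> (p a, n a)) (at a within A)"
proof -
  note Gs = Gam_sym[OF x, of "lift (p a) \<beta>"]
  have e1: "h *\<^sub>R dual_rhs \<beta> (p a) (n a) + Gam (p a) (h *\<^sub>R lift (p a) \<beta>) (n a)
     = h *\<^sub>R (T \<beta> (p a) (n a) - 2 *\<^sub>R Q (p a) (T \<beta> (p a) (n a)))" for h
    by (simp add: dual_rhs_def T_alt Gam_lin x Gs algebra_simps)
  show ?thesis
    using metric_has_derivative[OF x p[unfolded has_vector_derivative_def] n[unfolded has_vector_derivative_def] n[unfolded has_vector_derivative_def]]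
      G_sym[OF x, of "n a" "T \<beta> (p a) (n a)"] G_sym[OF x, of "n a" "Q (p a) (T \<beta> (p a) (n a))"]
    unfolding e1 has_vector_derivative_def by (simp add: G_lin x G_Q v len_deriv_def algebra_simps)
qed

text \<open>The point is uniformity: \<open>\<delta>\<close>, \<open>r\<close> and \<open>M\<close>
  serve all initial pairs near the given one. The bound \<open>M\<close> is recorded for the linear
  equation of holonomy fields that is solved later along these curves.\<close>

lemma Omega_flow:
  assumes x0: "x0 \<in> S" and \<epsilon>: "\<epsilon> > 0"
  obtains \<delta> r M where "\<delta> > 0" "r > 0" "M > 0" "\<delta> * M \<le> 1 / 2"
    "\<And>z1. dist z1 (x0, \<nu>0) < r \<Longrightarrow> \<exists>z. z 0 = z1 \<and> (\<forall>t\<in>{-3*\<delta><..<3*\<delta>}. dist (z t) (x0, \<nu>0) < \<epsilon> \<and> fst (z t) \<in> S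
       \<and> (\<forall>v. norm (fd (\<lambda>y. lift y \<beta>) (fst (z t)) v) \<le> M * norm v) \<and> (z has_vector_derivative dual_vf \<beta> (z t)) (at t))"
proof -
  let ?z0 = "(x0, \<nu>0)"
  have "?z0 \<in> \<Omega>" using x0 by simp
  then obtain e where e: "e > 0" "cball ?z0 e \<subseteq> \<Omega>" using open_Omega open_contains_cball by blast
  define r where "r = min (e / 2) (\<epsilon> / 3)"
  have r: "r > 0" "2 * r \<le> e" "2 * r < \<epsilon>" using e(1) \<epsilon> by (auto simp: r_def)
  define B where "B = cball ?z0 (2 * r)"
  have B: "compact B" "convex B" "B \<subseteq> \<Omega>" using e(2) r subset_cball[OF r(2), of ?z0] by (auto simp: B_def)
  obtain K where K: "K > 0" "\<And>x y. x \<in> B \<Longrightarrow> y \<in> B \<Longrightarrow> norm (dual_vf \<beta> x - dual_vf \<beta> y) \<le> K * norm (x - y)"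
    using smooth_lipschitz[OF dual_vf_smooth B] by blast
  have "continuous_on B (dual_vf \<beta>)" by (rule continuous_on_subset[OF smooth_on_continuous[OF dual_vf_smooth] B(3)])
  then have "bounded (dual_vf \<beta> ` B)" using B(1) compact_continuous_image compact_imp_bounded by blast
  then obtain C where C: "C > 0" "\<And>x. x \<in> B \<Longrightarrow> norm (dual_vf \<beta> x) \<le> C" by (auto simp: bounded_pos)
  have fB: "compact (fst ` B)" "fst ` B \<subseteq> S"
    using B compact_continuous_image[OF continuous_on_fst[OF continuous_on_id] B(1)] by auto
  obtain M where M: "M > 0" "\<And>x v. x \<in> fst ` B \<Longrightarrow> norm (fd (\<lambda>y. lift y \<beta>) x v) \<le> M * norm v"
    using smooth_fd_bound[OF lift_smooth[of \<beta>] fB] by blast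
  \<comment> \<open>The three bounds keep solutions within distance \<open>r\<close> of their start,
    make the Picard operator a contraction, and provide for the linear equation with constant
    \<open>M\<close>.\<close>
  define T0 where "T0 = min (r / C) (min (1 / (2 * K)) (1 / (2 * M)))"
  have T0: "T0 > 0" "T0 * C \<le> r" "T0 * K < 1" "T0 * M \<le> 1 / 2"
  proof -
    show "T0 > 0" using r K C M by (simp add: T0_def)
    have "T0 \<le> r / C" "T0 \<le> 1 / (2 * K)" "T0 \<le> 1 / (2 * M)" by (simp_all add: T0_def)
    then show "T0 * C \<le> r" "T0 * K < 1" "T0 * M \<le> 1 / 2" using C(1) K(1) M(1) by (simp_all add: field_simps)
  qed
  \<comment> \<open>Only the time from 0 to \<open>\<delta>\<close> is of interest; the room on both
    sides lets the reversed curve be extended past its ends and solved along in both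
    directions.\<close>
  define \<delta> where "\<delta> = T0 / 3"
  show thesis
  proof (rule that[of \<delta> r M])
    show "\<delta> > 0" "\<delta> * M \<le> 1 / 2" using T0 M(1) by (simp_all add: \<delta>_def field_simps)
    show "r > 0" "M > 0" by fact+
    fix z1 assume z1: "dist z1 ?z0 < r"
    have sub: "cball z1 r \<subseteq> B"
    proof
      fix y assume "y \<in> cball z1 r"
      then show "y \<in> B" using z1 dist_triangle[of ?z0 y z1] by (simp add: B_def dist_commute)
    qed
    have "\<exists>z. z 0 = z1 \<and> (\<forall>t\<in>{-T0..T0}. z t \<in> cball z1 r \<and> (z has_vector_derivative dual_vf \<beta> (z t)) (at t within {-T0..T0}))"
    proof (rule picard_local[OF T0(1) _ _ _ T0(2) _ _ T0(3)])
      show "continuous_on ({-T0..T0} \<times> cball z1 r) (\<lambda>(t, x). dual_vf \<beta> x)"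
        unfolding split_beta'
        by (rule continuous_on_compose2[OF continuous_on_subset[OF smooth_on_continuous[OF dual_vf_smooth] B(3)]])
          (use sub in \<open>auto intro!: continuous_intros\<close>)
      show "norm (dual_vf \<beta> x) \<le> C" if "x \<in> cball z1 r" for x
        by (rule C(2)[OF subsetD[OF sub that]])
      show "norm (dual_vf \<beta> x - dual_vf \<beta> y) \<le> K * norm (x - y)" if "x \<in> cball z1 r" "y \<in> cball z1 r" for x y
        by (rule K(2)[OF subsetD[OF sub that(1)] subsetD[OF sub that(2)]])
    qed (use r(1) K(1) in simp_all)
    then obtain z where z: "z 0 = z1" "\<And>t. t \<in> {-T0..T0} \<Longrightarrow> z t \<in> cball z1 r"
      "\<And>t. t \<in> {-T0..T0} \<Longrightarrow> (z has_vector_derivative dual_vf \<beta> (z t)) (at t within {-T0..T0})" by blast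
    show "\<exists>z. z 0 = z1 \<and> (\<forall>t\<in>{-3*\<delta><..<3*\<delta>}. dist (z t) ?z0 < \<epsilon> \<and> fst (z t) \<in> S
       \<and> (\<forall>v. norm (fd (\<lambda>y. lift y \<beta>) (fst (z t)) v) \<le> M * norm v) \<and> (z has_vector_derivative dual_vf \<beta> (z t)) (at t))"
    proof (intro exI[of _ z] conjI ballI allI)
      show "z 0 = z1" by fact
      fix t assume t: "t \<in> {-3*\<delta><..<3*\<delta>}"
      then have t': "t \<in> {-T0<..<T0}" by (simp add: \<delta>_def)
      have zB: "z t \<in> B" using z(2)[of t] t' sub by auto
      then show "dist (z t) ?z0 < \<epsilon>" using r(3) by (simp add: B_def dist_commute)
      show "fst (z t) \<in> S" using zB B(3) by auto
      show "norm (fd (\<lambda>y. lift y \<beta>) (fst (z t)) v) \<le> M * norm v" for v using zB by (intro M) auto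
      show "(z has_vector_derivative dual_vf \<beta> (z t)) (at t)"
        using z(3)[of t] t' at_within_interior[of t "{-T0..T0}"] by simp
    qed
  qed
qed

end

section \<open>Transport along horizontal curves\<close>

context foliated_manifold
begin

text \<open>The conditions on curve and field at a single time, so that they can be checked
  separately on overlapping open intervals when curves are joined.\<close>

definition hol_at :: "(real \<Rightarrow> 'm) \<Rightarrow> (real \<Rightarrow> 'e) \<Rightarrow> real \<Rightarrow> bool" where
  "hol_at \<gamma> \<xi> t \<longleftrightarrow> velocity A \<gamma> t \<in> horizontal A g F (\<gamma> t) \<and> \<xi> t \<in> vertical A F (\<gamma> t) \<and>
     has_covariant_derivative A g \<gamma> \<xi>
       (- oneill_adjoint A g F (\<gamma> t) (velocity A \<gamma> t) (\<xi> t) - shape A g F (\<gamma> t) (velocity A \<gamma> t) (\<xi> t)) t"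

definition transport :: "'m \<Rightarrow> 'e \<Rightarrow> 'm \<Rightarrow> 'e \<Rightarrow> bool" where
  "transport p \<xi> q \<eta> \<longleftrightarrow> (\<exists>\<gamma> X. smooth_curve A \<gamma> \<and> (\<forall>t\<in>{0..1}. hol_at \<gamma> X t) \<and>
     \<gamma> 0 = p \<and> X 0 = \<xi> \<and> \<gamma> 1 = q \<and> X 1 = \<eta>)"

lemma transport_iff:
  "transport p \<xi> q \<eta> \<longleftrightarrow> (\<exists>\<gamma> X. horizontal_curve A g F \<gamma> \<and> holonomy_field A g F \<gamma> X \<and>
     \<gamma> 0 = p \<and> X 0 = \<xi> \<and> \<gamma> 1 = q \<and> X 1 = \<eta>)"
  unfolding transport_def hol_at_def horizontal_curve_def holonomy_field_def by blast

text \<open>The tensors are given by unique descriptions, so linearity in \<open>X\<close> is read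
  off from the formula in a patch.\<close>

lemma holonomy_rhs_scale:
  assumes "X \<in> horizontal A g F q" "\<xi> \<in> vertical A F q"
  shows "r *\<^sub>R X \<in> horizontal A g F q"
    "- oneill_adjoint A g F q (r *\<^sub>R X) \<xi> - shape A g F q (r *\<^sub>R X) \<xi>
     = r *\<^sub>R (- oneill_adjoint A g F q X \<xi> - shape A g F q X \<xi>)"
proof -
  show h: "r *\<^sub>R X \<in> horizontal A g F q" using assms(1) by (simp add: horizontal_def g_lin)
  obtain \<phi> U k where "foliated_patch A g F (chart_at A q) \<phi> U k" and q: "q \<in> U"
    using foliated_patch_exists[OF chart_at] .
  then interpret foliated_patch A g F "chart_at A q" \<phi> U k by simp
  note x = S_mem[OF q] and qc = chart_at(2)[of q]
  show "- oneill_adjoint A g F q (r *\<^sub>R X) \<xi> - shape A g F q (r *\<^sub>R X) \<xi>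
     = r *\<^sub>R (- oneill_adjoint A g F q X \<xi> - shape A g F q X \<xi>)"
    unfolding holonomy_rhs[OF q h assms(2)] holonomy_rhs[OF q assms]
    by (simp add: comp_simps cA qc P.pi_simps x linear_cmul[OF P.T_linear2[OF x]] vec_simps)
qed

lemma hol_at_cong:
  assumes W: "open W" "t \<in> W" "\<And>s. s \<in> W \<Longrightarrow> \<gamma> s = \<gamma>' s" "\<And>s. s \<in> W \<Longrightarrow> \<xi> s = \<xi>' s" and h: "hol_at \<gamma> \<xi> t"
  shows "hol_at \<gamma>' \<xi>' t"
proof -
  have e: "\<gamma> t = \<gamma>' t" "\<xi> t = \<xi>' t" using W by auto
  have v: "velocity A \<gamma> t = velocity A \<gamma>' t"
    unfolding velocity_def e(1) vector_derivative_def has_vector_derivative_def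
    by (subst has_derivative_cong_open[OF W(1,2)]) (simp_all add: W(3))
  have "((\<lambda>s. tdiff A (cmap c) (\<gamma> s) (\<xi> s)) has_vector_derivative D) (at t within {0..1}) \<Longrightarrow>
     ((\<lambda>s. tdiff A (cmap c) (\<gamma>' s) (\<xi>' s)) has_vector_derivative D) (at t within {0..1})" for c :: "('m, 'e) chart" and D
    unfolding has_vector_derivative_def
    by (erule has_derivative_transform_within_open[OF _ W(1,2)]) (simp add: W(3,4))
  then show ?thesis using h unfolding hol_at_def has_covariant_derivative_def Let_def e v by blast
qed

lemma smooth_curve_reparam:
  assumes \<gamma>: "smooth_curve A \<gamma>" and \<phi>: "smooth_on UNIV \<phi>" "\<And>t. \<phi> t \<in> {0..1}"
  shows "continuous_on UNIV (\<lambda>t. \<gamma> (\<phi> t))"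
    "c \<in> A \<Longrightarrow> smooth_on ((\<lambda>t. \<gamma> (\<phi> t)) -` cdom c) (\<lambda>t. cmap c (\<gamma> (\<phi> t)))"
proof -
  obtain T where T: "open T" "{0..1} \<subseteq> T" "continuous_on T \<gamma>"
    "\<And>c. c \<in> A \<Longrightarrow> smooth_on (T \<inter> \<gamma> -` cdom c) (cmap c \<circ> \<gamma>)"
    using \<gamma> unfolding smooth_curve_def by blast
  show cont: "continuous_on UNIV (\<lambda>t. \<gamma> (\<phi> t))"
    by (rule continuous_on_compose2[OF T(3) smooth_on_continuous[OF \<phi>(1)]]) (use \<phi>(2) T(2) in blast)
  assume c: "c \<in> A"
  have oc: "open (cdom c)" by (rule chart_open(1)[OF is_chart[OF c]])
  have o: "open (T \<inter> \<gamma> -` cdom c)" by (rule continuous_open_preimage[OF T(3,1) oc])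
  have o': "open ((\<lambda>t. \<gamma> (\<phi> t)) -` cdom c)" using continuous_on_open_vimage[OF open_UNIV] cont oc by auto
  have "smooth_on ((\<lambda>t. \<gamma> (\<phi> t)) -` cdom c) (\<lambda>t. (cmap c \<circ> \<gamma>) (\<phi> t))"
    by (rule smooth_on_compose[OF o o' T(4)[OF c] smooth_on_subset[OF \<phi>(1)]]) (use \<phi>(2) T(2) in auto)
  then show "smooth_on ((\<lambda>t. \<gamma> (\<phi> t)) -` cdom c) (\<lambda>t. cmap c (\<gamma> (\<phi> t)))" by simp
qed

text \<open>By the chain rule both sides of the equation are multiplied by the derivative of
  \<open>\<phi>\<close>. As \<open>\<phi>\<close> maps everything into [0,1], one-sided derivatives
  compose and the result holds at every real time.\<close>

lemma hol_at_reparam: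
  assumes \<gamma>: "smooth_curve A \<gamma>" and h: "\<And>t. t \<in> {0..1} \<Longrightarrow> hol_at \<gamma> \<xi> t"
    and \<phi>: "smooth_on UNIV \<phi>" "\<And>t. \<phi> t \<in> {0..1}"
  shows "hol_at (\<lambda>t. \<gamma> (\<phi> t)) (\<lambda>t. \<xi> (\<phi> t)) t"
proof -
  obtain T where T: "open T" "{0..1} \<subseteq> T" "continuous_on T \<gamma>"
    "\<And>c. c \<in> A \<Longrightarrow> smooth_on (T \<inter> \<gamma> -` cdom c) (cmap c \<circ> \<gamma>)"
    using \<gamma> unfolding smooth_curve_def by blast
  let ?q = "\<gamma> (\<phi> t)"
  define c where "c = chart_at A ?q"
  have c: "c \<in> A" "?q \<in> cdom c" using chart_at by (auto simp: c_def)
  interpret C: metric_patch "cimg c" "GG c" by (rule patch[OF c(1)])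
  have x: "cmap c ?q \<in> cimg c" using is_chart[OF c(1)] c(2) by simp
  define r where "r = vector_derivative \<phi> (at t)"
  have r: "(\<phi> has_vector_derivative r) (at t)"
    unfolding r_def using smooth_on_differentiable[OF \<phi>(1)] by (simp add: vector_derivative_works[symmetric])
  have mem: "\<phi> t \<in> T \<inter> \<gamma> -` cdom c" using T(2) \<phi>(2) c(2) by auto
  have "(cmap c \<circ> \<gamma>) differentiable (at (\<phi> t))" by (rule smooth_on_differentiable[OF T(4)[OF c(1)] mem])
  then have v0: "((cmap c \<circ> \<gamma>) has_vector_derivative velocity A \<gamma> (\<phi> t)) (at (\<phi> t))"
    by (simp add: velocity_def c_def vector_derivative_works[symmetric])
  have "((cmap c \<circ> \<gamma>) \<circ> \<phi> has_vector_derivative (r *\<^sub>R velocity A \<gamma> (\<phi> t))) (at t)"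
    by (rule vector_diff_chain_at[OF r v0])
  then have vel: "velocity A (\<lambda>t. \<gamma> (\<phi> t)) t = r *\<^sub>R velocity A \<gamma> (\<phi> t)"
    unfolding velocity_def c_def[symmetric] by (simp add: vector_derivative_at o_def)
  let ?w = "- oneill_adjoint A g F ?q (velocity A \<gamma> (\<phi> t)) (\<xi> (\<phi> t)) - shape A g F ?q (velocity A \<gamma> (\<phi> t)) (\<xi> (\<phi> t))"
  let ?G = "christoffel (GG c) (cmap c ?q)"
  have h': "velocity A \<gamma> (\<phi> t) \<in> horizontal A g F ?q" "\<xi> (\<phi> t) \<in> vertical A F ?q"
    "((\<lambda>s. comp c (\<gamma> s) (\<xi> s)) has_vector_derivative (?w - ?G (velocity A \<gamma> (\<phi> t)) (\<xi> (\<phi> t)))) (at (\<phi> t) within {0..1})"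
    using h[OF \<phi>(2)[of t]] unfolding hol_at_def has_covariant_derivative_def Let_def c_def by auto
  have "((\<lambda>s. comp c (\<gamma> s) (\<xi> s)) \<circ> \<phi> has_vector_derivative r *\<^sub>R (?w - ?G (velocity A \<gamma> (\<phi> t)) (\<xi> (\<phi> t)))) (at t within {0..1})"
    by (rule vector_diff_chain_within[OF has_vector_derivative_at_within[OF r] has_vector_derivative_within_subset[OF h'(3)]])
      (use \<phi>(2) in auto)
  then have "((\<lambda>s. comp c (\<gamma> (\<phi> s)) (\<xi> (\<phi> s))) has_vector_derivative
      (r *\<^sub>R ?w - ?G (r *\<^sub>R velocity A \<gamma> (\<phi> t)) (\<xi> (\<phi> t)))) (at t within {0..1})"
    by (simp add: o_def scaleR_diff_right C.Gam_lin x)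
  then show ?thesis
    using holonomy_rhs_scale[OF h'(1,2), of r] h'(2)
    unfolding hol_at_def has_covariant_derivative_def Let_def vel c_def[symmetric] by simp
qed

text \<open>Each curve is run through a smooth step, so that near the junction both halves rest at
  the common point with the common vector.\<close>

lemma transport_trans:
  assumes "transport p \<xi> q \<eta>" "transport q \<eta> r \<zeta>" shows "transport p \<xi> r \<zeta>"
proof -
  obtain \<gamma>1 X1 where 1: "smooth_curve A \<gamma>1" "\<And>t. t \<in> {0..1} \<Longrightarrow> hol_at \<gamma>1 X1 t"
     "\<gamma>1 0 = p" "X1 0 = \<xi>" "\<gamma>1 1 = q" "X1 1 = \<eta>" using assms(1) unfolding transport_def by blast
  obtain \<gamma>2 X2 where 2: "smooth_curve A \<gamma>2" "\<And>t. t \<in> {0..1} \<Longrightarrow> hol_at \<gamma>2 X2 t"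
     "\<gamma>2 0 = q" "X2 0 = \<eta>" "\<gamma>2 1 = r" "X2 1 = \<zeta>" using assms(2) unfolding transport_def by blast
  obtain s :: "real \<Rightarrow> real" where s: "smooth_on UNIV s" "\<And>t. s t \<in> {0..1}"
    "\<And>t. t \<le> 1/4 \<Longrightarrow> s t = 0" "\<And>t. t \<ge> 3/4 \<Longrightarrow> s t = 1" using smooth_step_exists by blast
  define \<phi>1 where "\<phi>1 t = s (2 * t)" for t
  define \<phi>2 where "\<phi>2 t = s (2 * t - 1)" for t
  have \<phi>s: "smooth_on UNIV \<phi>1" "smooth_on UNIV \<phi>2"
    unfolding \<phi>1_def \<phi>2_def by (rule smooth_on_compose[OF open_UNIV open_UNIV s(1)]; auto intro!: smooth_intros)+
  have \<phi>r: "\<phi>1 t \<in> {0..1}" "\<phi>2 t \<in> {0..1}" for t by (simp_all only: \<phi>1_def \<phi>2_def s(2))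
  define \<gamma> where "\<gamma> t = (if t \<le> 1/2 then \<gamma>1 (\<phi>1 t) else \<gamma>2 (\<phi>2 t))" for t
  define X where "X t = (if t \<le> 1/2 then X1 (\<phi>1 t) else X2 (\<phi>2 t))" for t
  \<comment> \<open>\<open>\<phi>1\<close> equals 1 from time 3/8 on and \<open>\<phi>2\<close>
    equals 0 up to time 5/8. On the overlap both descriptions are therefore constant and
    agree.\<close>
  let ?W1 = "{..<5/8::real}" and ?W2 = "{(3/8::real)<..}"
  have eq1: "\<gamma>1 (\<phi>1 t) = \<gamma> t" "X1 (\<phi>1 t) = X t" if "t \<in> ?W1" for t
  proof -
    have "\<phi>1 t = 1 \<and> \<phi>2 t = 0" if "\<not> t \<le> 1/2"
      using that \<open>t \<in> ?W1\<close> by (simp add: \<phi>1_def \<phi>2_def s(3,4))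
    then show "\<gamma>1 (\<phi>1 t) = \<gamma> t" "X1 (\<phi>1 t) = X t"
      by (cases "t \<le> 1/2"; simp add: \<gamma>_def X_def 1(5,6) 2(3,4))+
  qed
  have eq2: "\<gamma>2 (\<phi>2 t) = \<gamma> t" "X2 (\<phi>2 t) = X t" if "t \<in> ?W2" for t
  proof -
    have "\<phi>1 t = 1 \<and> \<phi>2 t = 0" if "t \<le> 1/2"
      using that \<open>t \<in> ?W2\<close> by (simp add: \<phi>1_def \<phi>2_def s(3,4))
    then show "\<gamma>2 (\<phi>2 t) = \<gamma> t" "X2 (\<phi>2 t) = X t"
      by (cases "t \<le> 1/2"; simp add: \<gamma>_def X_def 1(5,6) 2(3,4))+
  qed
  have W: "t \<in> ?W1 \<or> t \<in> ?W2" for t by auto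
  have "hol_at \<gamma> X t" for t
    using W[of t]
  proof
    assume "t \<in> ?W1"
    from hol_at_cong[OF open_lessThan this eq1 hol_at_reparam[OF 1(1,2) \<phi>s(1) \<phi>r(1)]] show ?thesis .
  next
    assume "t \<in> ?W2"
    from hol_at_cong[OF open_greaterThan this eq2 hol_at_reparam[OF 2(1,2) \<phi>s(2) \<phi>r(2)]] show ?thesis .
  qed
  moreover have "smooth_curve A \<gamma>"
    unfolding smooth_curve_def
  proof (intro exI[of _ UNIV] conjI ballI)
    have "continuous_on ?W1 \<gamma>" "continuous_on ?W2 \<gamma>"
      by (rule continuous_on_eq[OF continuous_on_subset[OF smooth_curve_reparam(1)[OF 1(1) \<phi>s(1) \<phi>r(1)]] eq1(1)]; simp)
        (rule continuous_on_eq[OF continuous_on_subset[OF smooth_curve_reparam(1)[OF 2(1) \<phi>s(2) \<phi>r(2)]] eq2(1)]; simp)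
    then have "isCont \<gamma> t" for t
      using W[of t] by (auto simp: continuous_on_eq_continuous_at)
    then show "continuous_on UNIV \<gamma>" by (simp add: continuous_at_imp_continuous_on)
    fix c assume c: "c \<in> A"
    have oc: "open (cdom c)" by (rule chart_open(1)[OF is_chart[OF c]])
    show "smooth_on (UNIV \<inter> \<gamma> -` cdom c) (cmap c \<circ> \<gamma>)"
    proof (rule smooth_on_local)
      fix t assume t: "t \<in> UNIV \<inter> \<gamma> -` cdom c"
      have loc: "\<exists>U. open U \<and> t \<in> U \<and> smooth_on U (cmap c \<circ> \<gamma>)"
        if \<gamma>': "smooth_curve A \<gamma>'" "smooth_on UNIV \<phi>" "\<And>t. \<phi> t \<in> {0..1}" and W: "open W" "t \<in> W"
          and eq: "\<And>t. t \<in> W \<Longrightarrow> \<gamma>' (\<phi> t) = \<gamma> t" for \<gamma>' \<phi> W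
      proof -
        let ?U = "W \<inter> (\<lambda>t. \<gamma>' (\<phi> t)) -` cdom c"
        have o: "open ?U"
          using continuous_on_open_vimage[OF open_UNIV] smooth_curve_reparam(1)[OF \<gamma>'] oc W(1) by auto
        have "smooth_on ?U (\<lambda>t. cmap c (\<gamma>' (\<phi> t)))"
          by (rule smooth_on_subset[OF smooth_curve_reparam(2)[OF \<gamma>' c]]) simp
        then have "smooth_on ?U (cmap c \<circ> \<gamma>)"
          by (rule smooth_on_cong[OF _ o]) (simp add: eq)
        moreover have "t \<in> ?U" using t W(2) eq by simp
        ultimately show ?thesis using o by blast
      qed
      show "\<exists>U. open U \<and> t \<in> U \<and> smooth_on U (cmap c \<circ> \<gamma>)"
        using W[of t] loc[OF 1(1) \<phi>s(1) \<phi>r(1) open_lessThan _ eq1(1)]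
          loc[OF 2(1) \<phi>s(2) \<phi>r(2) open_greaterThan _ eq2(1)] by blast
    qed
  qed auto
  moreover have "\<gamma> 0 = p" "X 0 = \<xi>" "\<gamma> 1 = r" "X 1 = \<zeta>"
    using s(3)[of 0] s(4)[of 1] 1 2 by (simp_all add: \<gamma>_def X_def \<phi>1_def \<phi>2_def)
  ultimately show ?thesis unfolding transport_def by blast
qed

end

section \<open>From integral curves in coordinates to transport on the manifold\<close>

lemma integral_curve_smooth:
  fixes x :: "real \<Rightarrow> 'a::euclidean_space"
  assumes "open I" "open S" "smooth_on S V" "\<And>t. t \<in> I \<Longrightarrow> x t \<in> S"
    and x: "\<And>t. t \<in> I \<Longrightarrow> (x has_vector_derivative V (x t)) (at t)"
  shows "smooth_on I x"
proof (rule smooth_onI)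
  show "Ck_on n I x" for n
  \<comment> \<open>Bootstrapping: the velocity \<open>V (x t)\<close> is as regular as
    \<open>x\<close> itself.\<close>
  proof (induction n)
    case 0
    show ?case
      using x by (auto intro!: continuous_at_imp_continuous_on has_vector_derivative_continuous)
  next
    case (Suc n)
    show ?case
    proof (rule Ck_on_SucI[OF assms(1)])
      show "(x has_derivative (\<lambda>h. h *\<^sub>R V (x t))) (at t)" if "t \<in> I" for t
        using x[OF that] by (simp add: has_vector_derivative_def)
      show "Ck_on n I (\<lambda>t. h *\<^sub>R V (x t))" for h
        by (rule Ck_on_bounded_linear[OF assms(1) bounded_linear_scaleR_right
              Ck_on_compose[OF assms(2,1) smooth_onD[OF assms(3)] Suc assms(4)]])
    qed
  qed
qed

lemma inner_product_Cauchy_Schwarz: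
  assumes B: "inner_product B" shows "(B u v)\<^sup>2 \<le> B u u * B v v"
proof (cases "v = 0")
  case True
  then show ?thesis using linear_0[OF inner_product_linear(1)[OF B]] by simp
next
  case False
  have bil: "bilinear B" and sym: "B v u = B u v" and p: "B v v > 0"
    using B False unfolding inner_product_def by blast+
  note lin = bilinear_lsub[OF bil] bilinear_rsub[OF bil] bilinear_lmul[OF bil] bilinear_rmul[OF bil]
  let ?t = "B u v / B v v"
  have nn: "B w w \<ge> 0" for w
    using B linear_0[OF inner_product_linear(1)[OF B]] unfolding inner_product_def by (metis less_eq_real_def)
  have "0 \<le> B (u - ?t *\<^sub>R v) (u - ?t *\<^sub>R v)" by (rule nn)
  also have "\<dots> = B u u - (B u v)\<^sup>2 / B v v"
    using p by (simp add: lin sym power2_eq_square field_simps)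
  finally show ?thesis using p by (simp add: field_simps)
qed

text \<open>With one constant near \<open>x0\<close>, bounded lengths force bounded coordinate
  vectors, so a maximising sequence of vectors has a convergent subsequence.\<close>

lemma (in metric_patch) uniformly_coercive:
  assumes x0: "x0 \<in> S"
  shows "\<exists>c>0. \<forall>\<^sub>F x in nhds x0. x \<in> S \<and> (\<forall>w. c * (norm w)\<^sup>2 \<le> G x w w)"
proof -
  obtain c where c: "c > 0" "\<And>w. c * (norm w)\<^sup>2 \<le> G x0 w w" using inner_product_coercive[OF ip[OF x0]] by blast
  define e where "e x = (\<Sum>i\<in>Basis. \<Sum>j\<in>Basis. \<bar>G x0 i j - G x i j\<bar>)" for x
  have "isCont e x0" unfolding e_def
    using G_smooth[THEN smooth_on_continuous] open_S x0
    by (intro continuous_intros) (auto simp: continuous_on_eq_continuous_at)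
  then have "(e \<longlongrightarrow> e x0) (nhds x0)" by (simp add: continuous_at tendsto_at_iff_tendsto_nhds isCont_def)
  moreover have "e x0 < c / 2" using c by (simp add: e_def)
  ultimately have "\<forall>\<^sub>F x in nhds x0. e x < c / 2" by (rule order_tendstoD)
  moreover have "\<forall>\<^sub>F x in nhds x0. x \<in> S" using open_S x0 by (rule eventually_nhds_in_open)
  ultimately have "\<forall>\<^sub>F x in nhds x0. x \<in> S \<and> (\<forall>w. c / 2 * (norm w)\<^sup>2 \<le> G x w w)"
  proof eventually_elim
    case (elim x)
    have bil: "bilinear (\<lambda>u v. G x0 u v - G x u v)"
      using G_bil[OF x0] G_bil[OF elim(2)] unfolding bilinear_def by (auto intro: linear_compose_sub)
    have "c / 2 * (norm w)\<^sup>2 \<le> G x w w" for w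
    proof -
      have "\<bar>G x0 w w - G x w w\<bar> \<le> e x * (norm w)\<^sup>2"
        using bilinear_norm_le_Basis[OF bil, of w w] by (simp add: e_def power2_eq_square mult.assoc)
      also have "\<dots> \<le> c / 2 * (norm w)\<^sup>2" using elim(1) by (intro mult_right_mono) auto
      finally show ?thesis using c(2)[of w] by linarith
    qed
    then show ?case using elim by blast
  qed
  then show ?thesis using c(1) by (intro exI[of _ "c / 2"]) simp
qed

context foliated_patch
begin

text \<open>Adding the Christoffel term to \<xi>' = dX(\<xi>) gives \<open>T \<beta>\<close> applied
  to \<xi>, which is the holonomy equation by \<open>holonomy_rhs\<close>. The base curve lives on
  an open \<open>I\<close> because a smooth curve on [0,1] requires an extension.\<close>

lemma local_move:
  assumes I: "open I" "{0..1} \<subseteq> I" and xS: "\<And>t. t \<in> I \<Longrightarrow> x t \<in> S"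
    and x: "\<And>t. t \<in> I \<Longrightarrow> (x has_vector_derivative P.lift (x t) \<beta>) (at t)"
    and v: "\<And>t. t \<in> {0..1} \<Longrightarrow> P.vert (x t) (\<xi> t)"
    and \<xi>: "\<And>t. t \<in> {0..1} \<Longrightarrow> (\<xi> has_vector_derivative fd (\<lambda>y. P.lift y \<beta>) (x t) (\<xi> t)) (at t within {0..1})"
  shows "transport (cinv c (x 0)) (vec c (cinv c (x 0)) (\<xi> 0)) (cinv c (x 1)) (vec c (cinv c (x 1)) (\<xi> 1))"
proof -
  define \<gamma> where "\<gamma> t = cinv c (x t)" for t
  define X where "X t = vec c (\<gamma> t) (\<xi> t)" for t
  have xs: "smooth_on I x" by (rule integral_curve_smooth[OF I(1) P.open_S P.lift_smooth xS x])
  have \<gamma>U: "\<gamma> t \<in> U" "cmap c (\<gamma> t) = x t" "\<gamma> t \<in> cdom c" if "t \<in> I" for t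
    using S_D[OF xS[OF that]] Uc by (auto simp: \<gamma>_def)
  have \<gamma>c: "continuous_on I \<gamma>"
    unfolding \<gamma>_def using S_D(3) xS
    by (intro continuous_on_compose2[OF chart_continuous(2)[OF cchart] smooth_on_continuous[OF xs]]) auto
  have "smooth_curve A \<gamma>" unfolding smooth_curve_def
  proof (intro exI[of _ I] conjI ballI I \<gamma>c)
    fix d assume d: "d \<in> A"
    interpret cd: chart_pair c d by (rule pair[OF cA d])
    have o: "open (I \<inter> \<gamma> -` cdom d)" by (rule continuous_open_preimage[OF \<gamma>c I(1) chart_open(1)[OF cd.d]])
    have "smooth_on (I \<inter> \<gamma> -` cdom d) (\<lambda>t. (cmap d \<circ> cinv c) (x t))"
    proof (rule smooth_on_compose[OF cd.open_overlap o cd.smooth_tr smooth_on_subset[OF xs]])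
      show "x t \<in> cd.overlap" if "t \<in> I \<inter> \<gamma> -` cdom d" for t
        using cd.mem_overlap[of "\<gamma> t"] \<gamma>U[of t] that by simp
    qed simp
    then show "smooth_on (I \<inter> \<gamma> -` cdom d) (cmap d \<circ> \<gamma>)" by (simp add: o_def \<gamma>_def)
  qed
  moreover have "hol_at \<gamma> X t" if t: "t \<in> {0..1}" for t
  proof -
    have tI: "t \<in> I" using t I(2) by blast
    note xt = xS[OF tI] and gU = \<gamma>U[OF tI]
    have ct: "isCont \<gamma> t" using \<gamma>c I(1) tI by (simp add: continuous_on_eq_continuous_at)
    have dx: "((cmap c \<circ> \<gamma>) has_vector_derivative P.lift (x t) \<beta>) (at t)"
      using x[OF tI] unfolding has_vector_derivative_def
      by (rule has_derivative_transform_within_open[OF _ I(1) tI]) (simp add: \<gamma>U)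
    have vel: "velocity A \<gamma> t = vec c (\<gamma> t) (P.lift (x t) \<beta>)"
      by (rule velocity_chart(1)[OF cA gU(3) ct dx])
    have hv: "velocity A \<gamma> t \<in> horizontal A g F (\<gamma> t)"
      unfolding vel using hor_vec[OF gU(1)] P.lift_hor[OF xt] gU(2) by simp
    have vX: "X t \<in> vertical A F (\<gamma> t)"
      unfolding X_def using vert_vec[OF gU(1)] v[OF t] gU(2) by simp
    have cX: "comp c (\<gamma> s) (X s) = \<xi> s" if "s \<in> {0..1}" for s
      using that I(2) \<gamma>U(3) cA by (auto simp: X_def)
    have d\<xi>: "((\<lambda>s. comp c (\<gamma> s) (X s)) has_vector_derivative fd (\<lambda>y. P.lift y \<beta>) (x t) (\<xi> t)) (at t within {0..1})"
      by (rule has_vector_derivative_transform[OF t cX \<xi>[OF t]])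
    have "has_covariant_derivative A g \<gamma> X (vec c (\<gamma> t) (P.T \<beta> (x t) (\<xi> t))) t"
      using covariant_derivative_chart[OF cA gU(3) ct t dx d\<xi>] P.Gam_sym[OF xt, of "P.lift (x t) \<beta>" "\<xi> t"]
      by (simp add: cX[OF t] gU(2) P.T_alt)
    moreover have "- oneill_adjoint A g F (\<gamma> t) (velocity A \<gamma> t) (X t) - shape A g F (\<gamma> t) (velocity A \<gamma> t) (X t)
        = vec c (\<gamma> t) (P.T \<beta> (x t) (\<xi> t))"
      using holonomy_rhs[OF gU(1) hv vX] gU cA P.pi_lift[OF xt] cX[OF t] by (simp add: vel)
    ultimately show ?thesis unfolding hol_at_def using hv vX by simp
  qed
  ultimately show ?thesis unfolding transport_def
    by (intro exI[of _ \<gamma>] exI[of _ X]) (simp add: \<gamma>_def X_def)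
qed

end

section \<open>Dual holonomy as a relation between vectors\<close>

context foliated_manifold
begin

text \<open>If \<open>h\<close> is the holonomy map of a curve from \<open>p\<close> to \<open>q\<close>, then \<open>\<nu>\<close> and \<open>\<nu>'\<close> are related when
  \<open>\<nu>'\<close> is the image of \<open>\<nu>\<close> under the inverse adjoint of \<open>h\<close>, i.e. the value of a dual holonomy field.\<close>

definition dual_related :: "'m \<Rightarrow> 'e \<Rightarrow> 'm \<Rightarrow> 'e \<Rightarrow> bool" where
  "dual_related p \<nu> q \<nu>' \<longleftrightarrow>
     (\<forall>\<eta>\<in>vertical A F q. \<exists>\<xi>\<in>vertical A F p. transport q \<eta> p \<xi> \<and> g p \<nu> \<xi> = g q \<nu>' \<eta>)"

lemma dual_related_trans:
  "dual_related p \<nu> q \<nu>' \<Longrightarrow> dual_related q \<nu>' r \<nu>'' \<Longrightarrow> dual_related p \<nu> r \<nu>''"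
  unfolding dual_related_def by (metis transport_trans)

lemma transport_refl:
  assumes "\<xi> \<in> vertical A F p" shows "transport p \<xi> p \<xi>"
proof -
  obtain \<phi> U k where "foliated_patch A g F (chart_at A p) \<phi> U k" and p: "p \<in> U"
    using foliated_patch_exists[OF chart_at] .
  then interpret foliated_patch A g F "chart_at A p" \<phi> U k by simp
  let ?x = "cmap (chart_at A p) p"
  note x = S_mem[OF p]
  have [simp]: "cinv (chart_at A p) ?x = p" using cchart chart_at by simp
  have e: "P.lift y 0 = 0" if "y \<in> S" for y using P.lift_simps(4) that .
  have "fd (\<lambda>y. P.lift y 0) ?x = fd (\<lambda>y. 0) ?x" by (rule fd_cong[OF P.open_S x e])
  then have "fd (\<lambda>y. P.lift y 0) ?x v = 0" for v by simp
  \<comment> \<open>A constant curve is an integral curve of the basic field over 0, and constant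
    components solve the holonomy equation along it.\<close>
  then have "transport (cinv (chart_at A p) ?x) (vec (chart_at A p) (cinv (chart_at A p) ?x) \<xi>)
     (cinv (chart_at A p) ?x) (vec (chart_at A p) (cinv (chart_at A p) ?x) \<xi>)"
    using vert_iff[OF p, of \<xi>] assms comp_chart_at[of p \<xi>]
    by (intro local_move[where x="\<lambda>_. ?x" and \<xi>="\<lambda>_. \<xi>" and I=UNIV and \<beta>=0]) (auto simp: x e)
  then show ?thesis by (simp add: vec_chart_at)
qed

lemma dual_related_refl: "dual_related p \<nu> p \<nu>"
  unfolding dual_related_def using transport_refl by blast

text \<open>Carry \<nu>' itself back to a vector \<xi>, whose length is at most L times that of
  \<nu>'. The squared length of \<nu>' equals the product of \<nu> and \<xi>, so Cauchy-Schwarz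
  bounds \<nu>' by L times \<nu>.\<close>

lemma dual_related_bound:
  assumes L: "\<And>p \<xi> q \<eta>. transport p \<xi> q \<eta> \<Longrightarrow> sqrt (g q \<eta> \<eta>) \<le> L * sqrt (g p \<xi> \<xi>)"
    and r: "dual_related p \<nu> q \<nu>'" and v: "\<nu>' \<in> vertical A F q"
  shows "g q \<nu>' \<nu>' \<le> L\<^sup>2 * g p \<nu> \<nu>"
proof -
  obtain \<xi> where \<xi>: "transport q \<nu>' p \<xi>" "g p \<nu> \<xi> = g q \<nu>' \<nu>'"
    using r v unfolding dual_related_def by blast
  have nn: "g p u u \<ge> 0" for p u using g_pos[of u p] by (cases "u = 0") (auto simp: g_lin)
  let ?a = "g q \<nu>' \<nu>'"
  have "g p \<xi> \<xi> \<le> L\<^sup>2 * ?a"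
  proof -
    have "(sqrt (g p \<xi> \<xi>))\<^sup>2 \<le> (L * sqrt ?a)\<^sup>2" using L[OF \<xi>(1)] nn by (intro power_mono) auto
    then show ?thesis using nn by (simp add: power_mult_distrib)
  qed
  moreover have "?a\<^sup>2 \<le> g p \<nu> \<nu> * g p \<xi> \<xi>"
    using inner_product_Cauchy_Schwarz[OF g_ip, of p \<nu> \<xi>] \<xi>(2) by simp
  ultimately have "?a * ?a \<le> (L\<^sup>2 * g p \<nu> \<nu>) * ?a"
    using mult_left_mono[of "g p \<xi> \<xi>" "L\<^sup>2 * ?a" "g p \<nu> \<nu>"] nn by (simp add: power2_eq_square mult_ac)
  then show ?thesis using nn[of q \<nu>'] nn[of p \<nu>] by (cases "?a = 0") auto
qed

end

section \<open>Dual fields along the flows of basic fields\<close>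

context foliated_patch
begin

lemma fd_lift_scale:
  assumes x: "x \<in> S" shows "fd (\<lambda>y. P.lift y (r *\<^sub>R \<beta>)) x v = r *\<^sub>R fd (\<lambda>y. P.lift y \<beta>) x v"
  using linear_cmul[OF linear_fd_family[OF P.open_S x P.lift_linear P.lift_diff[OF x]]] .

text \<open>Given a vertical vector at the end of the flow line, a holonomy field starting from it
  is solved along the line run backwards. Its product with the dual field is constant, and this is
  the pairing condition of \<open>dual_related\<close>.\<close>

lemma dual_flow_related:
  assumes \<delta>: "\<delta> > 0" and M: "M > 0" "\<delta> * M \<le> 1 / 2"
    and zS: "\<And>t. t \<in> {-3*\<delta><..<3*\<delta>} \<Longrightarrow> fst (z t) \<in> S"
    and zM: "\<And>t v. t \<in> {-3*\<delta><..<3*\<delta>} \<Longrightarrow> norm (fd (\<lambda>y. P.lift y \<beta>) (fst (z t)) v) \<le> M * norm v"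
    and z: "\<And>t. t \<in> {-3*\<delta><..<3*\<delta>} \<Longrightarrow> (z has_vector_derivative P.dual_vf \<beta> (z t)) (at t)"
    and zv: "\<And>t. t \<in> {-3*\<delta><..<3*\<delta>} \<Longrightarrow> P.vert (fst (z t)) (snd (z t))"
  shows "dual_related (cinv c (fst (z 0))) (vec c (cinv c (fst (z 0))) (snd (z 0)))
     (cinv c (fst (z \<delta>))) (vec c (cinv c (fst (z \<delta>))) (snd (z \<delta>)))"
  unfolding dual_related_def
proof
  let ?J = "{-3*\<delta><..<3*\<delta>}"
  let ?D = "\<lambda>y. fd (\<lambda>y. P.lift y \<beta>) y"
  define q where "q = cinv c (fst (z \<delta>))"
  define p where "p = cinv c (fst (z 0))"
  have J: "\<delta> \<in> ?J" "0 \<in> ?J" using \<delta> by auto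
  have qU: "q \<in> U" "cmap c q = fst (z \<delta>)" and pU: "p \<in> U" "cmap c p = fst (z 0)"
    using S_D[OF zS[OF J(1)]] S_D[OF zS[OF J(2)]] by (auto simp: q_def p_def)
  have qc: "q \<in> cdom c" "p \<in> cdom c" using qU pU Uc by auto
  fix \<eta>' assume "\<eta>' \<in> vertical A F (cinv c (fst (z \<delta>)))"
  then have \<eta>': "\<eta>' \<in> vertical A F q" by (simp add: q_def)
  define \<eta> where "\<eta> = comp c q \<eta>'"
  have v\<eta>: "P.vert (fst (z \<delta>)) \<eta>" using \<eta>' vert_iff[OF qU(1)] qU(2) by (simp add: \<eta>_def)
  have zc: "continuous_on ?J z"
    by (intro continuous_at_imp_continuous_on ballI has_vector_derivative_continuous[OF z])
  have Dlin: "y \<in> S \<Longrightarrow> linear (?D y)" for y using fd_linear[OF P.lift_diff] .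
  have Dc: "continuous_on P.\<Omega> (\<lambda>w. ?D (fst w) (snd w))"
    by (intro smooth_on_continuous smooth_on_family_snd[where L="?D"] P.open_S Dlin smooth_on_fd_const P.lift_smooth)
  have "\<exists>u. u 0 = \<eta> \<and> (\<forall>s\<in>{-\<delta>..\<delta>}. u s \<in> cball \<eta> (norm \<eta>) \<and>
      (u has_vector_derivative - ?D (fst (z (\<delta> - s))) (u s)) (at s within {-\<delta>..\<delta>}))"
  \<comment> \<open>On the ball of radius \<open>norm \<eta>\<close> around \<open>\<eta>\<close>
    vectors have length at most \<open>2 * norm \<eta>\<close>. The condition
    \<open>\<delta> * M \<le> 1 / 2\<close> makes the solution stay in it up to time
    \<open>\<delta>\<close>, and also gives the contraction.\<close>
  proof (rule picard_local[where f="\<lambda>s v. - ?D (fst (z (\<delta> - s))) v" and K=M and B="M * (2 * norm \<eta>)"])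
    let ?R = "{-\<delta>..\<delta>} \<times> cball \<eta> (norm \<eta>)"
    have "continuous_on ?R (\<lambda>w. z (\<delta> - fst w))"
      by (rule continuous_on_compose2[OF zc]) (use \<delta> in \<open>auto intro!: continuous_intros\<close>)
    then have "continuous_on ?R (\<lambda>w. (fst (z (\<delta> - fst w)), snd w))"
      by (intro continuous_intros)
    then have "continuous_on ?R (\<lambda>w. - ?D (fst (fst (z (\<delta> - fst w)), snd w)) (snd (fst (z (\<delta> - fst w)), snd w)))"
      by (rule continuous_on_minus[OF continuous_on_compose2[OF Dc]]) (use zS \<delta> in auto)
    then show "continuous_on ({-\<delta>..\<delta>} \<times> cball \<eta> (norm \<eta>)) (\<lambda>(s, v). - ?D (fst (z (\<delta> - s))) v)"
      by (simp add: split_beta')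
    show "norm (- ?D (fst (z (\<delta> - s))) v) \<le> M * (2 * norm \<eta>)" if "s \<in> {-\<delta>..\<delta>}" "v \<in> cball \<eta> (norm \<eta>)" for s v
    proof -
      have "norm v \<le> 2 * norm \<eta>"
        using that(2) norm_triangle_ineq2[of v \<eta>] by (simp add: dist_norm norm_minus_commute)
      then have "M * norm v \<le> M * (2 * norm \<eta>)" using M(1) by (intro mult_left_mono) auto
      then show ?thesis using zM[of "\<delta> - s" v] that(1) \<delta> by simp
    qed
    show "\<delta> * (M * (2 * norm \<eta>)) \<le> norm \<eta>"
      using mult_right_mono[OF M(2), of "2 * norm \<eta>"] by (simp add: mult.assoc)
    show "norm (- ?D (fst (z (\<delta> - s))) v - - ?D (fst (z (\<delta> - s))) w) \<le> M * norm (v - w)" if "s \<in> {-\<delta>..\<delta>}" for s v w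
    proof -
      have s: "\<delta> - s \<in> ?J" using that \<delta> by auto
      have "- ?D (fst (z (\<delta> - s))) v - - ?D (fst (z (\<delta> - s))) w = - ?D (fst (z (\<delta> - s))) (v - w)"
        using linear_diff[OF Dlin[OF zS[OF s]]] by simp
      then show ?thesis using zM[OF s, of "v - w"] by simp
    qed
  qed (use \<delta> M in auto)
  then obtain u where u0: "u 0 = \<eta>"
    and u: "\<And>s. s \<in> {-\<delta>..\<delta>} \<Longrightarrow> (u has_vector_derivative - ?D (fst (z (\<delta> - s))) (u s)) (at s within {-\<delta>..\<delta>})" by blast
  \<comment> \<open>Time is reversed and rescaled to [0,1], so the velocity is the lift of
    \<open>- \<delta> *\<^sub>R \<beta>\<close>.\<close>
  define x where "x t = fst (z (\<delta> - \<delta> * t))" for t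
  define n where "n t = snd (z (\<delta> - \<delta> * t))" for t
  define \<xi> where "\<xi> t = u (\<delta> * t)" for t
  \<comment> \<open>For \<open>t\<close> in \<open>?I\<close> the flow time lies between
    \<open>- \<delta>\<close> and \<open>2 * \<delta>\<close>, hence inside
    \<open>?J\<close>.\<close>
  let ?I = "{-1<..<2::real}"
  have tJ: "\<delta> - \<delta> * t \<in> ?J" if "t \<in> ?I" for t
  proof -
    have "\<delta> * t < \<delta> * 2" by (rule mult_strict_left_mono) (use that \<delta> in auto)
    moreover have "\<delta> * (-1) < \<delta> * t" by (rule mult_strict_left_mono) (use that \<delta> in auto)
    ultimately show ?thesis using \<delta> by auto
  qed
  have xS: "x t \<in> S" if "t \<in> ?I" for t using zS[OF tJ[OF that]] by (simp add: x_def)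
  have dz: "((\<lambda>t. z (\<delta> - \<delta> * t)) has_vector_derivative - \<delta> *\<^sub>R P.dual_vf \<beta> (z (\<delta> - \<delta> * t))) (at t)" if "t \<in> ?I" for t
  proof -
    have 1: "((\<lambda>t. \<delta> - \<delta> * t) has_vector_derivative - \<delta>) (at t)"
      by (auto intro!: derivative_eq_intros simp: has_real_derivative_iff_has_vector_derivative[symmetric])
    show ?thesis using vector_diff_chain_at[OF 1 z[OF tJ[OF that]]] by (simp add: o_def)
  qed
  have dx: "(x has_vector_derivative - \<delta> *\<^sub>R P.lift (x t) \<beta>) (at t)" if "t \<in> ?I" for t
    using has_derivative_fst[OF dz[OF that, unfolded has_vector_derivative_def]]
    unfolding has_vector_derivative_def x_def by (simp add: P.dual_vf_def)
  have dn: "(n has_vector_derivative - \<delta> *\<^sub>R P.dual_rhs \<beta> (x t) (n t)) (at t)" if "t \<in> ?I" for t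
    using has_derivative_snd[OF dz[OF that, unfolded has_vector_derivative_def]]
    unfolding has_vector_derivative_def x_def n_def by (simp add: P.dual_vf_def)
  have d\<xi>: "(\<xi> has_vector_derivative - \<delta> *\<^sub>R ?D (x t) (\<xi> t)) (at t within {0..1})" if t: "t \<in> {0..1}" for t
  proof -
    have 1: "((\<lambda>t. \<delta> * t) has_vector_derivative \<delta>) (at t within {0..1})"
      by (auto intro!: derivative_eq_intros simp: has_real_derivative_iff_has_vector_derivative[symmetric])
    have im: "(\<lambda>t. \<delta> * t) ` {0..1} \<subseteq> {-\<delta>..\<delta>}"
      using \<delta> mult_left_le by (auto intro: order_trans[of "- \<delta>" 0])
    then have "\<delta> * t \<in> {-\<delta>..\<delta>}" using t by blast
    from vector_diff_chain_within[OF 1 has_vector_derivative_within_subset[OF u[OF this] im]]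
    show ?thesis by (simp add: o_def \<xi>_def[abs_def] x_def)
  qed
  have sub: "{0..1} \<subseteq> ?I" by auto
  have v\<xi>: "P.vert (x t) (\<xi> t)" if t: "t \<in> {0..1}" for t
  proof (rule P.vertical_transport_const[where A="{0..1}" and a=0 and r="-\<delta>" and \<beta>=\<beta> and q="\<lambda>_. 0"])
    show "P.vert (x 0) (\<xi> 0)" using v\<eta> by (simp add: x_def \<xi>_def u0)
    show "(x has_vector_derivative - \<delta> *\<^sub>R P.lift (x t) \<beta>) (at t within {0..1})" if "t \<in> {0..1}" for t
      by (rule has_vector_derivative_at_within[OF dx]) (use that in auto)
  qed (use t d\<xi> xS P.pi_simps(4) in auto)
  have "transport (cinv c (x 0)) (vec c (cinv c (x 0)) (\<xi> 0)) (cinv c (x 1)) (vec c (cinv c (x 1)) (\<xi> 1))"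
  proof (rule local_move[where \<beta>="- \<delta> *\<^sub>R \<beta>" and I="?I"])
    show "(x has_vector_derivative P.lift (x t) (- \<delta> *\<^sub>R \<beta>)) (at t)" if "t \<in> ?I" for t
      using dx[OF that] P.lift_simps(3)[OF xS[OF that], of "- \<delta>" \<beta>] by simp
    show "(\<xi> has_vector_derivative fd (\<lambda>y. P.lift y (- \<delta> *\<^sub>R \<beta>)) (x t) (\<xi> t)) (at t within {0..1})" if "t \<in> {0..1}" for t
      using d\<xi>[OF that] fd_lift_scale[OF xS, of t "- \<delta>" \<beta>] that by auto
  qed (use xS v\<xi> sub in auto)
  then have tr: "transport q \<eta>' p (vec c p (\<xi> 1))"
    using cA qc by (simp add: x_def \<xi>_def u0 q_def[symmetric] p_def[symmetric] \<eta>_def)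
  have vn: "P.vert (x t) (n t)" if "t \<in> {0..1}" for t
    using zv[OF tJ] that by (auto simp: x_def n_def)
  have "((\<lambda>t. GG c (x t) (n t) (\<xi> t)) has_derivative (\<lambda>h. 0)) (at t within {0..1})" if t: "t \<in> {0..1}" for t
    by (rule P.dual_pairing[where r="-\<delta>" and \<beta>=\<beta>, OF _ has_vector_derivative_at_within[OF dx]
          has_vector_derivative_at_within[OF dn] d\<xi>[OF t] vn[OF t] v\<xi>[OF t]]) (use t xS in auto)
  from has_derivative_zero_unique[OF _ this, of 0 1]
  have "GG c (x 1) (n 1) (\<xi> 1) = GG c (x 0) (n 0) (\<xi> 0)" by simp
  then have "g p (vec c p (snd (z 0))) (vec c p (\<xi> 1)) = g q (vec c q (snd (z \<delta>))) \<eta>'"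
    using g_vec[OF pU(1), of "snd (z 0)" "\<xi> 1"] g_vec[OF qU(1), of "snd (z \<delta>)" \<eta>] pU(2) qU(2) cA qc
    by (simp add: x_def n_def \<xi>_def u0 \<eta>_def)
  moreover have "vec c p (\<xi> 1) \<in> vertical A F p"
    using vert_vec[OF pU(1), of "\<xi> 1"] v\<xi>[of 1] pU(2) by (simp add: x_def)
  ultimately show "\<exists>\<xi>\<in>vertical A F (cinv c (fst (z 0))). transport (cinv c (fst (z \<delta>))) \<eta>' (cinv c (fst (z 0))) \<xi> \<and>
     g (cinv c (fst (z 0))) (vec c (cinv c (fst (z 0))) (snd (z 0))) \<xi> =
     g (cinv c (fst (z \<delta>))) (vec c (cinv c (fst (z \<delta>))) (snd (z \<delta>))) \<eta>'"
    using tr unfolding p_def[symmetric] q_def[symmetric] by blast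
qed

text \<open>\<open>Omega_flow\<close> restricted to vertical initial vectors, which stay vertical by
  \<open>vertical_transport_const\<close>; its endpoints are then dually related to the
  start.\<close>

lemma dual_flow:
  assumes x0: "x0 \<in> S" and \<epsilon>: "\<epsilon> > 0"
  obtains \<delta> r where "\<delta> > 0" "r > 0"
    "\<And>z1. dist z1 (x0, \<nu>0) < r \<Longrightarrow> P.vert (fst z1) (snd z1) \<Longrightarrow> \<exists>z. z 0 = z1 \<and>
       (\<forall>t\<in>{0..\<delta>}. dist (z t) (x0, \<nu>0) < \<epsilon> \<and> fst (z t) \<in> S \<and> P.vert (fst (z t)) (snd (z t)) \<and>
          (z has_vector_derivative P.dual_vf \<beta> (z t)) (at t)) \<and>
       dual_related (cinv c (fst z1)) (vec c (cinv c (fst z1)) (snd z1))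
         (cinv c (fst (z \<delta>))) (vec c (cinv c (fst (z \<delta>))) (snd (z \<delta>)))"
proof -
  obtain \<delta> r M where \<delta>: "\<delta> > 0" "r > 0" "M > 0" "\<delta> * M \<le> 1 / 2"
    and fl: "\<And>z1. dist z1 (x0, \<nu>0) < r \<Longrightarrow> \<exists>z. z 0 = z1 \<and> (\<forall>t\<in>{-3*\<delta><..<3*\<delta>}. dist (z t) (x0, \<nu>0) < \<epsilon> \<and> fst (z t) \<in> S
       \<and> (\<forall>v. norm (fd (\<lambda>y. P.lift y \<beta>) (fst (z t)) v) \<le> M * norm v) \<and> (z has_vector_derivative P.dual_vf \<beta> (z t)) (at t))"
    using P.Omega_flow[OF x0 \<epsilon>, of \<nu>0 \<beta>] by blast
  show thesis
  proof (rule that[OF \<delta>(1,2)])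
    fix z1 assume z1: "dist z1 (x0, \<nu>0) < r" "P.vert (fst z1) (snd z1)"
    let ?J = "{-3*\<delta><..<3*\<delta>}"
    obtain z where z0: "z 0 = z1" and z: "\<And>t. t \<in> ?J \<Longrightarrow> dist (z t) (x0, \<nu>0) < \<epsilon>" "\<And>t. t \<in> ?J \<Longrightarrow> fst (z t) \<in> S"
      "\<And>t v. t \<in> ?J \<Longrightarrow> norm (fd (\<lambda>y. P.lift y \<beta>) (fst (z t)) v) \<le> M * norm v"
      "\<And>t. t \<in> ?J \<Longrightarrow> (z has_vector_derivative P.dual_vf \<beta> (z t)) (at t)"
      using fl[OF z1(1)] by blast
    have vert: "P.vert (fst (z t)) (snd (z t))" if t: "t \<in> ?J" for t
    proof (rule P.vertical_transport_const[where A="?J" and a=0 and r=1 and \<beta>=\<beta>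
          and q="\<lambda>t. - 2 *\<^sub>R P.Q (fst (z t)) (P.T \<beta> (fst (z t)) (snd (z t)))"])
      show "((\<lambda>t. fst (z t)) has_vector_derivative 1 *\<^sub>R P.lift (fst (z t)) \<beta>) (at t within ?J)" if "t \<in> ?J" for t
        using has_derivative_fst[OF has_vector_derivative_at_within[OF z(4)[OF that], unfolded has_vector_derivative_def]]
        by (simp add: has_vector_derivative_def P.dual_vf_def)
      show "((\<lambda>t. snd (z t)) has_vector_derivative 1 *\<^sub>R fd (\<lambda>y. P.lift y \<beta>) (fst (z t)) (snd (z t))
          + - 2 *\<^sub>R P.Q (fst (z t)) (P.T \<beta> (fst (z t)) (snd (z t)))) (at t within ?J)" if "t \<in> ?J" for t
        using has_derivative_snd[OF has_vector_derivative_at_within[OF z(4)[OF that], unfolded has_vector_derivative_def]]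
        by (simp add: has_vector_derivative_def P.dual_vf_def P.dual_rhs_def)
      show "P.vert (fst (z t)) (- 2 *\<^sub>R P.Q (fst (z t)) (P.T \<beta> (fst (z t)) (snd (z t))))" if "t \<in> ?J" for t
        using P.Q_vert[OF z(2)[OF that]] by (simp add: P.pi_simps z(2)[OF that])
    qed (use t \<delta>(1) z0 z1 z(2) in auto)
    have "dual_related (cinv c (fst (z 0))) (vec c (cinv c (fst (z 0))) (snd (z 0)))
         (cinv c (fst (z \<delta>))) (vec c (cinv c (fst (z \<delta>))) (snd (z \<delta>)))"
      by (rule dual_flow_related[OF \<delta>(1,3,4) z(2,3,4) vert])
    then show "\<exists>z. z 0 = z1 \<and>
       (\<forall>t\<in>{0..\<delta>}. dist (z t) (x0, \<nu>0) < \<epsilon> \<and> fst (z t) \<in> S \<and> P.vert (fst (z t)) (snd (z t)) \<and>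
          (z has_vector_derivative P.dual_vf \<beta> (z t)) (at t)) \<and>
       dual_related (cinv c (fst z1)) (vec c (cinv c (fst z1)) (snd z1))
         (cinv c (fst (z \<delta>))) (vec c (cinv c (fst (z \<delta>))) (snd (z \<delta>)))"
      using z0 z vert \<delta>(1) by (intro exI[of _ z]) auto
  qed
qed

end

section \<open>Dual holonomy fields of maximal length\<close>

lemma second_order_growth:
  fixes h h1 h2 :: "real \<Rightarrow> real"
  assumes \<delta>: "\<delta> > 0" and h: "\<And>t. t \<in> {0..\<delta>} \<Longrightarrow> (h has_real_derivative h1 t) (at t)"
    and h1: "\<And>t. t \<in> {0..\<delta>} \<Longrightarrow> (h1 has_real_derivative h2 t) (at t)"
    and m: "\<And>t. t \<in> {0..\<delta>} \<Longrightarrow> h2 t \<ge> m"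
  shows "h \<delta> \<ge> h 0 + h1 0 * \<delta> + m * \<delta>\<^sup>2 / 2"
proof -
  let ?k = "\<lambda>t. h t - h1 0 * t - m * t\<^sup>2 / 2"
  have k: "(?k has_real_derivative (h1 t - h1 0 - m * t)) (at t)" if "t \<in> {0..\<delta>}" for t
    by (rule derivative_eq_intros h[OF that] refl | simp)+
  obtain \<tau> where \<tau>: "0 < \<tau>" "\<tau> < \<delta>" "?k \<delta> - ?k 0 = (\<delta> - 0) * (h1 \<tau> - h1 0 - m * \<tau>)"
    using MVT2[OF \<delta>, of ?k "\<lambda>t. h1 t - h1 0 - m * t"] k by auto
  obtain \<sigma> where \<sigma>: "0 < \<sigma>" "\<sigma> < \<tau>" "h1 \<tau> - h1 0 = (\<tau> - 0) * h2 \<sigma>"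
    using MVT2[OF \<tau>(1), of h1 h2] h1 \<tau>(2) by auto
  have "m * \<tau> \<le> \<tau> * h2 \<sigma>" using m[of \<sigma>] \<sigma> \<tau> by (simp add: mult.commute)
  then have "\<delta> * (h1 \<tau> - h1 0 - m * \<tau>) \<ge> 0" using \<sigma>(3) \<delta> by simp
  then show ?thesis using \<tau>(3) by simp
qed

context foliated_patch
begin

abbreviation "len z \<equiv> GG c (fst z) (snd z) (snd z)"
abbreviation "len_deriv2 \<beta> z \<equiv> fd (P.len_deriv \<beta>) z (P.dual_vf \<beta> z)"

lemma len_derivative:
  assumes "fst (z t) \<in> S" "P.vert (fst (z t)) (snd (z t))" "(z has_vector_derivative P.dual_vf \<beta> (z t)) (at t)"
  shows "((\<lambda>t. len (z t)) has_real_derivative P.len_deriv \<beta> (z t)) (at t)"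
    "((\<lambda>t. P.len_deriv \<beta> (z t)) has_real_derivative len_deriv2 \<beta> (z t)) (at t)"
proof -
  have d: "((\<lambda>t. fst (z t)) has_vector_derivative P.lift (fst (z t)) \<beta>) (at t)"
    "((\<lambda>t. snd (z t)) has_vector_derivative P.dual_rhs \<beta> (fst (z t)) (snd (z t))) (at t)"
    using has_derivative_fst[OF assms(3)[unfolded has_vector_derivative_def]]
      has_derivative_snd[OF assms(3)[unfolded has_vector_derivative_def]]
    by (simp_all add: has_vector_derivative_def P.dual_vf_def)
  show "((\<lambda>t. len (z t)) has_real_derivative P.len_deriv \<beta> (z t)) (at t)"
    using P.norm_derivative[OF assms(1) d assms(2)] by (simp add: has_real_derivative_iff_has_vector_derivative)
  have mem: "z t \<in> P.\<Omega>" using assms(1) by (auto simp: mem_Times_iff)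
  have "((\<lambda>t. P.len_deriv \<beta> (z t)) has_derivative (\<lambda>h. fd (P.len_deriv \<beta>) (z t) (h *\<^sub>R P.dual_vf \<beta> (z t)))) (at t)"
    by (rule has_derivative_compose[OF assms(3)[unfolded has_vector_derivative_def] smooth_on_works[OF P.len_deriv_smooth mem]])
  then show "((\<lambda>t. P.len_deriv \<beta> (z t)) has_real_derivative len_deriv2 \<beta> (z t)) (at t)"
    unfolding has_field_derivative_def
    by (rule has_derivative_eq_rhs)
      (simp add: fun_eq_iff linear_cmul[OF smooth_on_fd_linear[OF P.len_deriv_smooth mem]])
qed

text \<open>\<open>max\<close> bounds what can be reached from the members of the sequence and says
  nothing directly about the limit. Growth estimates for flows starting at \<open>zs n\<close> over
  a common time contradict it as n tends to infinity, unless the first derivative vanishes at the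
  limit and the second is nonpositive.\<close>

lemma extremal_curvature:
  fixes zs :: "nat \<Rightarrow> 'e \<times> 'e"
  assumes x0: "x0 \<in> S" and lim: "zs \<longlonglongrightarrow> (x0, \<nu>0)" and v: "\<And>n. P.vert (fst (zs n)) (snd (zs n))" "P.vert x0 \<nu>0"
    and max: "\<And>n q \<nu>. dual_related (cinv c (fst (zs n))) (vec c (cinv c (fst (zs n))) (snd (zs n))) q \<nu> \<Longrightarrow>
       \<nu> \<in> vertical A F q \<Longrightarrow> g q \<nu> \<nu> \<le> len (x0, \<nu>0)"
    and odd: "odd DIM('h)"
  shows "\<exists>\<beta>. \<beta> \<noteq> 0 \<and> GG c x0 (curvature (GG c) x0 \<nu>0 (P.lift x0 \<beta>) (P.lift x0 \<beta>)) \<nu>0 \<le> 0"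
proof -
  let ?z0 = "(x0, \<nu>0)"
  have z0: "?z0 \<in> P.\<Omega>" using x0 by simp
  have cont: "isCont f ?z0" if "smooth_on P.\<Omega> f" for f :: "'e \<times> 'e \<Rightarrow> real"
    using smooth_on_continuous[OF that] P.open_Omega z0 by (simp add: continuous_on_eq_continuous_at)
  have lenc: "isCont len ?z0" by (intro cont P.GG_smooth_Omega P.snd_smooth)
  have F1c: "isCont (P.len_deriv \<beta>) ?z0" for \<beta> by (intro cont P.len_deriv_smooth)
  have F2c: "isCont (len_deriv2 \<beta>) ?z0" for \<beta>
    by (intro cont smooth_on_fd P.open_Omega P.len_deriv_smooth P.dual_vf_smooth)
  have limf: "(\<lambda>n. f (zs n)) \<longlonglongrightarrow> f ?z0" if "isCont f ?z0" for f :: "'e \<times> 'e \<Rightarrow> real"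
    using isCont_tendsto_compose[OF that lim] .
  have flow: "\<exists>\<delta>>0. \<forall>\<^sub>F n in sequentially. \<exists>z. z 0 = zs n \<and> len (z \<delta>) \<le> len ?z0 \<and>
      (\<forall>t\<in>{0..\<delta>}. dist (z t) ?z0 < \<epsilon> \<and> ((\<lambda>t. len (z t)) has_real_derivative P.len_deriv \<beta> (z t)) (at t) \<and>
        ((\<lambda>t. P.len_deriv \<beta> (z t)) has_real_derivative len_deriv2 \<beta> (z t)) (at t))" if \<epsilon>: "\<epsilon> > 0" for \<epsilon> \<beta>
  proof -
    obtain \<delta> r where \<delta>: "\<delta> > 0" "r > 0" and fl:
      "\<And>z1. dist z1 ?z0 < r \<Longrightarrow> P.vert (fst z1) (snd z1) \<Longrightarrow> \<exists>z. z 0 = z1 \<and>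
       (\<forall>t\<in>{0..\<delta>}. dist (z t) ?z0 < \<epsilon> \<and> fst (z t) \<in> S \<and> P.vert (fst (z t)) (snd (z t)) \<and>
          (z has_vector_derivative P.dual_vf \<beta> (z t)) (at t)) \<and>
       dual_related (cinv c (fst z1)) (vec c (cinv c (fst z1)) (snd z1))
         (cinv c (fst (z \<delta>))) (vec c (cinv c (fst (z \<delta>))) (snd (z \<delta>)))"
      using dual_flow[OF x0 \<epsilon>, of \<nu>0 \<beta>] by blast
    have "\<forall>\<^sub>F n in sequentially. dist (zs n) ?z0 < r" using lim \<delta>(2) by (rule tendstoD)
    then have "\<forall>\<^sub>F n in sequentially. \<exists>z. z 0 = zs n \<and> len (z \<delta>) \<le> len ?z0 \<and>
      (\<forall>t\<in>{0..\<delta>}. dist (z t) ?z0 < \<epsilon> \<and> ((\<lambda>t. len (z t)) has_real_derivative P.len_deriv \<beta> (z t)) (at t) \<and>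
        ((\<lambda>t. P.len_deriv \<beta> (z t)) has_real_derivative len_deriv2 \<beta> (z t)) (at t))"
    proof eventually_elim
      case (elim n)
      obtain z where z: "z 0 = zs n" "\<And>t. t \<in> {0..\<delta>} \<Longrightarrow> dist (z t) ?z0 < \<epsilon>" "\<And>t. t \<in> {0..\<delta>} \<Longrightarrow> fst (z t) \<in> S"
        "\<And>t. t \<in> {0..\<delta>} \<Longrightarrow> P.vert (fst (z t)) (snd (z t))"
        "\<And>t. t \<in> {0..\<delta>} \<Longrightarrow> (z has_vector_derivative P.dual_vf \<beta> (z t)) (at t)"
        and rel: "dual_related (cinv c (fst (zs n))) (vec c (cinv c (fst (zs n))) (snd (zs n)))
         (cinv c (fst (z \<delta>))) (vec c (cinv c (fst (z \<delta>))) (snd (z \<delta>)))"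
        using fl[OF elim v(1)] by blast
      have d: "\<delta> \<in> {0..\<delta>}" using \<delta>(1) by simp
      let ?q = "cinv c (fst (z \<delta>))"
      note q = S_D[OF z(3)[OF d]]
      have "vec c ?q (snd (z \<delta>)) \<in> vertical A F ?q" using vert_vec[OF q(1)] z(4)[OF d] q(2) by simp
      from max[OF rel this] have "len (z \<delta>) \<le> len ?z0" unfolding g_vec[OF q(1)] q(2) by simp
      then show ?case using z len_derivative[OF z(3,4,5)] by blast
    qed
    then show ?thesis using \<delta>(1) by blast
  qed
  have F1_le: "P.len_deriv \<beta> ?z0 \<le> 0" for \<beta>
  proof (rule ccontr)
    assume "\<not> P.len_deriv \<beta> ?z0 \<le> 0"
    define m where "m = P.len_deriv \<beta> ?z0 / 2"
    have m: "m > 0" "m < P.len_deriv \<beta> ?z0" using \<open>\<not> P.len_deriv \<beta> ?z0 \<le> 0\<close> by (auto simp: m_def)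
    obtain \<epsilon> where \<epsilon>: "\<epsilon> > 0" "\<And>z. dist z ?z0 < \<epsilon> \<Longrightarrow> dist (P.len_deriv \<beta> z) (P.len_deriv \<beta> ?z0) < m"
      using F1c[of \<beta>] m(1) unfolding continuous_at_eps_delta by blast
    have F1m: "P.len_deriv \<beta> z \<ge> m" if "dist z ?z0 < \<epsilon>" for z
      using \<epsilon>(2)[OF that] by (simp add: m_def dist_real_def abs_if split: if_splits)
    obtain \<delta> where \<delta>: "\<delta> > 0" and ev: "\<forall>\<^sub>F n in sequentially. \<exists>z. z 0 = zs n \<and> len (z \<delta>) \<le> len ?z0 \<and>
      (\<forall>t\<in>{0..\<delta>}. dist (z t) ?z0 < \<epsilon> \<and> ((\<lambda>t. len (z t)) has_real_derivative P.len_deriv \<beta> (z t)) (at t) \<and>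
        ((\<lambda>t. P.len_deriv \<beta> (z t)) has_real_derivative len_deriv2 \<beta> (z t)) (at t))" using flow[OF \<epsilon>(1)] by blast
    \<comment> \<open>Growth at rate at least \<open>m\<close> for time \<open>\<delta>\<close> that
      ends below the supremum forces the start below it by \<open>m * \<delta>\<close>, although the
      starting lengths converge to the supremum.\<close>
    have "\<forall>\<^sub>F n in sequentially. len (zs n) \<le> len ?z0 - m * \<delta>"
      using ev
    proof eventually_elim
      case (elim n)
      then obtain z where z: "z 0 = zs n" "len (z \<delta>) \<le> len ?z0" "\<And>t. t \<in> {0..\<delta>} \<Longrightarrow> dist (z t) ?z0 < \<epsilon>"
        "\<And>t. t \<in> {0..\<delta>} \<Longrightarrow> ((\<lambda>t. len (z t)) has_real_derivative P.len_deriv \<beta> (z t)) (at t)" by blast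
      obtain \<tau> where \<tau>: "0 < \<tau>" "\<tau> < \<delta>" "len (z \<delta>) - len (z 0) = (\<delta> - 0) * P.len_deriv \<beta> (z \<tau>)"
        using MVT2[OF \<delta>, of "\<lambda>t. len (z t)" "\<lambda>t. P.len_deriv \<beta> (z t)"] z(4) by auto
      have "m * \<delta> \<le> \<delta> * P.len_deriv \<beta> (z \<tau>)" using F1m[OF z(3)[of \<tau>]] \<tau> \<delta> by (simp add: mult.commute)
      then show ?case using \<tau>(3) z(1,2) by simp
    qed
    from tendsto_upperbound[OF limf[OF lenc] this] have "len ?z0 \<le> len ?z0 - m * \<delta>" by simp
    then show False using m(1) \<delta> mult_pos_pos[OF m(1) \<delta>] by linarith
  qed
  have F1_0: "P.len_deriv \<beta> ?z0 = 0" for \<beta>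
  proof -
    \<comment> \<open>The derivative is linear in the direction, so a maximum in all directions is
      critical.\<close>
    have "P.len_deriv (- \<beta>) ?z0 = - P.len_deriv \<beta> ?z0"
      using linear_neg[OF P.T_linear2[OF x0]] by (simp add: P.len_deriv_def P.G_lin x0)
    then show ?thesis using F1_le[of \<beta>] F1_le[of "- \<beta>"] by simp
  qed
  then have crit: "GG c x0 (P.T \<beta> x0 \<nu>0) \<nu>0 = 0" for \<beta> by (simp add: P.len_deriv_def)
  obtain \<beta> where \<beta>: "\<beta> \<noteq> 0" "P.vert x0 (P.T \<beta> x0 \<nu>0)"
    using P.kernel_direction[OF x0 v(2) odd] by blast
  have "len_deriv2 \<beta> ?z0 \<le> 0"
  proof (rule ccontr)
    assume "\<not> len_deriv2 \<beta> ?z0 \<le> 0"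
    define m where "m = len_deriv2 \<beta> ?z0 / 2"
    have m: "m > 0" using \<open>\<not> len_deriv2 \<beta> ?z0 \<le> 0\<close> by (auto simp: m_def)
    obtain \<epsilon> where \<epsilon>: "\<epsilon> > 0" "\<And>z. dist z ?z0 < \<epsilon> \<Longrightarrow> dist (len_deriv2 \<beta> z) (len_deriv2 \<beta> ?z0) < m"
      using F2c[of \<beta>] m unfolding continuous_at_eps_delta by blast
    have F2m: "len_deriv2 \<beta> z \<ge> m" if "dist z ?z0 < \<epsilon>" for z
      using \<epsilon>(2)[OF that] unfolding m_def dist_real_def abs_if by (simp split: if_splits)
    obtain \<delta> where \<delta>: "\<delta> > 0" and ev: "\<forall>\<^sub>F n in sequentially. \<exists>z. z 0 = zs n \<and> len (z \<delta>) \<le> len ?z0 \<and>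
      (\<forall>t\<in>{0..\<delta>}. dist (z t) ?z0 < \<epsilon> \<and> ((\<lambda>t. len (z t)) has_real_derivative P.len_deriv \<beta> (z t)) (at t) \<and>
        ((\<lambda>t. P.len_deriv \<beta> (z t)) has_real_derivative len_deriv2 \<beta> (z t)) (at t))" using flow[OF \<epsilon>(1)] by blast
    \<comment> \<open>At \<open>zs n\<close> the first derivative need not vanish; its contribution
      is kept and disappears in the limit, where it is 0.\<close>
    have "\<forall>\<^sub>F n in sequentially. len (zs n) + P.len_deriv \<beta> (zs n) * \<delta> \<le> len ?z0 - m * \<delta>\<^sup>2 / 2"
      using ev
    proof eventually_elim
      case (elim n)
      then obtain z where z: "z 0 = zs n" "len (z \<delta>) \<le> len ?z0" "\<And>t. t \<in> {0..\<delta>} \<Longrightarrow> dist (z t) ?z0 < \<epsilon>"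
        "\<And>t. t \<in> {0..\<delta>} \<Longrightarrow> ((\<lambda>t. len (z t)) has_real_derivative P.len_deriv \<beta> (z t)) (at t)"
        "\<And>t. t \<in> {0..\<delta>} \<Longrightarrow> ((\<lambda>t. P.len_deriv \<beta> (z t)) has_real_derivative len_deriv2 \<beta> (z t)) (at t)" by blast
      show ?case using second_order_growth[OF \<delta> z(4,5) F2m[OF z(3)]] z(1,2) by simp
    qed
    moreover have "(\<lambda>n. len (zs n) + P.len_deriv \<beta> (zs n) * \<delta>) \<longlonglongrightarrow> len ?z0 + P.len_deriv \<beta> ?z0 * \<delta>"
      by (intro tendsto_intros limf lenc F1c)
    ultimately have "len ?z0 + P.len_deriv \<beta> ?z0 * \<delta> \<le> len ?z0 - m * \<delta>\<^sup>2 / 2"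
      by (intro tendsto_upperbound) auto
    moreover have "m * \<delta>\<^sup>2 > 0" using m \<delta> by simp
    ultimately show False using F1_0[of \<beta>] by simp
  qed
  \<comment> \<open>The second derivative is twice the curvature term plus six times a nonnegative
    square.\<close>
  then show ?thesis
    using P.second_variation[OF x0 v(2) \<beta>(2) crit] P.G_nonneg[OF x0, of "P.T \<beta> x0 \<nu>0"] \<beta>(1)
    by (intro exI[of _ \<beta>]) simp
qed

end

section \<open>The limit of a maximising sequence\<close>

theorem theorem1:
  fixes A :: "('m::{t2_space, second_countable_topology}, 'e::euclidean_space) chart set"
    and g :: "'m \<Rightarrow> 'e \<Rightarrow> 'e \<Rightarrow> real"
    and F :: "('m, 'v::euclidean_space \<times> 'h::euclidean_space) chart set"
  assumes "compact (UNIV :: 'm set)"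
    and "smooth_atlas A"
    and "riemannian_metric A g"
    and "riemannian_foliation A g F"
    and "odd DIM('h)"
    and "bounded_holonomy A g F"
  shows "\<exists>p u v. u \<noteq> v \<and> independent {u, v} \<and> sectional_curvature A g p u v \<le> 0"
proof -
  interpret foliated_manifold A g F by unfold_locales (use assms in auto)
  obtain L where L: "\<And>p \<xi> q \<eta>. transport p \<xi> q \<eta> \<Longrightarrow> sqrt (g q \<eta> \<eta>) \<le> L * sqrt (g p \<xi> \<xi>)"
    using assms(6) unfolding bounded_holonomy_def transport_iff by blast
  \<comment> \<open>An arbitrary base point; types are nonempty.\<close>
  define p0 :: 'm where "p0 = undefined"
  obtain \<nu>0 where \<nu>0: "\<nu>0 \<in> vertical A F p0" "\<nu>0 \<noteq> 0" using vertical_nonzero by blast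
  define E where "E = {g q \<nu> \<nu> | q \<nu>. dual_related p0 \<nu>0 q \<nu> \<and> \<nu> \<in> vertical A F q}"
  define \<rho> where "\<rho> = Sup E"
  have bdd: "bdd_above E"
    by (rule bdd_aboveI[of _ "L\<^sup>2 * g p0 \<nu>0 \<nu>0"]) (auto simp: E_def intro: dual_related_bound[OF L])
  have E0: "g p0 \<nu>0 \<nu>0 \<in> E" using dual_related_refl \<nu>0 by (auto simp: E_def)
  have "g p0 \<nu>0 \<nu>0 \<le> \<rho>" unfolding \<rho>_def by (rule cSup_upper[OF E0 bdd])
  then have \<rho>: "\<rho> > 0" using g_pos[OF \<nu>0(2), of p0] by linarith
  have Emax: "g q \<nu> \<nu> \<le> \<rho>" if "dual_related p0 \<nu>0 q \<nu>" "\<nu> \<in> vertical A F q" for q \<nu>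
    unfolding \<rho>_def by (rule cSup_upper[OF _ bdd]) (use that in \<open>auto simp: E_def\<close>)
  have "\<exists>q \<nu>. dual_related p0 \<nu>0 q \<nu> \<and> \<nu> \<in> vertical A F q \<and> \<rho> - 1 / real (Suc n) < g q \<nu> \<nu>" for n
  proof -
    have "\<rho> - 1 / real (Suc n) < Sup E" by (simp add: \<rho>_def)
    then obtain y where "y \<in> E" "\<rho> - 1 / real (Suc n) < y" using less_cSupE[of _ E] E0 by blast
    then show ?thesis by (auto simp: E_def)
  qed
  then obtain qs \<nu>s where qs: "\<And>n. dual_related p0 \<nu>0 (qs n) (\<nu>s n)" "\<And>n. \<nu>s n \<in> vertical A F (qs n)"
    "\<And>n. \<rho> - 1 / real (Suc n) < g (qs n) (\<nu>s n) (\<nu>s n)" by metis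
  have lim\<rho>: "(\<lambda>n. g (qs n) (\<nu>s n) (\<nu>s n)) \<longlonglongrightarrow> \<rho>"
  proof (rule tendsto_sandwich)
    show "\<forall>\<^sub>F n in sequentially. \<rho> - 1 / real (Suc n) \<le> g (qs n) (\<nu>s n) (\<nu>s n)" using qs(3) by (simp add: less_imp_le)
    show "\<forall>\<^sub>F n in sequentially. g (qs n) (\<nu>s n) (\<nu>s n) \<le> \<rho>" using Emax qs by simp
    have "(\<lambda>n. \<rho> - 1 / real (Suc n)) \<longlonglongrightarrow> \<rho> - 0"
      using LIMSEQ_inverse_real_of_nat by (intro tendsto_diff tendsto_const) (simp add: inverse_eq_divide)
    then show "(\<lambda>n. \<rho> - 1 / real (Suc n)) \<longlonglongrightarrow> \<rho>" by simp
  qed simp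
  obtain p r where r: "strict_mono (r :: nat \<Rightarrow> nat)" "(qs \<circ> r) \<longlonglongrightarrow> p"
    using seq_compactE[OF compact_imp_seq_compact[OF assms(1)], of qs] by (metis UNIV_I)
  define c where "c = chart_at A p"
  have c: "c \<in> A" "p \<in> cdom c" using chart_at by (auto simp: c_def)
  obtain \<phi> U k where "foliated_patch A g F c \<phi> U k" and pU: "p \<in> U"
    using foliated_patch_exists[OF c] .
  then interpret foliated_patch A g F c \<phi> U k by simp
  define x0 where "x0 = cmap c p"
  have x0: "x0 \<in> S" using S_mem[OF pU] by (simp add: x0_def)
  define xs where "xs n = cmap c (qs (r n))" for n
  define ns where "ns n = comp c (qs (r n)) (\<nu>s (r n))" for n
  have evU: "\<forall>\<^sub>F n in sequentially. qs (r n) \<in> U"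
    using topological_tendstoD[OF r(2) open_U pU] by simp
  have xlim: "xs \<longlonglongrightarrow> x0"
  proof -
    have "isCont (cmap c) p"
      using chart_continuous(1)[OF cchart] chart_open(1)[OF cchart] c(2) by (simp add: continuous_on_eq_continuous_at)
    from isCont_tendsto_compose[OF this r(2)] show ?thesis by (simp add: xs_def[abs_def] x0_def)
  qed
  obtain a where a: "a > 0" "\<forall>\<^sub>F x in nhds x0. x \<in> S \<and> (\<forall>w. a * (norm w)\<^sup>2 \<le> GG c x w w)"
    using P.uniformly_coercive[OF x0] by blast
  \<comment> \<open>Convergence of the base points lets one coercivity constant serve all late
    fibres, which bounds the coordinate vectors \<open>ns n\<close>.\<close>
  have "\<forall>\<^sub>F n in sequentially. \<forall>w. a * (norm w)\<^sup>2 \<le> GG c (xs n) w w"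
    using filterlim_compose[of _ "nhds x0"] xlim a(2) by (auto dest: filterlim_iff[THEN iffD1, rule_format] elim: eventually_mono)
  then obtain N where N: "\<And>n. n \<ge> N \<Longrightarrow> qs (r n) \<in> U" "\<And>n w. n \<ge> N \<Longrightarrow> a * (norm w)\<^sup>2 \<le> GG c (xs n) w w"
    using evU eventually_conj[of _ sequentially] unfolding eventually_sequentially by (metis nat_le_linear order_trans)
  have len: "GG c (xs n) (ns n) (ns n) = g (qs (r n)) (\<nu>s (r n)) (\<nu>s (r n))" if "n \<ge> N" for n
    using GG_comp[OF cA, of "qs (r n)"] N(1)[OF that] Uc by (auto simp: xs_def ns_def)
  have "ns (n + N) \<in> cball 0 (sqrt (\<rho> / a))" for n
  proof -
    have "a * (norm (ns (n + N)))\<^sup>2 \<le> \<rho>"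
      using N(2)[of "n + N" "ns (n + N)"] len[of "n + N"] Emax[OF qs(1,2)] by (simp add: order_trans)
    then have "(norm (ns (n + N)))\<^sup>2 \<le> \<rho> / a" using a(1) by (simp add: field_simps)
    then show ?thesis by (simp add: real_le_rsqrt)
  qed
  then obtain n0 r2 where r2: "strict_mono (r2 :: nat \<Rightarrow> nat)" "((\<lambda>n. ns (n + N)) \<circ> r2) \<longlonglongrightarrow> n0"
    using seq_compactE[OF compact_imp_seq_compact[OF compact_cball[of "0 :: 'e" "sqrt (\<rho> / a)"]], of "\<lambda>n. ns (n + N)"]
    by metis
  \<comment> \<open>The shift by \<open>N\<close> discards the indices whose base points may lie
    outside \<open>U\<close>.\<close>
  define s where "s n = r2 n + N" for n
  define zs where "zs n = (xs (s n), ns (s n))" for n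
  have fs: "filterlim s at_top sequentially"
    using r2(1) by (intro filterlim_subseq) (simp add: s_def strict_mono_def)
  have sN: "s n \<ge> N" for n by (simp add: s_def)
  have zlim: "zs \<longlonglongrightarrow> (x0, n0)"
    unfolding zs_def
  proof (rule tendsto_Pair)
    show "(\<lambda>n. xs (s n)) \<longlonglongrightarrow> x0" by (rule filterlim_compose[OF xlim fs])
    show "(\<lambda>n. ns (s n)) \<longlonglongrightarrow> n0" using r2(2) by (simp add: o_def s_def)
  qed
  have zU: "cinv c (fst (zs n)) = qs (r (s n))" "qs (r (s n)) \<in> U" "vec c (qs (r (s n))) (snd (zs n)) = \<nu>s (r (s n))" for n
    using N(1)[OF sN[of n]] Uc cchart cA by (auto simp: zs_def xs_def ns_def)
  have zv: "P.vert (fst (zs n)) (snd (zs n))" for n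
    using vert_iff[OF zU(2)] qs(2) by (auto simp: zs_def xs_def ns_def)
  have z0: "(x0, n0) \<in> P.\<Omega>" using x0 by simp
  have v0: "P.vert x0 n0"
  proof -
    have "isCont (\<lambda>z. fd pr (fst z) (snd z)) (x0, n0)"
      using smooth_on_continuous[OF smooth_on_family_snd[OF P.open_S P.pi_lin smooth_on_fd_const[OF P.pi_smooth]]] P.open_Omega z0
      by (simp add: continuous_on_eq_continuous_at)
    from isCont_tendsto_compose[OF this zlim] show ?thesis by (simp add: zv LIMSEQ_const_iff)
  qed
  have len0: "GG c x0 n0 n0 = \<rho>"
  proof -
    have "isCont len (x0, n0)"
      using smooth_on_continuous[OF P.GG_smooth_Omega[OF P.snd_smooth P.snd_smooth]] P.open_Omega z0
      by (simp add: continuous_on_eq_continuous_at)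
    from isCont_tendsto_compose[OF this zlim]
    have "(\<lambda>n. g (qs (r (s n))) (\<nu>s (r (s n))) (\<nu>s (r (s n)))) \<longlonglongrightarrow> GG c x0 n0 n0"
      by (simp add: zs_def len[OF sN])
    moreover have "(\<lambda>n. g (qs (r (s n))) (\<nu>s (r (s n))) (\<nu>s (r (s n)))) \<longlonglongrightarrow> \<rho>"
      using filterlim_compose[OF filterlim_compose[OF lim\<rho> filterlim_subseq[OF r(1)]] fs] by simp
    ultimately show ?thesis by (rule LIMSEQ_unique)
  qed
  \<comment> \<open>Whatever is dually related to a member of the sequence is, by transitivity,
    related to the initial vector as well, so the supremum bounds it.\<close>
  have mx: "g q \<nu> \<nu> \<le> len (x0, n0)"
    if "dual_related (cinv c (fst (zs n))) (vec c (cinv c (fst (zs n))) (snd (zs n))) q \<nu>" "\<nu> \<in> vertical A F q" for n q \<nu>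
    using Emax[OF dual_related_trans[OF qs(1) that(1)[unfolded zU]] that(2)] len0 by simp
  have "\<exists>\<beta>. \<beta> \<noteq> 0 \<and> GG c x0 (curvature (GG c) x0 n0 (P.lift x0 \<beta>) (P.lift x0 \<beta>)) n0 \<le> 0"
    by (rule extremal_curvature[OF x0 zlim zv v0 mx assms(5)])
  then obtain \<beta> where \<beta>: "\<beta> \<noteq> 0" "GG c x0 (curvature (GG c) x0 n0 (P.lift x0 \<beta>) (P.lift x0 \<beta>)) n0 \<le> 0"
    by (elim exE conjE)
  define w where "w = P.lift x0 \<beta>"
  have gG: "g p u v = GG c x0 u v" for u v using GG_chart_at[of p u v] by (simp add: c_def x0_def)
  have n0: "n0 \<noteq> 0" using len0 \<rho> by (auto simp: P.G_lin x0)
  have w: "w \<noteq> 0" using P.pi_lift[OF x0, of \<beta>] \<beta>(1) by (auto simp: w_def P.pi_simps x0)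
  have orth: "g p w n0 = 0" using P.lift_hor[OF x0, of \<beta>] v0 by (simp add: gG w_def P.hor_def)
  have notin: "n0 \<notin> span {w}"
  proof
    assume "n0 \<in> span {w}"
    then obtain t where "n0 = t *\<^sub>R w" by (auto simp: span_singleton)
    then have "g p n0 n0 = t * g p w n0" by (metis bilinear_lmul[OF g_bil] real_scaleR_def)
    then show False using orth g_pos[OF n0, of p] by simp
  qed
  have "n0 \<noteq> w" using notin span_base[of w "{w}"] by auto
  moreover have "independent {n0, w}" using notin w by (simp add: independent_insert)
  moreover have "sectional_curvature A g p n0 w \<le> 0"
  proof -
    \<comment> \<open>Cauchy-Schwarz makes the denominator of the sectional curvature nonnegative,
      so its sign is decided by the numerator.\<close>
    have "(g p n0 w)\<^sup>2 \<le> g p n0 n0 * g p w w" by (rule inner_product_Cauchy_Schwarz[OF g_ip])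
    then show ?thesis
      using \<beta>(2) unfolding sectional_curvature_def Let_def c_def[symmetric] x0_def[symmetric]
      by (intro divide_nonpos_nonneg) (simp_all add: gG w_def)
  qed
  ultimately show ?thesis by blast
qed

end
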